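(* Let $H$ be a Hopf fibration of $S^3$. The subgroup $\mathrm{Aut}(H)$ of automorphisms of $H$ is a smooth Fréchet submanifold of the Fréchet Lie group $\mathrm{Diff}(S^3)$.
   Context: "Smooth" means $C^\infty$. A Hopf fibration of the unit sphere $S^3\subset\mathbb{R}^4$ is the fibration by the great circles in which $S^3$ meets the complex lines of $\mathbb{R}^4\cong\mathbb{C}^2$, for some orthogonal complex structure on $\mathbb{R}^4$. $\mathrm{Diff}(S^3)$ is the group of all smooth diffeomorphisms of $S^3$ with the $C^\infty$ topology. It is a Fréchet Lie group modeled on the Fréchet space $\mathrm{VF}(S^3)$ of smooth vector fields on $S^3$; charts near the identity come from the Riemannian exponential map, $V\mapsto (x\mapsto \exp_x V(x))$ for $V$ in a small neighborhood of $0$, and are moved to other points by composition. $\mathrm{Aut}(H)\subset\mathrm{Diff}(S^3)$ is the subgroup of diffeomorphisms of $S^3$ which permute the fibers of $H$ (each fiber is mapped onto a fiber, not necessarily isometrically). Definition (Hamilton): Let $M$ be a Fréchet manifold and $N\subset M$ a closed subset. $N$ is a Fréchet submanifold of $M$ if every point of $N$ lies in the domain of a (smooth) coordinate chart on $M$ with range in a product of Fréchet spaces $F\times G$ such that a point of the domain of the chart lies in $N$ if and only if its image under the chart lies in $F\times\{0\}$. *)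

theory Defs
  imports "HOL-Analysis.Analysis" "HOL-Library.Function_Algebras"
begin

section \<open>Frechet spaces and smooth maps between them\<close>

text \<open>
  A topological vector space is given by a topology whose underlying set is a linear
  subspace of an ambient real vector space.  Maps on the sphere live in the
  vector space of all functions, with pointwise operations.
\<close>

instantiation "fun" :: (type, real_vector) real_vector
begin

definition scaleR_fun :: "real \<Rightarrow> ('a \<Rightarrow> 'b) \<Rightarrow> 'a \<Rightarrow> 'b"
  where "scaleR_fun c f = (\<lambda>x. c *\<^sub>R f x)"

instance
  by standard (auto simp: scaleR_fun_def plus_fun_def fun_eq_iff scaleR_add_right scaleR_add_left)

end

definition seminorm_on :: "'a::real_vector set \<Rightarrow> ('a \<Rightarrow> real) \<Rightarrow> bool" where
  "seminorm_on V p \<longleftrightarrow>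
     (\<forall>x\<in>V. 0 \<le> p x) \<and>
     (\<forall>x\<in>V. \<forall>y\<in>V. p (x + y) \<le> p x + p y) \<and>
     (\<forall>x\<in>V. \<forall>c. p (c *\<^sub>R x) = \<bar>c\<bar> * p x)"

definition seminorm_topology :: "'a::real_vector set \<Rightarrow> ('a \<Rightarrow> real) set \<Rightarrow> 'a topology" where
  "seminorm_topology V P =
     topology_generated_by {{y \<in> V. p (y - x) < e} | p x e. p \<in> P \<and> x \<in> V \<and> 0 < e}"

text \<open>A Hausdorff complete space whose topology is given by countably many seminorms.\<close>

definition frechet_space :: "'a::real_vector topology \<Rightarrow> bool" where
  "frechet_space E \<longleftrightarrow>
     subspace (topspace E) \<and>
     (\<exists>p :: nat \<Rightarrow> 'a \<Rightarrow> real.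
        (\<forall>k. seminorm_on (topspace E) (p k)) \<and>
        E = seminorm_topology (topspace E) (range p) \<and>
        (\<forall>x\<in>topspace E. (\<forall>k. p k x = 0) \<longrightarrow> x = 0) \<and>
        (\<forall>s :: nat \<Rightarrow> 'a.
           range s \<subseteq> topspace E \<and>
           (\<forall>k. \<forall>e>0. \<exists>N. \<forall>i\<ge>N. \<forall>j\<ge>N. p k (s i - s j) < e) \<longrightarrow>
           (\<exists>l. limitin E s l sequentially)))"

text \<open>
  Smoothness in the sense of Hamilton: for every \<open>n\<close>, the \<open>n\<close>-th derivative, obtained as an iterated
  directional derivative, exists and is jointly continuous as a map \<open>U \<times> E \<times> \<dots> \<times> E \<rightarrow> F\<close>.
  Here \<open>D x [h\<^sub>1, \<dots>, h\<^sub>n]\<close> is the value of the \<open>n\<close>-th derivative at \<open>x\<close> in the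
  directions \<open>h\<^sub>1, \<dots>, h\<^sub>n\<close>.
\<close>

definition frechet_smooth ::
    "'a::real_vector topology \<Rightarrow> 'b::real_vector topology \<Rightarrow> 'a set \<Rightarrow> ('a \<Rightarrow> 'b) \<Rightarrow> bool" where
  "frechet_smooth E F U f \<longleftrightarrow>
     openin E U \<and>
     (\<exists>D :: 'a \<Rightarrow> 'a list \<Rightarrow> 'b.
        (\<forall>x\<in>U. D x [] = f x) \<and>
        (\<forall>x\<in>U. \<forall>hs\<in>lists (topspace E). \<forall>h\<in>topspace E.
           limitin F (\<lambda>t. (1 / t) *\<^sub>R (D (x + t *\<^sub>R h) hs - D x hs)) (D x (hs @ [h])) (at (0::real))) \<and>
        (\<forall>n. continuous_map
               (prod_topology (subtopology E U) (product_topology (\<lambda>_. E) {..<n})) F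
               (\<lambda>(x, h). D x (map h [0..<n]))))"


section \<open>Frechet manifolds and submanifolds\<close>

definition chart ::
    "'m topology \<Rightarrow> 'e::real_vector topology \<Rightarrow> 'm set \<Rightarrow> ('m \<Rightarrow> 'e) \<Rightarrow> bool" where
  "chart X E U \<phi> \<longleftrightarrow>
     openin X U \<and> openin E (\<phi> ` U) \<and>
     homeomorphic_map (subtopology X U) (subtopology E (\<phi> ` U)) \<phi>"

definition charts_compatible ::
    "'e::real_vector topology \<Rightarrow> 'm set \<Rightarrow> ('m \<Rightarrow> 'e) \<Rightarrow>
     'f::real_vector topology \<Rightarrow> 'm set \<Rightarrow> ('m \<Rightarrow> 'f) \<Rightarrow> bool" where
  "charts_compatible E U \<phi> F V \<psi> \<longleftrightarrow>
     frechet_smooth E F (\<phi> ` (U \<inter> V)) (\<lambda>v. \<psi> (inv_into U \<phi> v)) \<and>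
     frechet_smooth F E (\<psi> ` (U \<inter> V)) (\<lambda>w. \<phi> (inv_into V \<psi> w))"

text \<open>
  A manifold is given by a topological space \<open>X\<close>, a model space \<open>E\<close> and an atlas \<open>A\<close>, i.e. a set of
  pairs of a chart domain and a chart.
\<close>

definition frechet_manifold ::
    "'m topology \<Rightarrow> 'e::real_vector topology \<Rightarrow> ('m set \<times> ('m \<Rightarrow> 'e)) set \<Rightarrow> bool" where
  "frechet_manifold X E A \<longleftrightarrow>
     Hausdorff_space X \<and> frechet_space E \<and>
     (\<forall>(U, \<phi>)\<in>A. chart X E U \<phi>) \<and>
     (\<Union>(U, \<phi>)\<in>A. U) = topspace X \<and>
     (\<forall>(U, \<phi>)\<in>A. \<forall>(V, \<psi>)\<in>A. charts_compatible E U \<phi> E V \<psi>)"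

text \<open>Charts compatible with the atlas; their model space \<open>F\<close> may differ from \<open>E\<close>.\<close>

definition smooth_chart ::
    "'m topology \<Rightarrow> 'e::real_vector topology \<Rightarrow> ('m set \<times> ('m \<Rightarrow> 'e)) set \<Rightarrow>
     'f::real_vector topology \<Rightarrow> 'm set \<Rightarrow> ('m \<Rightarrow> 'f) \<Rightarrow> bool" where
  "smooth_chart X E A F U \<phi> \<longleftrightarrow>
     chart X F U \<phi> \<and> (\<forall>(V, \<psi>)\<in>A. charts_compatible F U \<phi> E V \<psi>)"

text \<open>
  The spaces \<open>F\<close> and \<open>G\<close> range over all Frechet spaces carried by subspaces of the ambient vector
  space of the model space.  This is no restriction: the derivative of a chart transition at
  a point is a topological isomorphism from \<open>E\<close> to \<open>F \<times> G\<close>, so both factors are isomorphic to closed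
  subspaces of \<open>E\<close>.
\<close>

definition frechet_submanifold ::
    "'m topology \<Rightarrow> 'e::real_vector topology \<Rightarrow> ('m set \<times> ('m \<Rightarrow> 'e)) set \<Rightarrow> 'm set \<Rightarrow> bool" where
  "frechet_submanifold X E A N \<longleftrightarrow>
     frechet_manifold X E A \<and> closedin X N \<and>
     (\<forall>x\<in>N. \<exists>(F :: 'e topology) (G :: 'e topology) U \<phi>.
        frechet_space F \<and> frechet_space G \<and>
        smooth_chart X E A (prod_topology F G) U \<phi> \<and>
        x \<in> U \<and> (\<forall>y\<in>U. y \<in> N \<longleftrightarrow> \<phi> y \<in> topspace F \<times> {0}))"


section \<open>The diffeomorphism group of the three-sphere\<close>

text \<open>\<open>C\<^sup>\<infinity>\<close> maps: differentiable, with all directional derivatives again \<open>C\<^sup>\<infinity>\<close>.\<close>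

coinductive smooth_on :: "'a::real_normed_vector set \<Rightarrow> ('a \<Rightarrow> 'b::real_normed_vector) \<Rightarrow> bool"
  for U where
  "\<lbrakk>\<forall>x\<in>U. (f has_derivative f' x) (at x); \<forall>h. smooth_on U (\<lambda>x. f' x h)\<rbrakk> \<Longrightarrow> smooth_on U f"

abbreviation S3 :: "(real^4) set" where
  "S3 \<equiv> sphere 0 1"

definition smooth_on_S3 :: "(real^4 \<Rightarrow> real^4) \<Rightarrow> bool" where
  "smooth_on_S3 f \<longleftrightarrow> (\<exists>U g. open U \<and> S3 \<subseteq> U \<and> smooth_on U g \<and> (\<forall>x\<in>S3. g x = f x))"

text \<open>
  Maps with domain \<open>S\<^sup>3\<close> are represented by functions on \<open>\<real>\<^sup>4\<close> that vanish outside \<open>S\<^sup>3\<close>, so that equality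
  of functions is equality on \<open>S\<^sup>3\<close>.
\<close>

definition Cinf :: "(real^4 \<Rightarrow> real^4) set" where
  "Cinf = {f. smooth_on_S3 f \<and> (\<forall>x. x \<notin> S3 \<longrightarrow> f x = 0)}"

definition VF :: "(real^4 \<Rightarrow> real^4) set" where
  "VF = {V \<in> Cinf. \<forall>x\<in>S3. V x \<bullet> x = 0}"

definition Diff :: "(real^4 \<Rightarrow> real^4) set" where
  "Diff = {f \<in> Cinf. bij_betw f S3 S3 \<and> smooth_on_S3 (inv_into S3 f)}"

text \<open>
  The \<open>C\<^sup>\<infinity>\<close> topology is uniform convergence of all derivatives.  To differentiate a map
  on \<open>S\<^sup>3\<close> in the coordinates of \<open>\<real>\<^sup>4\<close>, extend it to \<open>\<real>\<^sup>4 - {0}\<close> as a function constant on rays.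
\<close>

definition radial_ext :: "(real^4 \<Rightarrow> real^4) \<Rightarrow> real^4 \<Rightarrow> real^4" where
  "radial_ext f = (\<lambda>x. f (x /\<^sub>R norm x))"

primrec iterated_derivative ::
    "'a::real_normed_vector list \<Rightarrow> ('a \<Rightarrow> 'b::real_normed_vector) \<Rightarrow> 'a \<Rightarrow> 'b" where
  "iterated_derivative [] f = f"
| "iterated_derivative (h # hs) f = (\<lambda>x. frechet_derivative (iterated_derivative hs f) (at x) h)"

definition Cinf_seminorm :: "(real^4) list \<Rightarrow> (real^4 \<Rightarrow> real^4) \<Rightarrow> real" where
  "Cinf_seminorm hs f = (SUP x\<in>S3. norm (iterated_derivative hs (radial_ext f) x))"

definition Cinf_topology :: "(real^4 \<Rightarrow> real^4) topology" where
  "Cinf_topology = seminorm_topology Cinf (Cinf_seminorm ` lists Basis)"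

definition VF_topology :: "(real^4 \<Rightarrow> real^4) topology" where
  "VF_topology = subtopology Cinf_topology VF"

definition Diff_topology :: "(real^4 \<Rightarrow> real^4) topology" where
  "Diff_topology = subtopology Cinf_topology Diff"

text \<open>
  The Riemannian exponential map of the unit sphere at \<open>x\<close>, applied to a tangent vector \<open>v\<close> orthogonal
  to \<open>x\<close>: the point at time 1 on the great circle with initial point \<open>x\<close> and initial velocity \<open>v\<close>.
  For \<open>v = 0\<close> the second summand is 0 because division by 0 yields 0.
\<close>

definition sphere_exp :: "real^4 \<Rightarrow> real^4 \<Rightarrow> real^4" where
  "sphere_exp x v = cos (norm v) *\<^sub>R x + (sin (norm v) / norm v) *\<^sub>R v"

definition exp_field :: "(real^4 \<Rightarrow> real^4) \<Rightarrow> real^4 \<Rightarrow> real^4" where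
  "exp_field V = (\<lambda>x. if x \<in> S3 then sphere_exp x (V x) else 0)"

text \<open>
  A neighbourhood of 0 on which \<open>exp_field\<close> is a homeomorphism onto a neighbourhood of the identity:
  the injectivity radius of \<open>S\<^sup>3\<close> is \<open>\<pi>\<close>.
\<close>

definition exp_domain :: "(real^4 \<Rightarrow> real^4) set" where
  "exp_domain = {V \<in> VF. (\<forall>x\<in>S3. norm (V x) < pi) \<and> exp_field V \<in> Diff}"

definition compose_S3 :: "(real^4 \<Rightarrow> real^4) \<Rightarrow> (real^4 \<Rightarrow> real^4) \<Rightarrow> real^4 \<Rightarrow> real^4" where
  "compose_S3 g f = (\<lambda>x. if x \<in> S3 then g (f x) else 0)"

text \<open>The inverse of the chart at \<open>f\<close> is \<open>V \<mapsto> exp_field V \<circ> f\<close>.\<close>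

definition Diff_parametrization ::
    "(real^4 \<Rightarrow> real^4) \<Rightarrow> (real^4 \<Rightarrow> real^4) \<Rightarrow> real^4 \<Rightarrow> real^4" where
  "Diff_parametrization f V = compose_S3 (exp_field V) f"

definition Diff_atlas ::
    "((real^4 \<Rightarrow> real^4) set \<times> ((real^4 \<Rightarrow> real^4) \<Rightarrow> real^4 \<Rightarrow> real^4)) set" where
  "Diff_atlas =
     {(Diff_parametrization f ` exp_domain, inv_into exp_domain (Diff_parametrization f)) | f. f \<in> Diff}"


section \<open>Hopf fibrations and their automorphisms\<close>

definition orthogonal_complex_structure :: "(real^4 \<Rightarrow> real^4) \<Rightarrow> bool" where
  "orthogonal_complex_structure J \<longleftrightarrow> orthogonal_transformation J \<and> (\<forall>v. J (J v) = - v)"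

definition complex_lines :: "(real^4 \<Rightarrow> real^4) \<Rightarrow> (real^4) set set" where
  "complex_lines J = {span {v, J v} | v. v \<noteq> 0}"

text \<open>A fibration of \<open>S\<^sup>3\<close> is represented by the set of its fibers.\<close>

definition hopf_fibration :: "(real^4) set set \<Rightarrow> bool" where
  "hopf_fibration H \<longleftrightarrow>
     (\<exists>J. orthogonal_complex_structure J \<and> H = {S3 \<inter> L | L. L \<in> complex_lines J})"

definition Aut :: "(real^4) set set \<Rightarrow> (real^4 \<Rightarrow> real^4) set" where
  "Aut H = {f \<in> Diff. \<forall>C\<in>H. f ` C \<in> H}"

end

theory Submission
  imports Defs
begin

text \<open>
  Write \<open>J\<close> for the complex structure and \<open>R\<^sub>t = cos t + sin t J\<close>.  Near a diffeomorphism
  \<open>f\<close>, instead of the Riemannian exponential map use the chart \<open>V \<mapsto> (x \<mapsto> E (f x, V (f x)))\<close>, where for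
  \<open>v = a J x + b\<close> with \<open>b\<close> orthogonal to the complex line of \<open>x\<close> the point \<open>E (x, v)\<close> is the
  normalization of \<open>(1 + a J) (x + b)\<close>.  The fiber through \<open>E (x, v)\<close> depends only on
  the line spanned by \<open>x + b\<close>, so for \<open>f\<close> in \<open>Aut H\<close> this diffeomorphism lies in \<open>Aut H\<close> if and only if the
  horizontal part of \<open>V\<close> is equivariant under all \<open>R\<^sub>t\<close>.  That is the kernel of a continuous linear projection of the
  space of vector fields, namely the horizontal part minus its average over the circle, and the model space
  splits accordingly as \<open>F \<times> G\<close>.

  All the maps between spaces of vector fields that occur are superposition operators
  \<open>V \<mapsto> (x \<mapsto> \<Phi> (x, V (k x)))\<close>.  Their smoothness is reduced to finite dimensions: a map from a topological space \<open>X\<close>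
  into the \<open>C\<^sup>\<infinity>\<close> maps on the sphere is continuous as soon as all derivatives of its values are jointly continuous on
  \<open>X \<times> S\<^sup>3\<close>, and the evaluation map itself has this property.
\<close>

section \<open>Smooth families of maps\<close>

text \<open>For the Riemannian exponential map the fiber through the image point depends on the
  vertical as well as the horizontal part of the tangent vector, so lying in \<open>Aut H\<close>
  would not be a linear condition. Multiplication by 1 + a J moves a point only within its complex
  line, which removes the vertical part from the condition. That whole fibers are still covered
  holds because the phase shift arctan a stays between -\<pi>/2 and \<pi>/2. A closed subspace of a
  Frechet space need not have a closed complement; compactness of the circle supplies one, since
  averaging is a continuous projection. Hamilton's derivatives are limits in the C-infinity
  topology, while evaluation at points gives pointwise limits only. The gap is bridged by writing a
  difference quotient as the integral over s in [0, 1] of the derivative at V + s t h, a family that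
  is continuous at t = 0 too. The adapted chart must be compatible with the exponential atlas, so
  transitions are treated for any pair of local additions.\<close>

definition jointly_continuous ::
    "'p topology \<Rightarrow> 'a::topological_space set \<Rightarrow> ('p \<Rightarrow> 'a \<Rightarrow> 'b::topological_space) \<Rightarrow> bool" where
  "jointly_continuous X U u \<longleftrightarrow>
     continuous_map (prod_topology X (top_of_set U)) euclidean (\<lambda>(p, x). u p x)"

text \<open>\<open>X\<close> carries no metric, so closeness of parameters is expressed by an open
  set and only the variable gets a radius.\<close>

lemma jointly_continuous_iff:
  fixes U :: "'a::metric_space set" and u :: "'p \<Rightarrow> 'a \<Rightarrow> 'b::metric_space"
  shows "jointly_continuous X U u \<longleftrightarrow>
    (\<forall>p\<in>topspace X. \<forall>x\<in>U. \<forall>e>0. \<exists>N d. openin X N \<and> p \<in> N \<and> d > 0 \<and>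
       (\<forall>q\<in>N. \<forall>y\<in>U. dist y x < d \<longrightarrow> dist (u q y) (u p x) < e))" (is "?L \<longleftrightarrow> ?R")
proof
  assume L: ?L
  show ?R
  proof (intro ballI allI impI)
    fix p x and e :: real assume p: "p \<in> topspace X" and x: "x \<in> U" and e: "e > 0"
    let ?W = "{z \<in> topspace (prod_topology X (top_of_set U)). (\<lambda>(p, x). u p x) z \<in> ball (u p x) e}"
    have W: "openin (prod_topology X (top_of_set U)) ?W"
      using L unfolding jointly_continuous_def
      by (rule openin_continuous_map_preimage) (simp flip: open_openin)
    have "(p, x) \<in> ?W" using p x e by simp
    from W[unfolded openin_prod_topology_alt, rule_format, OF this]
    obtain N V where NV: "openin X N" "openin (top_of_set U) V" "p \<in> N" "x \<in> V" "N \<times> V \<subseteq> ?W"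
      by (elim exE conjE) (rule that)
    obtain d where d: "d > 0" "ball x d \<inter> U \<subseteq> V"
      using NV(2,4) by (meson openin_contains_ball)
    show "\<exists>N d. openin X N \<and> p \<in> N \<and> d > 0 \<and> (\<forall>q\<in>N. \<forall>y\<in>U. dist y x < d \<longrightarrow> dist (u q y) (u p x) < e)"
    proof (intro exI conjI ballI impI)
      fix q y assume "q \<in> N" "y \<in> U" "dist y x < d"
      then have "y \<in> V" using d by (auto simp: dist_commute)
      then have "(q, y) \<in> ?W" using NV(5) \<open>q \<in> N\<close> by blast
      then show "dist (u q y) (u p x) < e" by (simp add: dist_commute)
    qed (use NV d in auto)
  qed
next
  assume R: ?R
  show ?L
    unfolding jointly_continuous_def continuous_map_def
  proof (intro conjI allI impI)
    fix O' :: "'b set" assume "openin euclidean O'"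
    then have O: "open O'" by simp
    show "openin (prod_topology X (top_of_set U))
          {z \<in> topspace (prod_topology X (top_of_set U)). (\<lambda>(p, x). u p x) z \<in> O'}"
      unfolding openin_prod_topology_alt
    proof (intro allI impI)
      fix p x assume "(p, x) \<in> {z \<in> topspace (prod_topology X (top_of_set U)). (\<lambda>(p, x). u p x) z \<in> O'}"
      then have p: "p \<in> topspace X" and x: "x \<in> U" and uO: "u p x \<in> O'" by auto
      obtain e where e: "e > 0" "ball (u p x) e \<subseteq> O'" using O uO open_contains_ball by blast
      obtain N d where N: "openin X N" "p \<in> N" "d > 0"
        "\<And>q y. q\<in>N \<Longrightarrow> y\<in>U \<Longrightarrow> dist y x < d \<Longrightarrow> dist (u q y) (u p x) < e"
        using R p x e by meson
      show "\<exists>M V. openin X M \<and> openin (top_of_set U) V \<and> p \<in> M \<and> x \<in> V \<and>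
           M \<times> V \<subseteq> {z \<in> topspace (prod_topology X (top_of_set U)). (\<lambda>(p, x). u p x) z \<in> O'}"
      proof (intro exI conjI)
        show "openin X N" "p \<in> N" using N by auto
        show "openin (top_of_set U) (U \<inter> ball x d)" by (simp add: openin_open_Int)
        show "x \<in> U \<inter> ball x d" using x N by auto
        show "N \<times> (U \<inter> ball x d) \<subseteq> {z \<in> topspace (prod_topology X (top_of_set U)). (\<lambda>(p, x). u p x) z \<in> O'}"
          using N e openin_subset[OF N(1)] by (auto simp: dist_commute subset_iff mem_ball)
      qed
    qed
  qed auto
qed

lemma jointly_continuous_cong:
  assumes "jointly_continuous X U u" "\<And>p x. p \<in> topspace X \<Longrightarrow> x \<in> U \<Longrightarrow> u p x = v p x"
  shows "jointly_continuous X U v"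
  using assms unfolding jointly_continuous_def
  by (auto elim!: continuous_map_eq)

lemma jointly_continuous_compose:
  assumes "jointly_continuous X O' g" "jointly_continuous X U f"
    "\<And>p x. p \<in> topspace X \<Longrightarrow> x \<in> U \<Longrightarrow> f p x \<in> O'"
  shows "jointly_continuous X U (\<lambda>p x. g p (f p x))"
proof -
  have "continuous_map (prod_topology X (top_of_set U)) (prod_topology X (top_of_set O')) (\<lambda>z. (fst z, f (fst z) (snd z)))"
    using assms(2,3) unfolding jointly_continuous_def
    by (intro continuous_map_pairedI)
       (auto simp: continuous_map_in_subtopology case_prod_unfold intro: continuous_map_fst)
  from continuous_map_compose[OF this assms(1)[unfolded jointly_continuous_def]]
  show ?thesis by (simp add: jointly_continuous_def o_def case_prod_unfold)
qed

lemma jointly_continuous_param: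
  assumes "jointly_continuous X U u" "continuous_map Y X \<eta>"
  shows "jointly_continuous Y U (\<lambda>q. u (\<eta> q))"
proof -
  have "continuous_map (prod_topology Y (top_of_set U)) (prod_topology X (top_of_set U)) (\<lambda>z. (\<eta> (fst z), snd z))"
    using assms(2)
    by (intro continuous_map_pairedI continuous_map_snd)
       (use continuous_map_compose[OF continuous_map_fst assms(2)] in \<open>auto simp: o_def\<close>)
  from continuous_map_compose[OF this assms(1)[unfolded jointly_continuous_def]]
  show ?thesis by (simp add: jointly_continuous_def o_def case_prod_unfold)
qed

lemma jointly_continuous_no_param:
  "continuous_on U f \<Longrightarrow> jointly_continuous X U (\<lambda>_. f)"
  unfolding jointly_continuous_def
  using continuous_map_compose[OF continuous_map_snd[of X "top_of_set U"], of euclidean f]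
  by (simp add: o_def case_prod_unfold)

lemma jointly_continuous_binary:
  fixes f :: "'p \<Rightarrow> 'a::topological_space \<Rightarrow> 'b::topological_space" and g :: "'p \<Rightarrow> 'a \<Rightarrow> 'c::topological_space"
    and h :: "'b \<Rightarrow> 'c \<Rightarrow> 'd::topological_space"
  assumes "jointly_continuous X U f" "jointly_continuous X U g" "continuous_on UNIV (\<lambda>z. h (fst z) (snd z))"
  shows "jointly_continuous X U (\<lambda>p x. h (f p x) (g p x))"
proof -
  have "continuous_map (prod_topology X (top_of_set U)) (prod_topology euclidean euclidean)
     (\<lambda>z. (f (fst z) (snd z), g (fst z) (snd z)))"
    using assms(1,2) unfolding jointly_continuous_def
    by (intro continuous_map_pairedI) (auto simp: case_prod_unfold)
  moreover have "continuous_map (prod_topology euclidean euclidean) euclidean (\<lambda>z. h (fst z) (snd z))"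
    using assms(3) by simp
  ultimately have "continuous_map (prod_topology X (top_of_set U)) euclidean
       ((\<lambda>z. h (fst z) (snd z)) \<circ> (\<lambda>z. (f (fst z) (snd z), g (fst z) (snd z))))"
    by (rule continuous_map_compose)
  then show ?thesis by (simp add: jointly_continuous_def o_def case_prod_unfold)
qed

text \<open>\<open>X\<close> may be a function space or a product of such spaces, so
  \<open>p\<close> enters only continuously and derivatives are taken in \<open>x\<close> alone.
  Asking for class n of \<open>u' p x h\<close> at each fixed \<open>h\<close>, instead of an
  operator-valued derivative, keeps the recursion at one type of values.\<close>

primrec C_family :: "nat \<Rightarrow> 'p topology \<Rightarrow> 'a::euclidean_space set \<Rightarrow> ('p \<Rightarrow> 'a \<Rightarrow> 'b::euclidean_space) \<Rightarrow> bool" where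
  "C_family 0 X U u = jointly_continuous X U u"
| "C_family (Suc n) X U u = (jointly_continuous X U u \<and>
     (\<exists>u'. (\<forall>p\<in>topspace X. \<forall>x\<in>U. (u p has_derivative u' p x) (at x)) \<and>
        (\<forall>h. C_family n X U (\<lambda>p x. u' p x h))))"

definition smooth_family :: "'p topology \<Rightarrow> 'a::euclidean_space set \<Rightarrow> ('p \<Rightarrow> 'a \<Rightarrow> 'b::euclidean_space) \<Rightarrow> bool" where
  "smooth_family X U u \<longleftrightarrow> (\<forall>n. C_family n X U u)"

lemma C_family_cont: "C_family n X U u \<Longrightarrow> jointly_continuous X U u"
  by (cases n) auto

lemma C_family_SucI:
  assumes "jointly_continuous X U u"
    "\<And>p x. p\<in>topspace X \<Longrightarrow> x \<in> U \<Longrightarrow> (u p has_derivative u' p x) (at x)"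
    "\<And>h. C_family n X U (\<lambda>p x. u' p x h)"
  shows "C_family (Suc n) X U u"
  using assms by auto

lemma C_family_SucE:
  assumes "C_family (Suc n) X U u"
  obtains u' where "jointly_continuous X U u"
    "\<And>p x. p\<in>topspace X \<Longrightarrow> x \<in> U \<Longrightarrow> (u p has_derivative u' p x) (at x)"
    "\<And>h. C_family n X U (\<lambda>p x. u' p x h)"
  using assms by auto

declare C_family.simps(2) [simp del]

lemma C_family_Suc_D: "C_family (Suc n) X U u \<Longrightarrow> C_family n X U u"
proof (induction n arbitrary: u)
  case 0 then show ?case by (auto dest: C_family_cont)
next
  case (Suc n)
  from Suc.prems obtain u' where u': "jointly_continuous X U u"
    "\<And>p x. p\<in>topspace X \<Longrightarrow> x \<in> U \<Longrightarrow> (u p has_derivative u' p x) (at x)"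
    "\<And>h. C_family (Suc n) X U (\<lambda>p x. u' p x h)" by (rule C_family_SucE) (rule that)
  show ?case
    by (rule C_family_SucI[of _ _ _ u']) (use Suc.prems u' Suc.IH in auto)
qed

lemma C_family_cong:
  assumes "open U" "C_family n X U u" "\<And>p x. p \<in> topspace X \<Longrightarrow> x \<in> U \<Longrightarrow> u p x = v p x"
  shows "C_family n X U v"
proof (cases n)
  case 0 then show ?thesis using assms jointly_continuous_cong by fastforce
next
  case (Suc m)
  from assms(2)[unfolded Suc] obtain u' where u': "jointly_continuous X U u"
    "\<And>p x. p\<in>topspace X \<Longrightarrow> x \<in> U \<Longrightarrow> (u p has_derivative u' p x) (at x)"
    "\<And>h. C_family m X U (\<lambda>p x. u' p x h)" by (rule C_family_SucE) (rule that)
  have "jointly_continuous X U v" using assms(2,3) jointly_continuous_cong C_family_cont by metis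
  moreover have "(v p has_derivative u' p x) (at x)" if "p \<in> topspace X" "x \<in> U" for p x
    using has_derivative_transform_within_open[OF u'(2)[OF that] assms(1) that(2)] assms(3) that(1) by blast
  ultimately show ?thesis unfolding Suc
    by (rule C_family_SucI) (assumption | rule u'(3))+
qed

lemma C_family_const: "C_family n X U (\<lambda>p x. c)"
proof (induction n arbitrary: c)
  case 0 then show ?case by (simp add: jointly_continuous_no_param continuous_on_const)
next
  case (Suc n)
  show ?case
    by (rule C_family_SucI[of _ _ _ "\<lambda>p x h. 0"])
       (use Suc in \<open>auto intro!: jointly_continuous_no_param continuous_on_const\<close>)
qed

lemma C_family_no_param_linear:
  assumes "bounded_linear L"
  shows "C_family n X U (\<lambda>p x. L x)"
proof (cases n)
  case 0 then show ?thesis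
    by (simp add: jointly_continuous_no_param assms linear_continuous_on)
next
  case (Suc m)
  show ?thesis unfolding Suc
    by (rule C_family_SucI[of _ _ _ "\<lambda>p x h. L h"])
       (use assms in \<open>auto intro!: C_family_const jointly_continuous_no_param linear_continuous_on bounded_linear_imp_has_derivative\<close>)
qed

lemma C_family_param:
  assumes "C_family n X U u" "continuous_map Y X \<eta>"
  shows "C_family n Y U (\<lambda>q. u (\<eta> q))"
  using assms(1)
proof (induction n arbitrary: u)
  case 0 then show ?case using assms(2) by (simp add: jointly_continuous_param)
next
  case (Suc n)
  from Suc.prems(1) obtain u' where u': "jointly_continuous X U u"
    "\<And>p x. p\<in>topspace X \<Longrightarrow> x \<in> U \<Longrightarrow> (u p has_derivative u' p x) (at x)"
    "\<And>h. C_family n X U (\<lambda>p x. u' p x h)" by (rule C_family_SucE) (rule that)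
  show ?case
  proof (rule C_family_SucI[of _ _ _ "\<lambda>q. u' (\<eta> q)"])
    show "C_family n Y U (\<lambda>p x. u' (\<eta> p) x h)" for h
      using Suc.IH[of "\<lambda>p x. u' p x h"] u' by simp
    show "jointly_continuous Y U (\<lambda>q. u (\<eta> q))" using u'(1) assms(2) by (rule jointly_continuous_param)
    show "(u (\<eta> q) has_derivative u' (\<eta> q) x) (at x)" if "q \<in> topspace Y" "x \<in> U" for q x
      using u'(2) that continuous_map_image_subset_topspace[OF assms(2)] by blast
  qed
qed

lemma C_family_subset:
  assumes "C_family n X U u" "V \<subseteq> U"
  shows "C_family n X V u"
  using assms(1)
proof (induction n arbitrary: u)
  case 0
  have "jointly_continuous X V (\<lambda>p x. x)"
    by (simp add: jointly_continuous_no_param)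
  from jointly_continuous_compose[OF 0[simplified] this] assms(2) show ?case by auto
next
  case (Suc n)
  from Suc.prems(1) obtain u' where u': "jointly_continuous X U u"
    "\<And>p x. p\<in>topspace X \<Longrightarrow> x \<in> U \<Longrightarrow> (u p has_derivative u' p x) (at x)"
    "\<And>h. C_family n X U (\<lambda>p x. u' p x h)" by (rule C_family_SucE) (rule that)
  have jc: "jointly_continuous X V u"
    by (rule jointly_continuous_compose[OF u'(1), of V "\<lambda>p x. x"])
      (use assms(2) in \<open>auto simp: jointly_continuous_no_param\<close>)
  show ?case
    by (rule C_family_SucI[of _ _ _ u']) (use jc u' assms(2) Suc.IH in auto)
qed

lemma C_family_add:
  assumes "C_family n X U f" "C_family n X U g"
  shows "C_family n X U (\<lambda>p x. f p x + g p x)"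
  using assms
proof (induction n arbitrary: f g)
  case 0 then show ?case
    by (auto intro!: jointly_continuous_binary[where h="(+)"] continuous_intros)
next
  case (Suc n)
  from Suc.prems(1) obtain f' where f': "jointly_continuous X U f"
    "\<And>p x. p\<in>topspace X \<Longrightarrow> x \<in> U \<Longrightarrow> (f p has_derivative f' p x) (at x)"
    "\<And>h. C_family n X U (\<lambda>p x. f' p x h)" by (rule C_family_SucE) (rule that)
  from Suc.prems(2) obtain g' where g': "jointly_continuous X U g"
    "\<And>p x. p\<in>topspace X \<Longrightarrow> x \<in> U \<Longrightarrow> (g p has_derivative g' p x) (at x)"
    "\<And>h. C_family n X U (\<lambda>p x. g' p x h)" by (rule C_family_SucE) (rule that)
  have "jointly_continuous X U (\<lambda>p x. f p x + g p x)"
    by (rule jointly_continuous_binary[OF f'(1) g'(1), where h="(+)"]) (intro continuous_intros)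
  then show ?case
    by (rule C_family_SucI[of _ _ _ "\<lambda>p x h. f' p x h + g' p x h"])
      (use f' g' Suc.IH in \<open>auto intro!: has_derivative_add\<close>)
qed

lemma C_family_bilinear:
  fixes B :: "'b::euclidean_space \<Rightarrow> 'c::euclidean_space \<Rightarrow> 'd::euclidean_space"
  assumes B: "bounded_bilinear B" and "C_family n X U f" "C_family n X U g"
  shows "C_family n X U (\<lambda>p x. B (f p x) (g p x))"
  using assms(2,3)
proof (induction n arbitrary: f g)
  case 0 then show ?case
    by (auto intro!: jointly_continuous_binary[where h=B] bounded_bilinear.continuous_on[OF B] continuous_intros)
next
  case (Suc n)
  from Suc.prems(1) obtain f' where f': "jointly_continuous X U f"
    "\<And>p x. p\<in>topspace X \<Longrightarrow> x \<in> U \<Longrightarrow> (f p has_derivative f' p x) (at x)"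
    "\<And>h. C_family n X U (\<lambda>p x. f' p x h)" by (rule C_family_SucE) (rule that)
  from Suc.prems(2) obtain g' where g': "jointly_continuous X U g"
    "\<And>p x. p\<in>topspace X \<Longrightarrow> x \<in> U \<Longrightarrow> (g p has_derivative g' p x) (at x)"
    "\<And>h. C_family n X U (\<lambda>p x. g' p x h)" by (rule C_family_SucE) (rule that)
  have *: "C_family n X U f" "C_family n X U g" by (auto intro: C_family_Suc_D Suc.prems)
  show ?case
  proof (rule C_family_SucI[of _ _ _ "\<lambda>p x h. B (f p x) (g' p x h) + B (f' p x h) (g p x)"])
    show "C_family n X U (\<lambda>p x. B (f p x) (g' p x h) + B (f' p x h) (g p x))" for h
      by (intro C_family_add Suc.IH) (use * f' g' in auto)
  qed (use f' g' in \<open>auto intro!: bounded_bilinear.FDERIV[OF B] jointly_continuous_binary[where h=B] bounded_bilinear.continuous_on[OF B] continuous_intros\<close>)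
qed

lemma C_family_linear:
  assumes "bounded_linear L" "C_family n X U f"
  shows "C_family n X U (\<lambda>p x. L (f p x))"
proof -
  interpret bounded_linear L by fact
  \<comment> \<open>Feeding the constant 1 into (r, y) \<mapsto> L (r y) makes the linear case an
    instance of the bilinear one.\<close>
  have "bounded_bilinear (\<lambda>(r::real) y. L (r *\<^sub>R y))"
    by (simp add: scaleR bounded_bilinear.comp[OF bounded_bilinear_scaleR bounded_linear_ident assms(1)])
  from C_family_bilinear[OF this C_family_const[of n X U 1] assms(2)] show ?thesis by simp
qed

lemma C_family_sum:
  assumes "\<And>i. i \<in> I \<Longrightarrow> C_family n X U (f i)"
  shows "C_family n X U (\<lambda>p x. \<Sum>i\<in>I. f i p x)"
  using assms by (induction I rule: infinite_finite_induct) (auto intro: C_family_add C_family_const)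

lemma C_family_prod:
  fixes f :: "'i \<Rightarrow> 'p \<Rightarrow> 'a::euclidean_space \<Rightarrow> real"
  assumes "\<And>i. i \<in> I \<Longrightarrow> C_family n X U (f i)"
  shows "C_family n X U (\<lambda>p x. \<Prod>i\<in>I. f i p x)"
  using assms by (induction I rule: infinite_finite_induct)
    (auto intro: C_family_bilinear[OF bounded_bilinear_mult] C_family_const)

text \<open>Families control derivatives in fixed directions only. A direction that moves with the
  point or the parameter is traded for scalar coefficients on basis directions.\<close>

lemma linear_basis_expansion:
  fixes L :: "'a::euclidean_space \<Rightarrow> 'b::real_vector"
  assumes "linear L"
  shows "L h = (\<Sum>b\<in>Basis. (h \<bullet> b) *\<^sub>R L b)"
proof -
  interpret linear L by fact
  have "L h = L (\<Sum>b\<in>Basis. (h \<bullet> b) *\<^sub>R b)" by (simp add: euclidean_representation)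
  then show ?thesis by (simp add: sum scale)
qed

lemma C_family_compose:
  assumes "C_family n X O' g" "C_family n X U f"
    "\<And>p x. p \<in> topspace X \<Longrightarrow> x \<in> U \<Longrightarrow> f p x \<in> O'" "open U"
  shows "C_family n X U (\<lambda>p x. g p (f p x))"
  using assms(1,2,3)
proof (induction n arbitrary: g f)
  case 0 then show ?case by (auto intro: jointly_continuous_compose)
next
  case (Suc n)
  from Suc.prems(2) obtain f' where f': "jointly_continuous X U f"
    "\<And>p x. p\<in>topspace X \<Longrightarrow> x \<in> U \<Longrightarrow> (f p has_derivative f' p x) (at x)"
    "\<And>h. C_family n X U (\<lambda>p x. f' p x h)" by (rule C_family_SucE) (rule that)
  from Suc.prems(1) obtain g' where g': "jointly_continuous X O' g"
    "\<And>p x. p\<in>topspace X \<Longrightarrow> x \<in> O' \<Longrightarrow> (g p has_derivative g' p x) (at x)"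
    "\<And>h. C_family n X O' (\<lambda>p x. g' p x h)" by (rule C_family_SucE) (rule that)
  have f: "C_family n X U f" by (auto intro: C_family_Suc_D Suc.prems)
  show ?case
  proof (rule C_family_SucI[of _ _ _ "\<lambda>p x h. g' p (f p x) (f' p x h)"])
    show "jointly_continuous X U (\<lambda>p x. g p (f p x))"
      by (rule jointly_continuous_compose[OF g'(1) f'(1)]) (use Suc.prems in auto)
    have "((\<lambda>x. g p (f p x)) has_derivative g' p (f p x) \<circ> f' p x) (at x)"
      if "p \<in> topspace X" "x \<in> U" for p x
      using diff_chain_at[of "f p" "f' p x" x "g p" "g' p (f p x)"] f' g' Suc.prems(3) that
      by (auto simp: o_def)
    then show "((\<lambda>x. g p (f p x)) has_derivative (\<lambda>h. g' p (f p x) (f' p x h))) (at x)"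
      if "p \<in> topspace X" "x \<in> U" for p x
      using that by (simp add: o_def)
    fix h
    have "C_family n X U (\<lambda>p x. \<Sum>b\<in>Basis. (f' p x h \<bullet> b) *\<^sub>R g' p (f p x) b)"
      by (intro C_family_sum C_family_bilinear[OF bounded_bilinear_scaleR] Suc.IH
            C_family_linear[OF bounded_linear_inner_left])
         (use f f' g' Suc.prems(3) in auto)
    then show "C_family n X U (\<lambda>p x. g' p (f p x) (f' p x h))"
    proof (rule C_family_cong[OF \<open>open U\<close>])
      fix p x assume "p \<in> topspace X" "x \<in> U"
      then have "linear (g' p (f p x))"
        using g' Suc.prems(3) has_derivative_linear by blast
      from linear_basis_expansion[OF this]
      show "(\<Sum>b\<in>Basis. (f' p x h \<bullet> b) *\<^sub>R g' p (f p x) b) = g' p (f p x) (f' p x h)" by metis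
    qed
  qed
qed

lemma C_family_components:
  fixes f :: "'p \<Rightarrow> 'a::euclidean_space \<Rightarrow> 'b::euclidean_space"
  assumes "\<And>b. b \<in> Basis \<Longrightarrow> C_family n X U (\<lambda>p x. f p x \<bullet> b)"
  shows "C_family n X U f"
proof -
  have "C_family n X U (\<lambda>p x. \<Sum>b\<in>Basis. (f p x \<bullet> b) *\<^sub>R b)"
    by (intro C_family_sum C_family_bilinear[OF bounded_bilinear_scaleR] assms C_family_const)
  then show ?thesis by (simp add: euclidean_representation)
qed

text \<open>The derivative is a polynomial in the function itself, so the induction on n
  closes.\<close>

lemma C_family_inverse: "C_family n X (- {0}) (\<lambda>p x. inverse (x::real))"
proof (induction n)
  case 0 show ?case by (auto intro!: jointly_continuous_no_param continuous_intros)
next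
  case (Suc n)
  show ?case
  proof (rule C_family_SucI[of _ _ _ "\<lambda>p x h. - (inverse x * h * inverse x)"])
    show "C_family n X (- {0}) (\<lambda>p x. - (inverse x * h * inverse (x::real)))" for h
      by (rule C_family_linear[OF bounded_linear_minus[OF bounded_linear_ident]])
        (intro C_family_bilinear[OF bounded_bilinear_mult] Suc C_family_const)
  qed (auto intro!: jointly_continuous_no_param continuous_intros has_derivative_inverse')
qed

lemma C_family_sqrt: "C_family n X {0<..} (\<lambda>p x. sqrt x)"
proof (induction n)
  case 0 show ?case by (auto intro!: jointly_continuous_no_param continuous_intros)
next
  case (Suc n)
  have *: "C_family n X {0<..} (\<lambda>p x. h * (inverse (sqrt x) / 2))" for h :: real
    unfolding divide_inverse
    by (intro C_family_bilinear[OF bounded_bilinear_mult] C_family_const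
          C_family_compose[OF C_family_inverse]) (use Suc in auto)
  show ?case
  proof (rule C_family_SucI[of _ _ _ "\<lambda>p x h. h * (inverse (sqrt x) / 2)"])
    show "(sqrt has_derivative (\<lambda>h. h * (inverse (sqrt x) / 2))) (at x)" if "x \<in> {0<..}" for x
      using DERIV_real_sqrt[of x] that unfolding has_field_derivative_def
      by (auto elim!: has_derivative_eq_rhs simp: fun_eq_iff)
    show "C_family n X {0<..} (\<lambda>p x. h * (inverse (sqrt x) / 2))" for h by (rule *)
  qed (auto intro!: jointly_continuous_no_param continuous_intros)
qed

lemma smooth_familyD: "smooth_family X U u \<Longrightarrow> C_family n X U u"
  by (simp add: smooth_family_def)

lemma smooth_family_jcont: "smooth_family X U u \<Longrightarrow> jointly_continuous X U u"
  using smooth_familyD[of X U u 0] by simp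

lemma smooth_family_cong:
  assumes "smooth_family X U u" "open U" "\<And>p x. p \<in> topspace X \<Longrightarrow> x \<in> U \<Longrightarrow> u p x = v p x"
  shows "smooth_family X U v"
  using assms C_family_cong unfolding smooth_family_def by blast

lemma smooth_family_const: "smooth_family X U (\<lambda>p x. c)"
  by (simp add: smooth_family_def C_family_const)

lemma smooth_family_no_param_linear: "bounded_linear L \<Longrightarrow> smooth_family X U (\<lambda>p x. L x)"
  by (simp add: smooth_family_def C_family_no_param_linear)

lemma smooth_family_ident: "smooth_family X U (\<lambda>p x. x)"
  by (rule smooth_family_no_param_linear) (rule bounded_linear_ident)

lemma smooth_family_param:
  "smooth_family X U u \<Longrightarrow> continuous_map Y X \<eta> \<Longrightarrow> smooth_family Y U (\<lambda>q. u (\<eta> q))"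
  unfolding smooth_family_def by (blast intro: C_family_param)

lemma smooth_family_subset: "smooth_family X U u \<Longrightarrow> V \<subseteq> U \<Longrightarrow> smooth_family X V u"
  by (auto simp: smooth_family_def intro: C_family_subset)

lemma smooth_family_add:
  "smooth_family X U f \<Longrightarrow> smooth_family X U g \<Longrightarrow> smooth_family X U (\<lambda>p x. f p x + g p x)"
  by (simp add: smooth_family_def C_family_add)

lemma smooth_family_bilinear:
  "bounded_bilinear B \<Longrightarrow> smooth_family X U f \<Longrightarrow> smooth_family X U g \<Longrightarrow> smooth_family X U (\<lambda>p x. B (f p x) (g p x))"
  by (simp add: smooth_family_def C_family_bilinear)

lemma smooth_family_linear:
  "bounded_linear L \<Longrightarrow> smooth_family X U f \<Longrightarrow> smooth_family X U (\<lambda>p x. L (f p x))"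
  by (simp add: smooth_family_def C_family_linear)

lemmas smooth_family_mult = smooth_family_bilinear[OF bounded_bilinear_mult]
lemmas smooth_family_scaleR = smooth_family_bilinear[OF bounded_bilinear_scaleR]
lemmas smooth_family_inner = smooth_family_bilinear[OF bounded_bilinear_inner]
lemmas smooth_family_minus = smooth_family_linear[OF bounded_linear_minus[OF bounded_linear_ident]]

lemma smooth_family_diff:
  assumes "smooth_family X U f" "smooth_family X U g"
  shows "smooth_family X U (\<lambda>p x. f p x - g p x)"
  using smooth_family_add[OF assms(1) smooth_family_minus[OF assms(2)]] by simp

lemma smooth_family_Pair:
  assumes "smooth_family X U f" "smooth_family X U g"
  shows "smooth_family X U (\<lambda>p x. (f p x, g p x))"
proof -
  have "bounded_linear (\<lambda>a. (a, 0::'d))" "bounded_linear (\<lambda>b. (0::'c, b))"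
    by (auto intro!: bounded_linear_Pair bounded_linear_ident bounded_linear_zero)
  from smooth_family_add[OF smooth_family_linear[OF this(1) assms(1)] smooth_family_linear[OF this(2) assms(2)]]
  show ?thesis by simp
qed

lemma smooth_family_sum:
  "(\<And>i. i \<in> I \<Longrightarrow> smooth_family X U (f i)) \<Longrightarrow> smooth_family X U (\<lambda>p x. \<Sum>i\<in>I. f i p x)"
  by (simp add: smooth_family_def C_family_sum)

lemma smooth_family_prod:
  fixes f :: "'i \<Rightarrow> 'p \<Rightarrow> 'a::euclidean_space \<Rightarrow> real"
  shows "(\<And>i. i \<in> I \<Longrightarrow> smooth_family X U (f i)) \<Longrightarrow> smooth_family X U (\<lambda>p x. \<Prod>i\<in>I. f i p x)"
  by (simp add: smooth_family_def C_family_prod)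

lemma smooth_family_compose:
  assumes "smooth_family X O' g" "smooth_family X U f"
    "\<And>p x. p \<in> topspace X \<Longrightarrow> x \<in> U \<Longrightarrow> f p x \<in> O'" "open U"
  shows "smooth_family X U (\<lambda>p x. g p (f p x))"
  using assms unfolding smooth_family_def by (auto intro: C_family_compose)

lemma smooth_family_components:
  "(\<And>b. b \<in> Basis \<Longrightarrow> smooth_family X U (\<lambda>p x. f p x \<bullet> b)) \<Longrightarrow> smooth_family X U f"
  by (simp add: smooth_family_def C_family_components)

lemma smooth_family_inverse:
  fixes f :: "'p \<Rightarrow> 'a::euclidean_space \<Rightarrow> real"
  assumes "smooth_family X U f" "open U" "\<And>p x. p \<in> topspace X \<Longrightarrow> x \<in> U \<Longrightarrow> f p x \<noteq> 0"
  shows "smooth_family X U (\<lambda>p x. inverse (f p x))"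
  by (rule smooth_family_compose[of _ "- {0}" "\<lambda>p. inverse"])
    (use assms in \<open>auto simp: smooth_family_def C_family_inverse\<close>)

lemma smooth_family_sqrt:
  assumes "smooth_family X U f" "open U" "\<And>p x. p \<in> topspace X \<Longrightarrow> x \<in> U \<Longrightarrow> 0 < f p x"
  shows "smooth_family X U (\<lambda>p x. sqrt (f p x))"
  by (rule smooth_family_compose[of _ "{0<..}" "\<lambda>p. sqrt"])
    (use assms in \<open>auto simp: smooth_family_def C_family_sqrt\<close>)

lemma smooth_family_has_derivative:
  assumes "smooth_family X U u" "p \<in> topspace X" "x \<in> U"
  shows "(u p has_derivative frechet_derivative (u p) (at x)) (at x)"
  using smooth_familyD[OF assms(1), of "Suc 0"] assms(2,3)
  by (metis C_family_SucE differentiableI frechet_derivative_works)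

lemma smooth_family_derivative:
  assumes "smooth_family X U u" "open U"
  shows "smooth_family X U (\<lambda>p x. frechet_derivative (u p) (at x) h)"
  unfolding smooth_family_def
proof
  fix n
  from smooth_familyD[OF assms(1), of "Suc n"]
  obtain u' where u': "jointly_continuous X U u"
    "\<And>p x. p\<in>topspace X \<Longrightarrow> x \<in> U \<Longrightarrow> (u p has_derivative u' p x) (at x)"
    "\<And>h. C_family n X U (\<lambda>p x. u' p x h)" by (rule C_family_SucE) (rule that)
  show "C_family n X U (\<lambda>p x. frechet_derivative (u p) (at x) h)"
    by (rule C_family_cong[OF assms(2) u'(3)[of h]]) (metis frechet_derivative_at u'(2))
qed

lemma smooth_family_iterated_derivative:
  assumes "smooth_family X U u" "open U"
  shows "smooth_family X U (\<lambda>p. iterated_derivative hs (u p))"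
  by (induction hs) (auto intro: smooth_family_derivative assms)

lemma smooth_on_imp_smooth_family:
  assumes "smooth_on U f"
  shows "smooth_family X U (\<lambda>_. f)"
proof -
  have "C_family n X U (\<lambda>_. f)" for n
    using assms
  proof (induction n arbitrary: f)
    case 0
    then obtain f' where "\<forall>x\<in>U. (f has_derivative f' x) (at x)" by cases blast
    then have "continuous_on U f"
      by (meson continuous_at_imp_continuous_on has_derivative_continuous)
    then show ?case by (simp add: jointly_continuous_no_param)
  next
    case (Suc n)
    from Suc.prems obtain f' where f': "\<forall>x\<in>U. (f has_derivative f' x) (at x)" "\<forall>h. smooth_on U (\<lambda>x. f' x h)"
      by cases (rule that)
    then have "continuous_on U f"
      by (meson continuous_at_imp_continuous_on has_derivative_continuous)
    then show ?case
      by (intro C_family_SucI[of _ _ _ "\<lambda>_. f'"] Suc.IH)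
         (use f' in \<open>auto intro: jointly_continuous_no_param\<close>)
  qed
  then show ?thesis by (simp add: smooth_family_def)
qed

lemma smooth_family_imp_smooth_on:
  assumes "smooth_family X U u" "open U" "p \<in> topspace X"
  shows "smooth_on U (u p)"
proof -
  \<comment> \<open>Coinduction invariant: \<open>f\<close> is a slice of some smooth family.
    Directional derivatives of slices are slices again.\<close>
  have "\<exists>u. smooth_family X U u \<and> f = u p \<Longrightarrow> smooth_on U f" for f
  proof (coinduction arbitrary: f rule: smooth_on.coinduct)
    case (smooth_on f)
    then obtain u where u: "smooth_family X U u" "f = u p" by blast
    show ?case
      using u smooth_family_has_derivative[OF u(1) assms(3)] smooth_family_derivative[OF u(1) assms(2)]
      by (intro exI[of _ f] exI[of _ "\<lambda>x. frechet_derivative (u p) (at x)"]) auto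
  qed
  then show ?thesis using assms by blast
qed

text \<open>A one-point parameter space expresses the absence of parameters; it plays this role
  throughout.\<close>

lemma smooth_on_iff_smooth_family:
  "open U \<Longrightarrow> smooth_on U f \<longleftrightarrow> smooth_family (discrete_topology {()}) U (\<lambda>_. f)"
  using smooth_on_imp_smooth_family smooth_family_imp_smooth_on by fastforce

section \<open>Maps on the sphere and their radial extensions\<close>

lemma smooth_family_normalize: "smooth_family X (- {0}) (\<lambda>p x::'a::euclidean_space. x /\<^sub>R norm x)"
proof -
  have "smooth_family X (- {0}) (\<lambda>p x::'a. inverse (sqrt (x \<bullet> x)) *\<^sub>R x)"
    by (intro smooth_family_scaleR smooth_family_ident smooth_family_inverse smooth_family_sqrt smooth_family_inner) auto
  then show ?thesis by (simp add: norm_eq_sqrt_inner)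
qed

lemma normalize_in_sphere: "(x::'a::euclidean_space) \<noteq> 0 \<Longrightarrow> x /\<^sub>R norm x \<in> sphere 0 1"
  by simp

lemma radial_ext_sphere [simp]: "x \<in> S3 \<Longrightarrow> radial_ext f x = f x"
  by (simp add: radial_ext_def)

lemma S3_nonempty: "S3 \<noteq> {}" and compact_S3: "compact S3"
  by (auto simp: sphere_eq_empty)

lemma S3_nonzero: "x \<in> S3 \<Longrightarrow> x \<noteq> 0" by auto

text \<open>Any local extension, composed with normalization, yields the radial one. Smoothness on
  the sphere can thus be tested on one canonical extension with the fixed open domain
  \<open>- {0}\<close>.\<close>

lemma smooth_on_S3_iff: "smooth_on_S3 f \<longleftrightarrow> smooth_on (- {0}) (radial_ext f)"
proof
  assume "smooth_on_S3 f"
  then obtain U g where g: "open U" "S3 \<subseteq> U" "smooth_on U g" "\<And>x. x\<in>S3 \<Longrightarrow> g x = f x"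
    unfolding smooth_on_S3_def by blast
  let ?X = "discrete_topology {()}"
  have "smooth_family ?X (- {0}) (\<lambda>p x. g (x /\<^sub>R norm x))"
    by (rule smooth_family_compose[OF smooth_on_imp_smooth_family[OF g(3)] smooth_family_normalize])
       (use g(2) normalize_in_sphere in auto)
  then have "smooth_family ?X (- {0}) (\<lambda>p. radial_ext f)"
    by (rule smooth_family_cong) (auto simp: radial_ext_def intro!: g(4))
  then show "smooth_on (- {0}) (radial_ext f)" by (simp add: smooth_on_iff_smooth_family open_Compl)
next
  assume "smooth_on (- {0}) (radial_ext f)"
  then show "smooth_on_S3 f" unfolding smooth_on_S3_def
    by (intro exI[of _ "- {0}"] exI[of _ "radial_ext f"]) auto
qed

lemma CinfI:
  assumes "smooth_on_S3 f" "\<And>x. x \<notin> S3 \<Longrightarrow> f x = 0" shows "f \<in> Cinf"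
  using assms by (simp add: Cinf_def)

lemma CinfD: "f \<in> Cinf \<Longrightarrow> smooth_family X (- {0}) (\<lambda>_. radial_ext f)"
  by (simp add: Cinf_def smooth_on_S3_iff smooth_on_imp_smooth_family)

lemma Cinf_zero: "f \<in> Cinf \<Longrightarrow> x \<notin> S3 \<Longrightarrow> f x = 0"
  by (simp add: Cinf_def)

lemma Cinf_from_family:
  assumes "smooth_family X (- {0}) (\<lambda>p. radial_ext (T p))" "p \<in> topspace X" "\<And>x. x \<notin> S3 \<Longrightarrow> T p x = 0"
  shows "T p \<in> Cinf"
  using smooth_family_imp_smooth_on[OF assms(1) _ assms(2)] assms(3)
  by (auto simp: Cinf_def smooth_on_S3_iff open_Compl)

lemma Cinf_from_no_param:
  assumes "smooth_family (discrete_topology {()}) (- {0}) (\<lambda>_. radial_ext f)" "\<And>x. x \<notin> S3 \<Longrightarrow> f x = 0"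
  shows "f \<in> Cinf"
  using Cinf_from_family[of "discrete_topology {()}" "\<lambda>_. f" "()"] assms by auto

lemma radial_ext_linear:
  "radial_ext (f + g) = (\<lambda>x. radial_ext f x + radial_ext g x)"
  "radial_ext (f - g) = (\<lambda>x. radial_ext f x - radial_ext g x)"
  "radial_ext (c *\<^sub>R f) = (\<lambda>x. c *\<^sub>R radial_ext f x)"
  "radial_ext 0 = (\<lambda>x. 0)"
  by (auto simp: radial_ext_def scaleR_fun_def fun_eq_iff)

lemma subspace_Cinf: "subspace Cinf"
  unfolding subspace_def
proof (intro conjI ballI allI)
  show "0 \<in> Cinf"
    by (rule Cinf_from_no_param) (auto simp: radial_ext_linear intro: smooth_family_const)
  fix f g and c :: real assume f: "f \<in> Cinf"
  show "c *\<^sub>R f \<in> Cinf"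
    by (rule Cinf_from_no_param)
      (simp_all add: radial_ext_linear(3) smooth_family_scaleR smooth_family_const CinfD f, simp add: scaleR_fun_def Cinf_zero[OF f])
  assume g: "g \<in> Cinf"
  show "f + g \<in> Cinf"
  proof (rule Cinf_from_no_param)
    show "smooth_family (discrete_topology {()}) (- {0}) (\<lambda>_. radial_ext (f + g))"
      unfolding radial_ext_linear by (intro smooth_family_add CinfD f g)
    show "(f + g) x = 0" if "x \<notin> S3" for x
      using Cinf_zero[OF f that] Cinf_zero[OF g that] by simp
  qed
qed

lemma iterated_derivative_has_derivative:
  assumes "smooth_family X U u" "open U" "p \<in> topspace X" "x \<in> U"
  shows "(iterated_derivative hs (u p) has_derivative frechet_derivative (iterated_derivative hs (u p)) (at x)) (at x)"
  using smooth_family_has_derivative[OF smooth_family_iterated_derivative[OF assms(1,2)] assms(3,4)] .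

lemma frechet_derivative_eqI:
  assumes "open U" "x \<in> U" "(g has_derivative g') (at x)" "\<And>y. y \<in> U \<Longrightarrow> f y = g y"
  shows "frechet_derivative f (at x) = g'"
proof -
  have "(f has_derivative g') (at x)"
    using has_derivative_transform_within_open[OF assms(3,1,2)] assms(4) by simp
  then show ?thesis by (metis frechet_derivative_at)
qed

lemma iterated_derivative_add:
  fixes f g :: "real^4 \<Rightarrow> real^4"
  assumes "f \<in> Cinf" "g \<in> Cinf" "x \<noteq> 0"
  shows "iterated_derivative hs (radial_ext (f + g)) x =
    iterated_derivative hs (radial_ext f) x + iterated_derivative hs (radial_ext g) x"
  using assms(3)
proof (induction hs arbitrary: x)
  case Nil show ?case by (simp only: radial_ext_linear iterated_derivative.simps)
next
  case (Cons h hs)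
  have "frechet_derivative (iterated_derivative hs (radial_ext (f + g))) (at x) =
     (\<lambda>h. frechet_derivative (iterated_derivative hs (radial_ext f)) (at x) h +
      frechet_derivative (iterated_derivative hs (radial_ext g)) (at x) h)"
  proof (rule frechet_derivative_eqI[of "- {0}", OF _ _ has_derivative_add])
    show "(iterated_derivative hs (radial_ext f) has_derivative
        frechet_derivative (iterated_derivative hs (radial_ext f)) (at x)) (at x)"
      by (rule iterated_derivative_has_derivative[OF CinfD[OF assms(1), of "discrete_topology {()}"]])
         (use Cons in auto)
    show "(iterated_derivative hs (radial_ext g) has_derivative
        frechet_derivative (iterated_derivative hs (radial_ext g)) (at x)) (at x)"
      by (rule iterated_derivative_has_derivative[OF CinfD[OF assms(2), of "discrete_topology {()}"]])
         (use Cons in auto)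
    show "iterated_derivative hs (radial_ext (f + g)) y =
       iterated_derivative hs (radial_ext f) y + iterated_derivative hs (radial_ext g) y" if "y \<in> - {0}" for y
      by (rule Cons.IH) (use that in simp)
  qed (use Cons in auto)
  then show ?case by (simp only: iterated_derivative.simps)
qed

lemma iterated_derivative_scaleR:
  fixes f :: "real^4 \<Rightarrow> real^4"
  assumes "f \<in> Cinf" "x \<noteq> 0"
  shows "iterated_derivative hs (radial_ext (c *\<^sub>R f)) x = c *\<^sub>R iterated_derivative hs (radial_ext f) x"
  using assms(2)
proof (induction hs arbitrary: x)
  case Nil then show ?case by (simp add: radial_ext_linear)
next
  case (Cons h hs)
  have "frechet_derivative (iterated_derivative hs (radial_ext (c *\<^sub>R f))) (at x) =
     (\<lambda>h. c *\<^sub>R frechet_derivative (iterated_derivative hs (radial_ext f)) (at x) h)"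
    by (rule frechet_derivative_eqI[of "- {0}", OF _ _ has_derivative_scaleR_right])
      (use Cons iterated_derivative_has_derivative[OF CinfD[OF assms(1), of "discrete_topology {()}"]] in auto)
  then show ?case by simp
qed

lemma iterated_derivative_diff:
  fixes f g :: "real^4 \<Rightarrow> real^4"
  assumes "f \<in> Cinf" "g \<in> Cinf" "x \<noteq> 0"
  shows "iterated_derivative hs (radial_ext (f - g)) x =
    iterated_derivative hs (radial_ext f) x - iterated_derivative hs (radial_ext g) x"
proof -
  have "(-1) *\<^sub>R g \<in> Cinf" using assms subspace_Cinf by (metis subspace_scale)
  from iterated_derivative_add[OF assms(1) this assms(3), of hs] show ?thesis
    unfolding iterated_derivative_scaleR[OF assms(2,3)] by simp
qed

text \<open>\<open>radial_ext f\<close> is homogeneous of degree 0 and each differentiation lowers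
  the degree by one. This lets suprema over the sphere control derivatives on all of
  \<open>- {0}\<close>.\<close>

lemma iterated_derivative_homogeneous:
  fixes f :: "real^4 \<Rightarrow> real^4"
  assumes "f \<in> Cinf" "x \<noteq> 0" "c > 0"
  shows "iterated_derivative hs (radial_ext f) (c *\<^sub>R x) =
    inverse (c ^ length hs) *\<^sub>R iterated_derivative hs (radial_ext f) x"
  using assms(2)
proof (induction hs arbitrary: x)
  case Nil
  have "(c *\<^sub>R x) /\<^sub>R norm (c *\<^sub>R x) = x /\<^sub>R norm x" using assms(3) by simp
  then have "radial_ext f (c *\<^sub>R x) = radial_ext f x" by (simp only: radial_ext_def)
  then show ?case by simp
next
  case (Cons h hs)
  let ?F = "iterated_derivative hs (radial_ext f)"
  have D: "(?F has_derivative frechet_derivative ?F (at y)) (at y)" if "y \<noteq> 0" for y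
    using iterated_derivative_has_derivative[OF CinfD[OF assms(1), of "discrete_topology {()}"]] that by auto
  \<comment> \<open>The function \<open>?F (c *\<^sub>R y)\<close> of \<open>y\<close> is
    differentiated twice: by the chain rule, and through the induction hypothesis, which makes it a
    multiple of \<open>?F\<close>.\<close>
  have "((\<lambda>y. ?F (c *\<^sub>R y)) has_derivative (\<lambda>k. frechet_derivative ?F (at (c *\<^sub>R x)) (c *\<^sub>R k))) (at x)"
    by (rule has_derivative_compose[of "\<lambda>y. c *\<^sub>R y" "\<lambda>k. c *\<^sub>R k"])
      (use D[of "c *\<^sub>R x"] Cons.prems assms(3) in \<open>auto intro!: derivative_eq_intros\<close>)
  moreover have "((\<lambda>y. inverse (c ^ length hs) *\<^sub>R ?F y) has_derivative
      (\<lambda>k. inverse (c ^ length hs) *\<^sub>R frechet_derivative ?F (at x) k)) (at x)"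
    by (intro has_derivative_scaleR_right D Cons.prems)
  then have "((\<lambda>y. ?F (c *\<^sub>R y)) has_derivative
      (\<lambda>k. inverse (c ^ length hs) *\<^sub>R frechet_derivative ?F (at x) k)) (at x)"
    by (rule has_derivative_transform_within_open[of _ _ _ _ "- {0}"]) (use Cons in auto)
  ultimately have "(\<lambda>k. frechet_derivative ?F (at (c *\<^sub>R x)) (c *\<^sub>R k)) =
      (\<lambda>k. inverse (c ^ length hs) *\<^sub>R frechet_derivative ?F (at x) k)"
    by (rule has_derivative_unique)
  then have "frechet_derivative ?F (at (c *\<^sub>R x)) (c *\<^sub>R h) = inverse (c ^ length hs) *\<^sub>R frechet_derivative ?F (at x) h"
    by (rule fun_cong)
  moreover have "linear (frechet_derivative ?F (at (c *\<^sub>R x)))"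
    using D[of "c *\<^sub>R x"] Cons.prems assms(3) has_derivative_linear by auto
  ultimately have "c *\<^sub>R frechet_derivative ?F (at (c *\<^sub>R x)) h = inverse (c ^ length hs) *\<^sub>R frechet_derivative ?F (at x) h"
    by (simp add: linear_scale)
  then have "inverse c *\<^sub>R c *\<^sub>R frechet_derivative ?F (at (c *\<^sub>R x)) h =
     inverse c *\<^sub>R inverse (c ^ length hs) *\<^sub>R frechet_derivative ?F (at x) h" by simp
  then show ?case using assms(3) by (simp add: field_simps)
qed

section \<open>The topology of uniform convergence of all derivatives\<close>

text \<open>This is the tube lemma for the compact set \<open>K\<close>.\<close>

lemma jointly_continuous_open_compact:
  assumes "jointly_continuous X U u" "compact K" "K \<subseteq> U" "open W"
  shows "openin X {p \<in> topspace X. \<forall>x\<in>K. u p x \<in> W}"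
proof (subst openin_subopen, intro ballI)
  fix p assume "p \<in> {p \<in> topspace X. \<forall>x\<in>K. u p x \<in> W}"
  then have p: "p \<in> topspace X" "\<And>x. x \<in> K \<Longrightarrow> u p x \<in> W" by auto
  let ?Z = "{z \<in> topspace (prod_topology X (top_of_set U)). (\<lambda>(p, x). u p x) z \<in> W}"
  have Z: "openin (prod_topology X (top_of_set U)) ?Z"
    using assms(1) unfolding jointly_continuous_def
    by (rule openin_continuous_map_preimage) (simp add: assms(4))
  have "compactin (top_of_set U) K" using assms(2,3) by (simp add: compactin_subtopology)
  moreover have "{p} \<times> K \<subseteq> ?Z" using p assms(3) by auto
  ultimately have "\<exists>N V. openin X N \<and> openin (top_of_set U) V \<and> p \<in> N \<and> K \<subseteq> V \<and> N \<times> V \<subseteq> ?Z"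
    by (rule tube_lemma_right[OF Z _ p(1)])
  then obtain N V where NV: "openin X N" "p \<in> N" "K \<subseteq> V" "N \<times> V \<subseteq> ?Z"
    by (elim exE conjE) (rule that)
  show "\<exists>T. openin X T \<and> p \<in> T \<and> T \<subseteq> {p \<in> topspace X. \<forall>x\<in>K. u p x \<in> W}"
  proof (intro exI conjI subsetI)
    fix q assume q: "q \<in> N"
    then have "(q, x) \<in> ?Z" if "x \<in> K" for x using NV(3,4) that by blast
    then show "q \<in> {p \<in> topspace X. \<forall>x\<in>K. u p x \<in> W}" using q openin_subset[OF NV(1)] by auto
  qed (use NV in auto)
qed

text \<open>The tube lemma, applied to the distance from the slice at \<open>p\<close>, upgrades
  joint continuity to uniform closeness on compact sets, which is what sup seminorms
  require.\<close>

lemma jointly_continuous_uniform: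
  fixes u :: "'p \<Rightarrow> 'a::topological_space \<Rightarrow> 'b::metric_space"
  assumes "jointly_continuous X U u" "compact K" "K \<subseteq> U" "p \<in> topspace X" "e > 0"
  obtains N where "openin X N" "p \<in> N" "\<And>q x. q \<in> N \<Longrightarrow> x \<in> K \<Longrightarrow> dist (u q x) (u p x) < e"
proof -
  have "jointly_continuous X U (\<lambda>q x. u p x)"
    by (rule jointly_continuous_param[OF assms(1), where \<eta>="\<lambda>_. p"]) (simp add: assms(4))
  then have "jointly_continuous X U (\<lambda>q x. dist (u q x) (u p x))"
    by (rule jointly_continuous_binary[OF assms(1)]) (intro continuous_intros)
  from jointly_continuous_open_compact[OF this assms(2,3), of "{..<e}"]
  have "openin X {q \<in> topspace X. \<forall>x\<in>K. dist (u q x) (u p x) \<in> {..<e}}" by simp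
  then show ?thesis by (rule that) (use assms in auto)
qed

section \<open>Topologies generated by seminorms\<close>

lemma seminorm_onD:
  assumes "seminorm_on V p"
  shows "x \<in> V \<Longrightarrow> 0 \<le> p x" "x \<in> V \<Longrightarrow> y \<in> V \<Longrightarrow> p (x + y) \<le> p x + p y"
    "x \<in> V \<Longrightarrow> p (c *\<^sub>R x) = \<bar>c\<bar> * p x"
  using assms by (auto simp: seminorm_on_def)

lemma seminorm_on_zero: "seminorm_on V p \<Longrightarrow> subspace V \<Longrightarrow> p 0 = 0"
  using seminorm_onD(3)[of V p 0 0] by (simp add: subspace_0)

lemma seminorm_on_triangle:
  assumes "seminorm_on V p" "subspace V" "x \<in> V" "y \<in> V" "z \<in> V"
  shows "p (x - z) \<le> p (x - y) + p (y - z)"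
  using seminorm_onD(2)[OF assms(1), of "x - y" "y - z"] assms(2-) by (simp add: subspace_diff)

lemma topspace_seminorm_topology:
  assumes "subspace V" "P \<noteq> {}" "\<forall>p\<in>P. seminorm_on V p"
  shows "topspace (seminorm_topology V P) = V"
proof -
  obtain p where p: "p \<in> P" using assms(2) by blast
  show ?thesis unfolding seminorm_topology_def topology_generated_by_topspace
  proof (intro equalityI subsetI)
    fix x assume x: "x \<in> V"
    have "{y \<in> V. p (y - x) < 1} \<in> {{y \<in> V. p (y - x) < e} |p x e. p \<in> P \<and> x \<in> V \<and> 0 < e}"
      using p x zero_less_one by blast
    moreover have "x \<in> {y \<in> V. p (y - x) < 1}"
      using x seminorm_on_zero[OF assms(3)[rule_format, OF p] assms(1)] by simp
    ultimately show "x \<in> \<Union>{{y \<in> V. p (y - x) < e} |p x e. p \<in> P \<and> x \<in> V \<and> 0 < e}" by (rule UnionI)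
  qed auto
qed

text \<open>A generating set uses one seminorm and an arbitrary centre. The triangle inequality
  moves the centre to the point in question, and finite intersections take the smaller
  radius.\<close>

lemma openin_seminorm_topology:
  assumes V: "subspace V" and P: "P \<noteq> {}" "\<forall>p\<in>P. seminorm_on V p"
  shows "openin (seminorm_topology V P) A \<longleftrightarrow>
    A \<subseteq> V \<and> (\<forall>x\<in>A. \<exists>Q e. finite Q \<and> Q \<subseteq> P \<and> e > 0 \<and> {y \<in> V. \<forall>p\<in>Q. p (y - x) < e} \<subseteq> A)"
    (is "?L \<longleftrightarrow> ?R A")
proof
  assume L: ?L
  then have "A \<subseteq> V" using openin_subset topspace_seminorm_topology[OF assms] by metis
  moreover from L have "\<forall>x\<in>A. \<exists>Q e. finite Q \<and> Q \<subseteq> P \<and> e > 0 \<and> {y \<in> V. \<forall>p\<in>Q. p (y - x) < e} \<subseteq> A"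
    unfolding seminorm_topology_def openin_topology_generated_by_iff
  proof (induction rule: generate_topology_on.induct)
    case (Int a b)
    show ?case
    proof
      fix x assume x: "x \<in> a \<inter> b"
      from bspec[OF Int.IH(1) IntD1[OF x]] obtain Q e
        where 1: "finite Q" "Q \<subseteq> P" "e > 0" "{y \<in> V. \<forall>p\<in>Q. p (y - x) < e} \<subseteq> a" by (elim exE conjE) (rule that)
      from bspec[OF Int.IH(2) IntD2[OF x]] obtain Q' e'
        where 2: "finite Q'" "Q' \<subseteq> P" "e' > 0" "{y \<in> V. \<forall>p\<in>Q'. p (y - x) < e'} \<subseteq> b" by (elim exE conjE) (rule that)
      show "\<exists>Q e. finite Q \<and> Q \<subseteq> P \<and> e > 0 \<and> {y \<in> V. \<forall>p\<in>Q. p (y - x) < e} \<subseteq> a \<inter> b"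
        by (rule exI[of _ "Q \<union> Q'"], rule exI[of _ "min e e'"]) (use 1 2 in auto)
    qed
  next
    case (UN K)
    then show ?case by (meson Sup_upper Union_iff subset_trans)
  next
    case (Basis s)
    then obtain p x0 e where s: "s = {y \<in> V. p (y - x0) < e}" "p \<in> P" "x0 \<in> V" "0 < e"
      unfolding mem_Collect_eq by (elim exE conjE) (rule that)
    show ?case
    proof
      fix x assume x: "x \<in> s"
      have "p (y - x0) < e" if "y \<in> V" "p (y - x) < e - p (x - x0)" for y
        using seminorm_on_triangle[OF P(2)[rule_format, OF s(2)] V that(1), of x x0] x s that by auto
      then show "\<exists>Q e. finite Q \<and> Q \<subseteq> P \<and> e > 0 \<and> {y \<in> V. \<forall>p\<in>Q. p (y - x) < e} \<subseteq> s"
        by (intro exI[of _ "{p}"] exI[of _ "e - p (x - x0)"]) (use s x in auto)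
    qed
  qed simp
  ultimately show "?R A" by blast
next
  assume R: "?R A"
  have *: "openin (seminorm_topology V P) {y \<in> V. \<forall>p\<in>Q. p (y - x) < e}"
    if "finite Q" "Q \<subseteq> P" "e > 0" "x \<in> V" for Q x and e :: real
    using that(1,2)
  proof (induction Q)
    case empty
    then show ?case using openin_topspace[of "seminorm_topology V P"] by (simp add: topspace_seminorm_topology[OF assms])
  next
    case (insert q Q)
    have "openin (seminorm_topology V P) {y \<in> V. q (y - x) < e}"
      unfolding seminorm_topology_def by (rule topology_generated_by_Basis) (use insert.prems that in blast)
    moreover have "{y \<in> V. \<forall>p\<in>insert q Q. p (y - x) < e} = {y \<in> V. q (y - x) < e} \<inter> {y \<in> V. \<forall>p\<in>Q. p (y - x) < e}"
      by blast
    ultimately show ?case using insert by auto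
  qed
  show ?L
  proof (subst openin_subopen, intro ballI)
    fix x assume x: "x \<in> A"
    from bspec[OF conjunct2[OF R] x] obtain Q e
      where Q: "finite Q" "Q \<subseteq> P" "e > 0" "{y \<in> V. \<forall>p\<in>Q. p (y - x) < e} \<subseteq> A" by (elim exE conjE) (rule that)
    have "x \<in> V" using x R by blast
    moreover have "p (x - x) < e" if "p \<in> Q" for p
      using seminorm_on_zero[of V p] P(2) V that Q by auto
    ultimately show "\<exists>T. openin (seminorm_topology V P) T \<and> x \<in> T \<and> T \<subseteq> A"
      using *[OF Q(1-3)] Q(4) by (intro exI[of _ "{y \<in> V. \<forall>p\<in>Q. p (y - x) < e}"]) auto
  qed
qed

lemma seminorm_on_subset: "seminorm_on V p \<Longrightarrow> W \<subseteq> V \<Longrightarrow> seminorm_on W p"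
  by (simp add: seminorm_on_def subset_iff)

text \<open>Restricting generators does not suffice: those for \<open>V\<close> are centred anywhere
  in \<open>V\<close>, those for \<open>W\<close> in \<open>W\<close>. Neighbourhoods centred at the
  point in question remove the difference.\<close>

lemma subtopology_seminorm_topology:
  assumes V: "subspace V" and P: "P \<noteq> {}" "\<forall>p\<in>P. seminorm_on V p" and W: "subspace W" "W \<subseteq> V"
  shows "subtopology (seminorm_topology V P) W = seminorm_topology W P"
proof -
  have PW: "\<forall>p\<in>P. seminorm_on W p" using P W seminorm_on_subset by blast
  have "openin (subtopology (seminorm_topology V P) W) A \<longleftrightarrow> openin (seminorm_topology W P) A" for A
  proof
    assume "openin (subtopology (seminorm_topology V P) W) A"
    then obtain B where B: "openin (seminorm_topology V P) B" "A = B \<inter> W" by (auto simp: openin_subtopology)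
    show "openin (seminorm_topology W P) A"
      unfolding openin_seminorm_topology[OF W(1) P(1) PW]
    proof (intro conjI ballI)
      fix x assume "x \<in> A"
      then obtain Q e where "finite Q" "Q \<subseteq> P" "e > 0" "{y \<in> V. \<forall>p\<in>Q. p (y - x) < e} \<subseteq> B"
        using B openin_seminorm_topology[OF V P] by auto
      then show "\<exists>Q e. finite Q \<and> Q \<subseteq> P \<and> e > 0 \<and> {y \<in> W. \<forall>p\<in>Q. p (y - x) < e} \<subseteq> A"
        using B(2) W(2) by (intro exI[of _ Q] exI[of _ e]) auto
    qed (use B in auto)
  next
    assume A: "openin (seminorm_topology W P) A"
    have "\<exists>T. openin (subtopology (seminorm_topology V P) W) T \<and> x \<in> T \<and> T \<subseteq> A" if x: "x \<in> A" for x
    proof -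
      obtain Q e where Q: "finite Q" "Q \<subseteq> P" "e > 0" "{y \<in> W. \<forall>p\<in>Q. p (y - x) < e} \<subseteq> A"
        using A x openin_seminorm_topology[OF W(1) P(1) PW] by meson
      have xV: "x \<in> V" "x \<in> W" using A x W(2) openin_seminorm_topology[OF W(1) P(1) PW] by auto
      let ?B = "{y \<in> V. \<forall>p\<in>Q. p (y - x) < e}"
      have "openin (seminorm_topology V P) ?B"
        unfolding openin_seminorm_topology[OF V P]
      proof (intro conjI ballI)
        fix y assume y: "y \<in> ?B"
        \<comment> \<open>Inserting \<open>e\<close> keeps the set nonempty when \<open>Q\<close> is
          empty.\<close>
        define d where "d = Min (insert e ((\<lambda>p. e - p (y - x)) ` Q))"
        have "d > 0" unfolding d_def using Q y by (subst Min_gr_iff) auto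
        moreover have "p (z - x) < e" if "p \<in> Q" "z \<in> V" "p (z - y) < d" for p z
        proof -
          have "d \<le> e - p (y - x)" unfolding d_def using Q that by (intro Min_le) auto
          then show ?thesis
            using seminorm_on_triangle[OF P(2)[rule_format] V, of p z y x] that Q y xV by auto
        qed
        ultimately show "\<exists>Q e. finite Q \<and> Q \<subseteq> P \<and> e > 0 \<and> {z \<in> V. \<forall>p\<in>Q. p (z - y) < e} \<subseteq> ?B"
          using Q by (intro exI[of _ Q] exI[of _ d]) auto
      qed auto
      moreover have "p (x - x) < e" if "p \<in> Q" for p
        using seminorm_on_zero[of V p] P(2) V that Q by auto
      ultimately show ?thesis
        using Q(4) xV W(2) by (intro exI[of _ "?B \<inter> W"]) (auto simp: openin_subtopology_Int)
    qed
    then show "openin (subtopology (seminorm_topology V P) W) A" by (subst openin_subopen) blast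
  qed
  then show ?thesis by (simp add: topology_eq)
qed

section \<open>The C-infinity seminorms and the evaluation map\<close>

lemma iterated_derivative_bdd:
  assumes "f \<in> Cinf"
  shows "bdd_above ((\<lambda>x. norm (iterated_derivative hs (radial_ext f) x)) ` S3)"
proof -
  have "continuous_on S3 (iterated_derivative hs (radial_ext f))"
    by (intro continuous_at_imp_continuous_on ballI has_derivative_continuous[OF
          iterated_derivative_has_derivative[OF CinfD[OF assms, of "discrete_topology {()}"]]]) auto
  then have "compact ((\<lambda>x. norm (iterated_derivative hs (radial_ext f) x)) ` S3)"
    by (intro compact_continuous_image continuous_intros compact_S3)
  then show ?thesis by (simp add: bounded_imp_bdd_above compact_imp_bounded)
qed

lemma Cinf_seminorm_upper:
  "f \<in> Cinf \<Longrightarrow> x \<in> S3 \<Longrightarrow> norm (iterated_derivative hs (radial_ext f) x) \<le> Cinf_seminorm hs f"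
  unfolding Cinf_seminorm_def by (rule cSUP_upper[OF _ iterated_derivative_bdd])

lemma Cinf_seminorm_least:
  "(\<And>x. x \<in> S3 \<Longrightarrow> norm (iterated_derivative hs (radial_ext f) x) \<le> c) \<Longrightarrow> Cinf_seminorm hs f \<le> c"
  unfolding Cinf_seminorm_def by (rule cSUP_least) (use S3_nonempty in auto)

text \<open>Homogeneity carries the seminorm bound from x / |x| on the sphere to x.\<close>

lemma norm_iterated_derivative_diff_le:
  assumes "f \<in> Cinf" "g \<in> Cinf" "x \<noteq> 0"
  shows "norm (iterated_derivative hs (radial_ext f) x - iterated_derivative hs (radial_ext g) x)
    \<le> inverse (norm x ^ length hs) * Cinf_seminorm hs (f - g)"
proof -
  define s where "s = x /\<^sub>R norm x"
  have s: "s \<in> S3" "x = norm x *\<^sub>R s" using assms(3) by (simp_all add: s_def)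
  have fg: "f - g \<in> Cinf" using assms subspace_Cinf by (simp add: subspace_diff)
  have "norm (iterated_derivative hs (radial_ext (f - g)) x)
     = inverse (norm x ^ length hs) * norm (iterated_derivative hs (radial_ext (f - g)) s)"
    by (subst s(2), subst iterated_derivative_homogeneous[OF fg S3_nonzero[OF s(1)]]) (use assms(3) in auto)
  also have "\<dots> \<le> inverse (norm x ^ length hs) * Cinf_seminorm hs (f - g)"
    by (intro mult_left_mono Cinf_seminorm_upper fg s) simp
  finally show ?thesis unfolding iterated_derivative_diff[OF assms] .
qed

lemma seminorm_on_Cinf: "seminorm_on Cinf (Cinf_seminorm hs)"
  unfolding seminorm_on_def
proof (intro conjI ballI allI)
  obtain z where z: "z \<in> S3" using S3_nonempty by blast
  fix f assume f: "f \<in> Cinf"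
  show nn: "0 \<le> Cinf_seminorm hs f"
    using order_trans[OF norm_ge_zero Cinf_seminorm_upper[OF f z]] .
  show "Cinf_seminorm hs (f + g) \<le> Cinf_seminorm hs f + Cinf_seminorm hs g" if g: "g \<in> Cinf" for g
  proof (rule Cinf_seminorm_least)
    fix x assume x: "x \<in> S3"
    show "norm (iterated_derivative hs (radial_ext (f + g)) x) \<le> Cinf_seminorm hs f + Cinf_seminorm hs g"
      unfolding iterated_derivative_add[OF f g S3_nonzero[OF x]]
      by (intro order_trans[OF norm_triangle_ineq] add_mono Cinf_seminorm_upper f g x)
  qed
  fix c :: real
  \<comment> \<open>One inequality for all scalars is enough: used for \<open>inverse c\<close> and
    \<open>c *\<^sub>R f\<close> it gives the converse when c \<noteq> 0.\<close>
  have le: "Cinf_seminorm hs (c *\<^sub>R f) \<le> \<bar>c\<bar> * Cinf_seminorm hs f" if f: "f \<in> Cinf" for c f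
  proof (rule Cinf_seminorm_least)
    fix x assume x: "x \<in> S3"
    show "norm (iterated_derivative hs (radial_ext (c *\<^sub>R f)) x) \<le> \<bar>c\<bar> * Cinf_seminorm hs f"
      unfolding iterated_derivative_scaleR[OF f S3_nonzero[OF x]] norm_scaleR
      by (intro mult_left_mono Cinf_seminorm_upper f x) auto
  qed
  show "Cinf_seminorm hs (c *\<^sub>R f) = \<bar>c\<bar> * Cinf_seminorm hs f"
  proof (cases "c = 0")
    case True
    have "0 \<le> Cinf_seminorm hs (c *\<^sub>R f)"
      by (rule order_trans[OF norm_ge_zero Cinf_seminorm_upper[OF _ z]]) (simp add: f subspace_Cinf subspace_scale)
    then show ?thesis using True le[OF f, of c] by simp
  next
    case False
    have "c *\<^sub>R f \<in> Cinf" by (simp add: f subspace_Cinf subspace_scale)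
    from le[OF this, of "inverse c"] False have "Cinf_seminorm hs f \<le> \<bar>inverse c\<bar> * Cinf_seminorm hs (c *\<^sub>R f)" by simp
    then have "\<bar>c\<bar> * Cinf_seminorm hs f \<le> Cinf_seminorm hs (c *\<^sub>R f)" using False by (simp add: field_simps)
    then show ?thesis using le[OF f, of c] by simp
  qed
qed

lemma Cinf_seminorms: "Cinf_seminorm ` lists Basis \<noteq> {}"
  "\<forall>p\<in>Cinf_seminorm ` lists Basis. seminorm_on Cinf p"
  using seminorm_on_Cinf by auto

lemma topspace_Cinf_topology [simp]: "topspace Cinf_topology = Cinf"
  unfolding Cinf_topology_def by (rule topspace_seminorm_topology[OF subspace_Cinf Cinf_seminorms])

text \<open>Joint continuity of an iterated derivative becomes, by compactness of the sphere,
  continuity for the corresponding seminorm; a neighbourhood involves finitely many of them.\<close>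

lemma continuous_map_into_Cinf:
  assumes "smooth_family X (- {0}) (\<lambda>p. radial_ext (T p))" "\<And>p x. p \<in> topspace X \<Longrightarrow> x \<notin> S3 \<Longrightarrow> T p x = 0"
  shows "continuous_map X Cinf_topology T"
proof -
  have TC: "T p \<in> Cinf" if "p \<in> topspace X" for p
    by (rule Cinf_from_family[OF assms(1) that]) (use assms(2) that in auto)
  show ?thesis
    unfolding continuous_map_def
  proof (intro conjI allI impI)
    show "T \<in> topspace X \<rightarrow> topspace Cinf_topology" using TC by simp
    fix A assume "openin Cinf_topology A"
    then have A: "A \<subseteq> Cinf" "\<And>x. x\<in>A \<Longrightarrow> \<exists>Q e. finite Q \<and> Q \<subseteq> Cinf_seminorm ` lists Basis \<and> e > 0 \<and>
         {y \<in> Cinf. \<forall>p\<in>Q. p (y - x) < e} \<subseteq> A"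
      unfolding Cinf_topology_def openin_seminorm_topology[OF subspace_Cinf Cinf_seminorms] by auto
    show "openin X {p \<in> topspace X. T p \<in> A}"
    proof (subst openin_subopen, intro ballI)
      fix p assume "p \<in> {p \<in> topspace X. T p \<in> A}"
      then have p: "p \<in> topspace X" "T p \<in> A" by auto
      obtain Q e where Q: "finite Q" "Q \<subseteq> Cinf_seminorm ` lists Basis" "e > 0"
         "{y \<in> Cinf. \<forall>s\<in>Q. s (y - T p) < e} \<subseteq> A" using A(2)[OF p(2)] by blast
      have "\<exists>N. openin X N \<and> p \<in> N \<and> (\<forall>q\<in>N. s (T q - T p) < e)" if sQ: "s \<in> Q" for s
      proof -
        obtain hs where hs: "s = Cinf_seminorm hs" using Q(2) sQ by blast
        have "jointly_continuous X (- {0}) (\<lambda>q. iterated_derivative hs (radial_ext (T q)))"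
          by (rule smooth_family_jcont[OF smooth_family_iterated_derivative[OF assms(1)]]) auto
        \<comment> \<open>Half of \<open>e\<close>, because passing to the supremum turns strict
          inequalities into weak ones.\<close>
        then obtain N where N: "openin X N" "p \<in> N"
          "\<And>q x. q \<in> N \<Longrightarrow> x \<in> S3 \<Longrightarrow> dist (iterated_derivative hs (radial_ext (T q)) x)
             (iterated_derivative hs (radial_ext (T p)) x) < e/2"
          by (rule jointly_continuous_uniform[OF _ compact_S3 _ p(1), of _ _ "e/2"]) (use Q(3) in auto)
        have le: "s (T q - T p) \<le> e/2" if "q \<in> N" for q
          unfolding hs
        proof (rule Cinf_seminorm_least)
          fix x assume x: "x \<in> S3"
          have "T q \<in> Cinf" "T p \<in> Cinf" using TC that N(1) p(1) openin_subset by auto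
          from iterated_derivative_diff[OF this S3_nonzero[OF x], of hs] N(3)[OF that x]
          show "norm (iterated_derivative hs (radial_ext (T q - T p)) x) \<le> e/2" by (simp add: dist_norm)
        qed
        have "s (T q - T p) < e" if "q \<in> N" for q using le[OF that] Q(3) by linarith
        then show ?thesis using N(1,2) by blast
      qed
      then obtain N where N: "\<And>s. s \<in> Q \<Longrightarrow> openin X (N s) \<and> p \<in> N s \<and> (\<forall>q\<in>N s. s (T q - T p) < e)" by metis
      let ?M = "\<Inter>s\<in>Q. N s"
      have "openin X (topspace X \<inter> ?M)"
        using Q(1) N by (cases "Q = {}") (auto intro!: openin_Int)
      then show "\<exists>M. openin X M \<and> p \<in> M \<and> M \<subseteq> {p \<in> topspace X. T p \<in> A}"
        by (intro exI[of _ "topspace X \<inter> ?M"]) (use N p Q(4) TC in auto)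
    qed
  qed
qed

text \<open>There are two errors: the seminorm bounds the passage from f to g at y, and continuity
  of the derivative of f bounds the passage from y to x. The radius \<open>r\<close> keeps y away
  from the origin, where the homogeneity factor is unbounded.\<close>

lemma jointly_continuous_iterated_derivative:
  assumes "hs \<in> lists Basis"
  shows "jointly_continuous Cinf_topology (- {0}) (\<lambda>f. iterated_derivative hs (radial_ext f))"
  unfolding jointly_continuous_iff topspace_Cinf_topology
proof (intro ballI allI impI)
  fix f and x :: "real^4" and e :: real
  assume f: "f \<in> Cinf" and x: "x \<in> - {0}" and e: "0 < e"
  let ?D = "\<lambda>f. iterated_derivative hs (radial_ext f)" and ?n = "length hs"
  have "isCont (?D f) x"
    by (rule has_derivative_continuous[OF iterated_derivative_has_derivative[OF CinfD[OF f, of "discrete_topology {()}"]]])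
      (use x in auto)
  then obtain d where d: "d > 0" "\<And>y. dist y x < d \<Longrightarrow> dist (?D f y) (?D f x) < e/2"
    using e unfolding continuous_at_eps_delta by (metis half_gt_zero)
  define r where "r = norm x / 2"
  have r: "r > 0" using x by (simp add: r_def)
  define N where "N = {g \<in> Cinf. Cinf_seminorm hs (g - f) < r ^ ?n * (e/2)}"
  have "openin Cinf_topology N"
    unfolding Cinf_topology_def seminorm_topology_def
  proof (rule topology_generated_by_Basis)
    have "Cinf_seminorm hs \<in> Cinf_seminorm ` lists Basis" "0 < r ^ ?n * (e/2)" using assms r e by simp_all
    then show "N \<in> {{y \<in> Cinf. p (y - x) < e} |p x e. p \<in> Cinf_seminorm ` lists Basis \<and> x \<in> Cinf \<and> 0 < e}"
      unfolding N_def using f by blast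
  qed
  moreover have "f \<in> N" unfolding N_def using f r e seminorm_on_zero[OF seminorm_on_Cinf subspace_Cinf] by simp
  moreover have "dist (?D g y) (?D f x) < e" if g: "g \<in> N" and y: "y \<in> - {0}" "dist y x < min d r" for g y
  proof -
    have gC: "g \<in> Cinf" using g by (simp add: N_def)
    have ny: "norm y \<ge> r" using y(2) norm_triangle_ineq2[of x y]
      by (simp add: r_def dist_norm norm_minus_commute)
    have y0: "norm y > 0" "y \<noteq> 0" using y by auto
    have gf: "g - f \<in> Cinf" using gC f subspace_Cinf by (simp add: subspace_diff)
    have "dist (?D g y) (?D f y) \<le> inverse (norm y ^ ?n) * Cinf_seminorm hs (g - f)"
      unfolding dist_norm by (rule norm_iterated_derivative_diff_le[OF gC f y0(2)])
    also have "\<dots> \<le> inverse (r ^ ?n) * Cinf_seminorm hs (g - f)"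
      by (intro mult_right_mono le_imp_inverse_le power_mono ny seminorm_onD(1)[OF seminorm_on_Cinf gf])
        (use r in auto)
    also have "\<dots> < e / 2" using g r by (simp add: N_def field_simps)
    finally have "dist (?D g y) (?D f y) < e / 2" .
    then show ?thesis using d(2)[of y] y dist_triangle[of "?D g y" "?D f x" "?D f y"] by auto
  qed
  ultimately show "\<exists>N d. openin Cinf_topology N \<and> f \<in> N \<and> 0 < d \<and>
      (\<forall>g\<in>N. \<forall>y\<in>- {0}. dist y x < d \<longrightarrow> dist (?D g y) (?D f x) < e)"
    using d(1) r by (intro exI[of _ N] exI[of _ "min d r"]) auto
qed

text \<open>The universal smooth family: any continuous map into \<open>Cinf_topology\<close> yields
  a smooth family from it by reparametrization. Only lists over \<open>Basis\<close> occur among the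
  seminorms, so other directions are expanded in the basis.\<close>

lemma smooth_family_radial_ext: "smooth_family Cinf_topology (- {0}) radial_ext"
proof -
  have "C_family n Cinf_topology (- {0}) (\<lambda>f. iterated_derivative hs (radial_ext f))"
    if "hs \<in> lists Basis" for n hs
    using that
  proof (induction n arbitrary: hs)
    case 0 then show ?case by (simp add: jointly_continuous_iterated_derivative)
  next
    case (Suc n)
    let ?D = "\<lambda>f x. frechet_derivative (iterated_derivative hs (radial_ext f)) (at x)"
    have D: "(iterated_derivative hs (radial_ext f) has_derivative ?D f x) (at x)" if "f \<in> Cinf" "x \<noteq> 0" for f x
      using iterated_derivative_has_derivative[OF CinfD[OF that(1), of "discrete_topology {()}"]] that(2) by auto
    show ?case
    proof (rule C_family_SucI[of _ _ _ ?D])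
      fix h :: "real^4"
      have "C_family n Cinf_topology (- {0}) (\<lambda>f x. \<Sum>b\<in>Basis. (h \<bullet> b) *\<^sub>R iterated_derivative (b # hs) (radial_ext f) x)"
        by (intro C_family_sum C_family_bilinear[OF bounded_bilinear_scaleR] C_family_const Suc.IH)
          (use Suc.prems in auto)
      then show "C_family n Cinf_topology (- {0}) (\<lambda>f x. ?D f x h)"
      proof (rule C_family_cong[rotated])
        fix f x assume "f \<in> topspace Cinf_topology" "x \<in> - {0::real^4}"
        then have "linear (?D f x)" using D has_derivative_linear by fastforce
        then show "(\<Sum>b\<in>Basis. (h \<bullet> b) *\<^sub>R iterated_derivative (b # hs) (radial_ext f) x) = ?D f x h"
          using linear_basis_expansion[of "?D f x" h] by simp
      qed auto
    qed (use D jointly_continuous_iterated_derivative Suc.prems in auto)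
  qed
  from this[of "[]"] show ?thesis by (simp add: smooth_family_def)
qed

section \<open>Varying directions and parameter integrals\<close>

lemma smooth_family_param_only:
  assumes "continuous_map X euclidean c"
  shows "smooth_family X U (\<lambda>p x. c p)"
proof -
  have jc: "jointly_continuous X U (\<lambda>p x. c p)"
    using continuous_map_compose[OF continuous_map_fst[of X "top_of_set U"] assms]
    by (simp add: jointly_continuous_def o_def case_prod_unfold)
  have "C_family n X U (\<lambda>p x. c p)" for n
  proof (cases n)
    case (Suc m)
    show ?thesis unfolding Suc
      by (rule C_family_SucI[of _ _ _ "\<lambda>p x h. 0"]) (auto intro: jc C_family_const)
  qed (simp add: jc)
  then show ?thesis by (simp add: smooth_family_def)
qed

lemma smooth_family_directional_derivative:
  assumes u: "smooth_family X U u" and w: "smooth_family X U w" and "open U"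
  shows "smooth_family X U (\<lambda>p x. frechet_derivative (u p) (at x) (w p x))"
proof -
  have "smooth_family X U (\<lambda>p x. \<Sum>b\<in>Basis. (w p x \<bullet> b) *\<^sub>R frechet_derivative (u p) (at x) b)"
    by (intro smooth_family_sum smooth_family_scaleR smooth_family_derivative smooth_family_inner
         smooth_family_const assms)
  then show ?thesis
  proof (rule smooth_family_cong[OF _ \<open>open U\<close>])
    fix p x assume "p \<in> topspace X" "x \<in> U"
    then have "linear (frechet_derivative (u p) (at x))"
      using smooth_family_has_derivative[OF u] has_derivative_linear by blast
    from linear_basis_expansion[OF this]
    show "(\<Sum>b\<in>Basis. (w p x \<bullet> b) *\<^sub>R frechet_derivative (u p) (at x) b) = frechet_derivative (u p) (at x) (w p x)"
      by (rule sym)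
  qed
qed

lemma jointly_continuous_at_param:
  assumes "jointly_continuous X U u" "p \<in> topspace X"
  shows "continuous_on U (u p)"
proof -
  have "continuous_map (top_of_set U) (prod_topology X (top_of_set U)) (\<lambda>x. (p, x))"
    using assms(2) by (intro continuous_map_pairedI) auto
  from continuous_map_compose[OF this assms(1)[unfolded jointly_continuous_def]]
  show ?thesis by (simp add: o_def)
qed

lemma jointly_continuous_integral:
  fixes u :: "'p \<times> real \<Rightarrow> 'a::euclidean_space \<Rightarrow> 'b::euclidean_space"
  assumes "jointly_continuous (prod_topology X (top_of_set {0..1})) U u"
  shows "p \<in> topspace X \<Longrightarrow> continuous_on (U \<times> {0..1}) (\<lambda>(x, s). u (p, s) x)"
    and "jointly_continuous X U (\<lambda>p x. integral {0..1} (\<lambda>s. u (p, s) x))"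
proof -
  let ?I = "top_of_set {0..1::real}"
  \<comment> \<open>The factors are reordered so that (p, x) becomes the parameter and s the
    variable in a compact interval, over which uniformity is needed.\<close>
  have "continuous_map (prod_topology (prod_topology X (top_of_set U)) ?I)
      (prod_topology (prod_topology X ?I) (top_of_set U)) (\<lambda>z. ((fst (fst z), snd z), snd (fst z)))"
    by (intro continuous_map_pairedI continuous_map_snd continuous_map_fst
        continuous_map_of_fst[THEN iffD2] continuous_map_compose[OF continuous_map_fst continuous_map_fst, unfolded o_def]
        continuous_map_compose[OF continuous_map_fst continuous_map_snd, unfolded o_def] disjI2)
  from continuous_map_compose[OF this assms[unfolded jointly_continuous_def]]
  have jc: "jointly_continuous (prod_topology X (top_of_set U)) {0..1} (\<lambda>z s. u (fst z, s) (snd z))"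
    by (simp add: jointly_continuous_def o_def case_prod_unfold)
  show "continuous_on (U \<times> {0..1}) (\<lambda>(x, s). u (p, s) x)" if p: "p \<in> topspace X" for p
  proof -
    have "continuous_map (prod_topology (top_of_set U) ?I) (prod_topology (prod_topology X (top_of_set U)) ?I)
       (\<lambda>z. ((p, fst z), snd z))"
      using p by (intro continuous_map_pairedI continuous_map_snd continuous_map_fst) auto
    from continuous_map_compose[OF this jc[unfolded jointly_continuous_def]]
    show ?thesis by (simp add: o_def case_prod_unfold subtopology_Times[symmetric])
  qed
  show "jointly_continuous X U (\<lambda>p x. integral {0..1} (\<lambda>s. u (p, s) x))"
  proof -
    have "continuous_map (prod_topology X (top_of_set U)) Met_TC.mtopology (\<lambda>(p, x). integral {0..1} (\<lambda>s. u (p, s) x))"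
      unfolding Met_TC.continuous_map_to_metric
    proof (intro ballI allI impI)
      fix z and e :: real assume z: "z \<in> topspace (prod_topology X (top_of_set U))" and e: "0 < e"
      obtain N where N: "openin (prod_topology X (top_of_set U)) N" "z \<in> N"
        "\<And>q s. q \<in> N \<Longrightarrow> s \<in> {0..1} \<Longrightarrow> dist (u (fst q, s) (snd q)) (u (fst z, s) (snd z)) < e/2"
        by (rule jointly_continuous_uniform[OF jc _ _ z, of "{0..1}" "e/2"]) (use e in auto)
      have int: "(\<lambda>s. u (fst q, s) (snd q)) integrable_on {0..1}" if "q \<in> topspace (prod_topology X (top_of_set U))" for q
        by (intro integrable_continuous_interval jointly_continuous_at_param[OF jc that])
      show "\<exists>N. openin (prod_topology X (top_of_set U)) N \<and> z \<in> N \<and>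
        (\<forall>q\<in>N. (case q of (p, x) \<Rightarrow> integral {0..1} (\<lambda>s. u (p, s) x)) \<in>
          Met_TC.mball (case z of (p, x) \<Rightarrow> integral {0..1} (\<lambda>s. u (p, s) x)) e)"
      proof (intro exI conjI ballI)
        fix q assume q: "q \<in> N"
        have qt: "q \<in> topspace (prod_topology X (top_of_set U))" using q N(1) openin_subset by blast
        have "integral {0..1} (\<lambda>s. u (fst z, s) (snd z)) - integral {0..1} (\<lambda>s. u (fst q, s) (snd q)) =
            integral {0..1} (\<lambda>s. u (fst z, s) (snd z) - u (fst q, s) (snd q))"
          by (rule Henstock_Kurzweil_Integration.integral_diff[symmetric]) (use int z qt in auto)
        also have "norm \<dots> \<le> integral {0..1::real} (\<lambda>s. e/2)"
          by (rule integral_norm_bound_integral)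
            (use N(3)[OF q] int[OF z] int[OF qt] in \<open>auto intro!: integrable_diff simp: dist_norm norm_minus_commute less_imp_le\<close>)
        also have "\<dots> < e" using e by simp
        finally show "(case q of (p, x) \<Rightarrow> integral {0..1} (\<lambda>s. u (p, s) x)) \<in>
          Met_TC.mball (case z of (p, x) \<Rightarrow> integral {0..1} (\<lambda>s. u (p, s) x)) e"
          by (simp add: case_prod_unfold dist_norm)
      qed (use N in auto)
    qed
    then show ?thesis by (simp add: jointly_continuous_def)
  qed
qed

text \<open>Differentiation under the integral sign reproduces the same kind of integral, with
  \<open>u'\<close> at a fixed direction in place of \<open>u\<close>.\<close>

lemma C_family_integral:
  fixes u :: "'p \<times> real \<Rightarrow> 'a::euclidean_space \<Rightarrow> 'b::euclidean_space"
  assumes "C_family n (prod_topology X (top_of_set {0..1})) U u" "open U"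
  shows "C_family n X U (\<lambda>p x. integral {0..1} (\<lambda>s. u (p, s) x))"
  using assms(1)
proof (induction n arbitrary: u)
  case 0 then show ?case by (simp add: jointly_continuous_integral)
next
  case (Suc n)
  from Suc.prems obtain u' where u': "jointly_continuous (prod_topology X (top_of_set {0..1})) U u"
    "\<And>p x. p\<in>topspace (prod_topology X (top_of_set {0..1})) \<Longrightarrow> x \<in> U \<Longrightarrow> (u p has_derivative u' p x) (at x)"
    "\<And>h. C_family n (prod_topology X (top_of_set {0..1})) U (\<lambda>p x. u' p x h)"
    by (rule C_family_SucE) (rule that)
  show ?case
  proof (rule C_family_SucI[of _ _ _ "\<lambda>p x h. integral {0..1} (\<lambda>s. u' (p, s) x h)"])
    show "jointly_continuous X U (\<lambda>p x. integral {0..1} (\<lambda>s. u (p, s) x))"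
      by (rule jointly_continuous_integral(2)[OF u'(1)])
    show "C_family n X U (\<lambda>p x. integral {0..1} (\<lambda>s. u' (p, s) x h))" for h
      using Suc.IH[OF u'(3)] .
    fix p x assume p: "p \<in> topspace X" and x: "x \<in> U"
    obtain r where r: "r > 0" "ball x r \<subseteq> U" using \<open>open U\<close> x open_contains_ball by blast
    \<comment> \<open>The Leibniz rule wants the derivative as a bounded linear function. In finite
      dimension its continuity is recovered from continuity in each fixed direction.\<close>
    define fx where "fx y s = Blinfun (u' (p, s) y)" for y s
    have D: "(u (p, s) has_derivative blinfun_apply (fx y s)) (at y)" if "y \<in> U" "s \<in> {0..1}" for y s
    proof -
      have "(u (p, s) has_derivative u' (p, s) y) (at y)" by (rule u'(2)) (use p that in auto)
      note bl = bounded_linear_Blinfun_apply[OF has_derivative_bounded_linear[OF this]]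
      show ?thesis unfolding fx_def bl by fact
    qed
    have app: "blinfun_apply (fx y s) h = u' (p, s) y h" if "y \<in> U" "s \<in> {0..1}" for y s h
    proof -
      have "(u (p, s) has_derivative u' (p, s) y) (at y)" by (rule u'(2)) (use p that in auto)
      note bl = bounded_linear_Blinfun_apply[OF has_derivative_bounded_linear[OF this]]
      show ?thesis unfolding fx_def bl ..
    qed
    have cont: "continuous_on (U \<times> {0..1}) (\<lambda>z. fx (fst z) (snd z))"
    proof (rule continuous_on_blinfun_componentwise)
      fix b :: 'a
      have "continuous_on (U \<times> {0..1}) (\<lambda>(y, s). u' (p, s) y b)"
        by (rule jointly_continuous_integral(1)[OF C_family_cont[OF u'(3)] p])
      then show "continuous_on (U \<times> {0..1}) (\<lambda>z. blinfun_apply (fx (fst z) (snd z)) b)"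
        by (rule continuous_on_eq) (auto simp: app)
    qed
    have "((\<lambda>y. integral (cbox 0 1) (\<lambda>s. u (p, s) y)) has_derivative integral (cbox 0 1) (fx x)) (at x within ball x r)"
    proof (rule leibniz_rule)
      show "((\<lambda>y. u (p, s) y) has_derivative blinfun_apply (fx y s)) (at y within ball x r)"
        if "y \<in> ball x r" "s \<in> cbox 0 1" for y s
        by (rule has_derivative_at_withinI, rule D) (use that r in auto)
      show "(\<lambda>s. u (p, s) y) integrable_on cbox 0 1" if "y \<in> ball x r" for y
      proof -
        have "continuous_on {0..1} (\<lambda>s. (case (y, s) of (x, s) \<Rightarrow> u (p, s) x))"
          by (rule continuous_on_compose2[OF jointly_continuous_integral(1)[OF u'(1) p]])
            (use that r in \<open>auto intro!: continuous_intros\<close>)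
        then show ?thesis by (simp add: integrable_continuous_interval)
      qed
      show "continuous_on (ball x r \<times> cbox 0 1) (\<lambda>(y, s). fx y s)"
        using continuous_on_subset[OF cont, of "ball x r \<times> cbox 0 1"] r by (auto simp: case_prod_unfold)
    qed (use r in auto)
    then have "((\<lambda>y. integral {0..1} (\<lambda>s. u (p, s) y)) has_derivative integral {0..1} (fx x)) (at x)"
      using at_within_open[of x "ball x r"] r by (simp only: centre_in_ball open_ball cbox_interval)
    moreover have "blinfun_apply (integral {0..1} (fx x)) h = integral {0..1} (\<lambda>s. u' (p, s) x h)" for h
    proof -
      have "continuous_on {0..1} (\<lambda>s. (\<lambda>z. fx (fst z) (snd z)) (x, s))"
        by (rule continuous_on_compose2[OF cont]) (use x in \<open>auto intro!: continuous_intros\<close>)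
      then have "fx x integrable_on {0..1}" by (simp add: integrable_continuous_interval)
      then have "blinfun_apply (integral {0..1} (fx x)) h = integral {0..1} (\<lambda>s. blinfun_apply (fx x s) h)"
        by (rule blinfun_apply_integral)
      also have "\<dots> = integral {0..1} (\<lambda>s. u' (p, s) x h)"
        by (rule Henstock_Kurzweil_Integration.integral_cong) (use app x in auto)
      finally show ?thesis .
    qed
    ultimately show "((\<lambda>y. integral {0..1} (\<lambda>s. u (p, s) y)) has_derivative (\<lambda>h. integral {0..1} (\<lambda>s. u' (p, s) x h))) (at x)"
      by (auto elim!: has_derivative_eq_rhs)
  qed
qed

lemma smooth_family_integral:
  fixes u :: "'p \<times> real \<Rightarrow> 'a::euclidean_space \<Rightarrow> 'b::euclidean_space"
  assumes "smooth_family (prod_topology X (top_of_set {0..1})) U u" "open U"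
  shows "smooth_family X U (\<lambda>p x. integral {0..1} (\<lambda>s. u (p, s) x))"
  using assms by (simp add: smooth_family_def C_family_integral)

text \<open>Each iterated derivative of the sequence converges on \<open>- {0}\<close> to a function
  \<open>G hs\<close>, uniformly away from the origin by homogeneity. The theorem on differentiating
  a sequence with uniformly convergent derivatives identifies the partial derivative of
  \<open>G hs\<close> along b with \<open>G (b # hs)\<close>, so all these limits are
  smooth.\<close>

lemma Cinf_complete:
  fixes s :: "nat \<Rightarrow> real^4 \<Rightarrow> real^4"
  assumes s: "\<And>i. s i \<in> Cinf"
    and cau: "\<And>hs e. hs \<in> lists Basis \<Longrightarrow> e > 0 \<Longrightarrow> \<exists>N. \<forall>i\<ge>N. \<forall>j\<ge>N. Cinf_seminorm hs (s i - s j) < e"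
  shows "\<exists>l\<in>Cinf. \<forall>hs\<in>lists Basis. \<forall>e>0. \<exists>N. \<forall>i\<ge>N. Cinf_seminorm hs (s i - l) < e"
proof -
  let ?L = "lists (Basis :: (real^4) set)" and ?X = "discrete_topology {()}"
  define D where "D i hs = iterated_derivative hs (radial_ext (s i))" for i hs
  define G where "G hs x = lim (\<lambda>i. D i hs x)" for hs x
  have bound: "norm (D i hs x - D j hs x) \<le> inverse (norm x ^ length hs) * Cinf_seminorm hs (s i - s j)"
    if "x \<noteq> 0" for i j hs x
    unfolding D_def by (rule norm_iterated_derivative_diff_le[OF s s that])
  have lim: "(\<lambda>i. D i hs x) \<longlonglongrightarrow> G hs x" if hs: "hs \<in> ?L" and x: "x \<noteq> 0" for hs x
  proof -
    have "Cauchy (\<lambda>i. D i hs x)"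
    proof (rule metric_CauchyI)
      fix e :: real assume e: "e > 0"
      have "0 < e * norm x ^ length hs" using e x by simp
      from cau[OF hs this] obtain N where
        N: "\<And>i j. i \<ge> N \<Longrightarrow> j \<ge> N \<Longrightarrow> Cinf_seminorm hs (s i - s j) < e * norm x ^ length hs" by blast
      have "dist (D i hs x) (D j hs x) < e" if "i \<ge> N" "j \<ge> N" for i j
      proof -
        have "norm (D i hs x - D j hs x) \<le> inverse (norm x ^ length hs) * Cinf_seminorm hs (s i - s j)" by (rule bound[OF x])
        also have "\<dots> < inverse (norm x ^ length hs) * (e * norm x ^ length hs)"
          by (intro mult_strict_left_mono N that) (use x in simp)
        also have "\<dots> = e" using x by simp
        finally show ?thesis by (simp add: dist_norm)
      qed
      then show "\<exists>M. \<forall>m\<ge>M. \<forall>n\<ge>M. dist (D m hs x) (D n hs x) < e" by blast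
    qed
    then show ?thesis unfolding G_def using Cauchy_convergent convergent_LIMSEQ_iff by blast
  qed
  have unif: "\<exists>N. \<forall>i\<ge>N. \<forall>x. x \<noteq> 0 \<longrightarrow> norm (D i hs x - G hs x) \<le> inverse (norm x ^ length hs) * e"
    if hs: "hs \<in> ?L" and e: "e > 0" for hs and e :: real
  proof -
    from cau[OF hs e] obtain N where N: "\<And>i j. i \<ge> N \<Longrightarrow> j \<ge> N \<Longrightarrow> Cinf_seminorm hs (s i - s j) < e" by blast
    have "norm (D i hs x - G hs x) \<le> inverse (norm x ^ length hs) * e" if "i \<ge> N" "x \<noteq> 0" for i x
    proof (rule LIMSEQ_le_const2)
      show "(\<lambda>j. norm (D i hs x - D j hs x)) \<longlonglongrightarrow> norm (D i hs x - G hs x)"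
        by (intro tendsto_intros lim hs that)
      have "norm (D i hs x - D j hs x) \<le> inverse (norm x ^ length hs) * e" if "j \<ge> N" for j
        by (rule order_trans[OF bound[OF \<open>x \<noteq> 0\<close>]]) (use N[OF \<open>i \<ge> N\<close> that] in \<open>simp add: mult_left_mono less_imp_le\<close>)
      then show "\<exists>N. \<forall>j\<ge>N. norm (D i hs x - D j hs x) \<le> inverse (norm x ^ length hs) * e" by blast
    qed
    then show ?thesis by blast
  qed
  have dG: "(G hs has_derivative (\<lambda>h. \<Sum>b\<in>Basis. (h \<bullet> b) *\<^sub>R G (b # hs) x)) (at x)"
    if hs: "hs \<in> ?L" and x: "x \<noteq> 0" for hs x
  proof -
    define r where "r = norm x / 2"
    have r: "r > 0" using x by (simp add: r_def)
    have nb: "norm y \<ge> r" "y \<noteq> 0" if "y \<in> ball x r" for y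
    proof -
      have "norm x - norm y \<le> dist x y" by (simp add: dist_norm norm_triangle_ineq2)
      then show "norm y \<ge> r" using that by (simp add: r_def)
      then show "y \<noteq> 0" using r by auto
    qed
    have "\<exists>g. \<forall>y\<in>ball x r. (\<lambda>n. D n hs y) \<longlonglongrightarrow> g y \<and>
       (g has_derivative (\<lambda>h. \<Sum>b\<in>Basis. (h \<bullet> b) *\<^sub>R G (b # hs) y)) (at y within ball x r)"
    proof (rule has_derivative_sequence[where f' = "\<lambda>n y h. \<Sum>b\<in>Basis. (h \<bullet> b) *\<^sub>R D n (b # hs) y"])
      show "(D n hs has_derivative (\<lambda>h. \<Sum>b\<in>Basis. (h \<bullet> b) *\<^sub>R D n (b # hs) y)) (at y within ball x r)"
        if y: "y \<in> ball x r" for n y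
      proof -
        have d: "(D n hs has_derivative frechet_derivative (D n hs) (at y)) (at y)"
          unfolding D_def by (rule iterated_derivative_has_derivative[OF CinfD[OF s, of ?X]]) (use nb[OF y] in auto)
        have "frechet_derivative (D n hs) (at y) = (\<lambda>h. \<Sum>b\<in>Basis. (h \<bullet> b) *\<^sub>R D n (b # hs) y)"
        proof
          fix h show "frechet_derivative (D n hs) (at y) h = (\<Sum>b\<in>Basis. (h \<bullet> b) *\<^sub>R D n (b # hs) y)"
            using linear_basis_expansion[OF has_derivative_linear[OF d], of h] by (simp add: D_def)
        qed
        then show ?thesis using has_derivative_at_withinI[OF d, of "ball x r"] by (simp only:)
      qed
      show "\<forall>\<^sub>F n in sequentially. \<forall>y\<in>ball x r. \<forall>h. norm ((\<Sum>b\<in>Basis. (h \<bullet> b) *\<^sub>R D n (b # hs) y) -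
           (\<Sum>b\<in>Basis. (h \<bullet> b) *\<^sub>R G (b # hs) y)) \<le> e * norm h" if e: "e > 0" for e
      proof -
        \<comment> \<open>The power of \<open>r\<close> cancels the homogeneity factor on the ball,
          and 4 is the number of basis directions. The list \<open>undefined # hs\<close> stands for
          \<open>b # hs\<close>, of which only the length matters here.\<close>
        let ?e = "e * r ^ length (undefined # hs) / 4"
        have e': "?e > 0" using e r by simp
        have "\<forall>\<^sub>F n in sequentially. \<forall>y. y \<noteq> 0 \<longrightarrow> norm (D n (b # hs) y - G (b # hs) y) \<le> inverse (norm y ^ length (b # hs)) * ?e"
          if "b \<in> Basis" for b
          using unif[of "b # hs", OF _ e'] that hs unfolding eventually_sequentially by auto
        then have "\<forall>\<^sub>F n in sequentially. \<forall>b\<in>Basis. \<forall>y. y \<noteq> 0 \<longrightarrow>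
            norm (D n (b # hs) y - G (b # hs) y) \<le> inverse (norm y ^ length (b # hs)) * ?e"
          by (intro eventually_ball_finite) auto
        then show ?thesis
        proof (eventually_elim, intro ballI allI)
          fix n y and h :: "real^4" assume n: "\<forall>b\<in>Basis. \<forall>y. y \<noteq> 0 \<longrightarrow>
            norm (D n (b # hs) y - G (b # hs) y) \<le> inverse (norm y ^ length (b # hs)) * ?e" and y: "y \<in> ball x r"
          have "norm (D n (b # hs) y - G (b # hs) y) \<le> e / 4" if "b \<in> Basis" for b
          proof -
            have "norm (D n (b # hs) y - G (b # hs) y) \<le> inverse (norm y ^ length (b # hs)) * ?e" using n that nb[OF y] by blast
            also have "\<dots> \<le> inverse (r ^ length (b # hs)) * ?e"
              by (intro mult_right_mono le_imp_inverse_le power_mono nb[OF y]) (use r e' in auto)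
            also have "\<dots> = e / 4" using r by (simp add: field_simps)
            finally show ?thesis .
          qed
          then have "norm ((h \<bullet> b) *\<^sub>R D n (b # hs) y - (h \<bullet> b) *\<^sub>R G (b # hs) y) \<le> norm h * (e / 4)" if "b \<in> Basis" for b
            unfolding scaleR_diff_right[symmetric] norm_scaleR using Basis_le_norm[OF that, of h] that
            by (intro mult_mono) auto
          then have "norm (\<Sum>b\<in>Basis. (h \<bullet> b) *\<^sub>R D n (b # hs) y - (h \<bullet> b) *\<^sub>R G (b # hs) y) \<le>
             of_nat (card (Basis::(real^4) set)) * (norm h * (e / 4))"
            by (intro sum_norm_bound) auto
          then show "norm ((\<Sum>b\<in>Basis. (h \<bullet> b) *\<^sub>R D n (b # hs) y) -
             (\<Sum>b\<in>Basis. (h \<bullet> b) *\<^sub>R G (b # hs) y)) \<le> e * norm h"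
            by (simp add: sum_subtractf mult.commute)
        qed
      qed
      show "(\<lambda>n. D n hs x) \<longlonglongrightarrow> G hs x" by (rule lim[OF hs x])
    qed (use r in auto)
    then obtain g where g: "\<And>y. y\<in>ball x r \<Longrightarrow> (\<lambda>n. D n hs y) \<longlonglongrightarrow> g y"
       "\<And>y. y\<in>ball x r \<Longrightarrow> (g has_derivative (\<lambda>h. \<Sum>b\<in>Basis. (h \<bullet> b) *\<^sub>R G (b # hs) y)) (at y within ball x r)" by blast
    have "g y = G hs y" if "y \<in> ball x r" for y
      using LIMSEQ_unique[OF g(1)[OF that] lim[OF hs nb(2)[OF that]]] .
    moreover have "(g has_derivative (\<lambda>h. \<Sum>b\<in>Basis. (h \<bullet> b) *\<^sub>R G (b # hs) x)) (at x)"
      using g(2)[of x] at_within_open[of x "ball x r"] r by (simp only: centre_in_ball open_ball)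
    ultimately show ?thesis
      using has_derivative_transform_within_open[of g _ x UNIV "ball x r" "G hs"] r by auto
  qed
  have jc: "jointly_continuous ?X (- {0}) (\<lambda>_. G hs)" if "hs \<in> ?L" for hs
    by (intro jointly_continuous_no_param continuous_at_imp_continuous_on ballI has_derivative_continuous[OF dG[OF that]]) auto
  have "C_family n ?X (- {0}) (\<lambda>_. G hs)" if "hs \<in> ?L" for n hs
    using that
  proof (induction n arbitrary: hs)
    case 0
    then show ?case using jc by simp
  next
    case (Suc n)
    show ?case
    proof (rule C_family_SucI[OF jc[OF Suc.prems], of "\<lambda>_ x h. \<Sum>b\<in>Basis. (h \<bullet> b) *\<^sub>R G (b # hs) x"])
      show "C_family n ?X (- {0}) (\<lambda>p x. \<Sum>b\<in>Basis. (h \<bullet> b) *\<^sub>R G (b # hs) x)" for h :: "real^4"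
        by (intro C_family_sum C_family_bilinear[OF bounded_bilinear_scaleR] C_family_const Suc.IH lists.Cons Suc.prems)
    qed (use dG[OF Suc.prems] in auto)
  qed
  then have smG: "smooth_family ?X (- {0}) (\<lambda>_. G [])" by (simp add: smooth_family_def)
  define l where "l x = (if x \<in> S3 then G [] x else 0)" for x
  \<comment> \<open>A limit of functions constant on rays is constant on rays, so
    \<open>G []\<close> is recovered from its restriction \<open>l\<close> to the sphere.\<close>
  have re: "radial_ext l x = G [] x" if "x \<noteq> 0" for x
  proof -
    have "D i [] (x /\<^sub>R norm x) = D i [] x" for i
      using that by (simp add: D_def radial_ext_def)
    then show ?thesis using that by (simp add: radial_ext_def l_def G_def)
  qed
  have lC: "l \<in> Cinf"
    by (rule Cinf_from_no_param, rule smooth_family_cong[OF smG]) (auto simp: re l_def)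
  have itl: "iterated_derivative hs (radial_ext l) x = G hs x" if "hs \<in> ?L" "x \<noteq> 0" for hs x
    using that
  proof (induction hs arbitrary: x)
    case (Cons h hs)
    have "frechet_derivative (iterated_derivative hs (radial_ext l)) (at x) = (\<lambda>h. \<Sum>b\<in>Basis. (h \<bullet> b) *\<^sub>R G (b # hs) x)"
      by (rule frechet_derivative_eqI[of "- {0}", OF _ _ dG]) (use Cons in auto)
    moreover have "(\<Sum>b\<in>Basis. (h \<bullet> b) *\<^sub>R G (b # hs) x) = (\<Sum>b\<in>Basis. if b = h then G (b # hs) x else 0)"
      by (rule sum.cong) (use Cons in \<open>auto simp: inner_Basis\<close>)
    ultimately show ?case using Cons by simp
  qed (simp add: re)
  show ?thesis
  proof (intro bexI[OF _ lC] ballI allI impI)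
    fix hs and e :: real assume hs: "hs \<in> ?L" and e: "e > 0"
    obtain N where N: "\<And>i x. i \<ge> N \<Longrightarrow> x \<noteq> 0 \<Longrightarrow> norm (D i hs x - G hs x) \<le> inverse (norm x ^ length hs) * (e/2)"
      using unif[OF hs, of "e/2"] e by auto
    have "Cinf_seminorm hs (s i - l) < e" if "i \<ge> N" for i
    proof (rule le_less_trans[OF Cinf_seminorm_least[of hs _ "e/2"]])
      fix x assume x: "x \<in> S3"
      show "norm (iterated_derivative hs (radial_ext (s i - l)) x) \<le> e / 2"
        using N[OF that S3_nonzero[OF x]] x
        unfolding iterated_derivative_diff[OF s lC S3_nonzero[OF x]] itl[OF hs S3_nonzero[OF x]] D_def by simp
    qed (use e in simp)
    then show "\<exists>N. \<forall>i\<ge>N. Cinf_seminorm hs (s i - l) < e" by blast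
  qed
qed

text \<open>Countability comes from the finiteness of \<open>Basis\<close>, separation already from
  the sup norm (the empty list), and completeness passes to closed subspaces.\<close>

lemma frechet_space_closed_subspace_Cinf:
  assumes W: "subspace W" "closedin Cinf_topology W"
  shows "frechet_space (subtopology Cinf_topology W)"
proof -
  have WC: "W \<subseteq> Cinf" using closedin_subset[OF W(2)] by simp
  have ts: "topspace (subtopology Cinf_topology W) = W" using WC by (simp add: inf_absorb2)
  let ?L = "lists (Basis :: (real^4) set)"
  have cL: "countable ?L" by (simp add: countable_lists countable_finite)
  have nL: "?L \<noteq> {}" using lists.Nil by blast
  define p where "p k = Cinf_seminorm (from_nat_into ?L k)" for k
  have rp: "range p = Cinf_seminorm ` ?L"
    using range_from_nat_into[OF nL cL] unfolding p_def by (metis image_image)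
  have pk: "\<exists>k. p k = Cinf_seminorm hs" if "hs \<in> ?L" for hs
  proof -
    have "Cinf_seminorm hs \<in> range p" unfolding rp using that by (rule imageI)
    then obtain k where "Cinf_seminorm hs = p k" by blast
    then show ?thesis by (intro exI[of _ k]) simp
  qed
  have eq: "subtopology Cinf_topology W = seminorm_topology W (range p)"
    unfolding rp Cinf_topology_def by (rule subtopology_seminorm_topology[OF subspace_Cinf Cinf_seminorms W(1) WC])
  show ?thesis
    unfolding frechet_space_def ts
  proof (intro conjI exI[of _ p] allI ballI impI)
    show "seminorm_on W (p k)" for k unfolding p_def by (rule seminorm_on_subset[OF seminorm_on_Cinf WC])
    show "x = 0" if x: "x \<in> W" and "\<forall>k. p k x = 0" for x
    proof
      fix z
      obtain k where "p k = Cinf_seminorm []" using pk[of "[]"] by auto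
      then have 0: "Cinf_seminorm [] x = 0" using that(2) by metis
      have xC: "x \<in> Cinf" using x WC by auto
      show "x z = 0 z"
      proof (cases "z \<in> S3")
        case True
        from Cinf_seminorm_upper[OF xC this, of "[]"] 0 radial_ext_sphere[OF True, of x] show ?thesis by simp
      qed (use Cinf_zero[OF xC] in simp)
    qed
    fix s :: "nat \<Rightarrow> real^4 \<Rightarrow> real^4" assume s: "range s \<subseteq> W \<and> (\<forall>k. \<forall>e>0. \<exists>N. \<forall>i\<ge>N. \<forall>j\<ge>N. p k (s i - s j) < e)"
    have "\<exists>N. \<forall>i\<ge>N. \<forall>j\<ge>N. Cinf_seminorm hs (s i - s j) < e" if "hs \<in> ?L" "e > 0" for hs e
      using pk[OF that(1)] s that(2) by metis
    moreover have sC: "s i \<in> Cinf" "s i \<in> W" for i using s WC by auto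
    ultimately obtain l where l: "l \<in> Cinf" "\<And>hs e. hs \<in> ?L \<Longrightarrow> e > 0 \<Longrightarrow> \<exists>N. \<forall>i\<ge>N. Cinf_seminorm hs (s i - l) < e"
      using Cinf_complete[of s] by blast
    have lim: "limitin Cinf_topology s l sequentially"
      unfolding limitin_def
    proof (intro conjI allI impI)
      fix A assume A: "openin Cinf_topology A \<and> l \<in> A"
      then obtain Q e where Q: "finite Q" "Q \<subseteq> Cinf_seminorm ` ?L" "e > 0"
         "{y \<in> Cinf. \<forall>s\<in>Q. s (y - l) < e} \<subseteq> A"
        unfolding Cinf_topology_def openin_seminorm_topology[OF subspace_Cinf Cinf_seminorms] by meson
      have "\<forall>\<^sub>F i in sequentially. q (s i - l) < e" if "q \<in> Q" for q
        using l(2)[OF _ Q(3)] that Q(2) unfolding eventually_sequentially by fastforce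
      then have "\<forall>\<^sub>F i in sequentially. \<forall>q\<in>Q. q (s i - l) < e" using Q(1) by (simp add: eventually_ball_finite)
      then show "\<forall>\<^sub>F i in sequentially. s i \<in> A" by eventually_elim (use Q(4) sC in blast)
    qed (use l in simp)
    have "l \<in> W" by (rule limitin_closedin[OF lim W(2)]) (use sC in auto)
    then show "\<exists>l. limitin (subtopology Cinf_topology W) s l sequentially"
      using lim sC by (auto simp: limitin_subtopology)
  qed (use W eq in auto)
qed

section \<open>Superposition operators\<close>

lemma VF_D: "V \<in> VF \<Longrightarrow> V \<in> Cinf" "V \<in> VF \<Longrightarrow> x \<in> S3 \<Longrightarrow> V x \<bullet> x = 0"
  by (auto simp: VF_def)

lemma topspace_VF_topology [simp]: "topspace VF_topology = VF"
  by (auto simp: VF_topology_def VF_def)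

lemma subspace_VF: "subspace VF"
  unfolding subspace_def
proof (intro conjI ballI allI)
  show "0 \<in> VF" by (simp add: VF_def subspace_0[OF subspace_Cinf])
  fix f and c :: real assume f: "f \<in> VF"
  show "c *\<^sub>R f \<in> VF" using f subspace_scale[OF subspace_Cinf, of f c] by (simp add: VF_def scaleR_fun_def)
  fix g assume g: "g \<in> VF"
  show "f + g \<in> VF"
    unfolding VF_def mem_Collect_eq
  proof (intro conjI ballI)
    show "f + g \<in> Cinf" using f g by (intro subspace_add[OF subspace_Cinf] VF_D)
    show "(f + g) x \<bullet> x = 0" if "x \<in> S3" for x using VF_D(2)[OF f that] VF_D(2)[OF g that] by (simp add: inner_add_left)
  qed
qed

lemma smooth_family_radial_ext_map:
  assumes "continuous_map X Cinf_topology T"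
  shows "smooth_family X (- {0}) (\<lambda>p. radial_ext (T p))"
  by (rule smooth_family_param[OF smooth_family_radial_ext assms])

lemma continuous_map_VF_imp_Cinf: "continuous_map X VF_topology T \<Longrightarrow> continuous_map X Cinf_topology T"
  by (simp add: VF_topology_def continuous_map_in_subtopology)

lemma continuous_map_into_VF:
  assumes "smooth_family X (- {0}) (\<lambda>p. radial_ext (T p))" "\<And>p x. p \<in> topspace X \<Longrightarrow> x \<notin> S3 \<Longrightarrow> T p x = 0"
    "\<And>p x. p \<in> topspace X \<Longrightarrow> x \<in> S3 \<Longrightarrow> T p x \<bullet> x = 0"
  shows "continuous_map X VF_topology T"
proof -
  have "continuous_map X Cinf_topology T" by (rule continuous_map_into_Cinf[OF assms(1,2)])
  moreover from this have "T p \<in> Cinf" if "p \<in> topspace X" for p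
    using that continuous_map_image_subset_topspace by fastforce
  ultimately show ?thesis using assms(3)
    by (auto simp: VF_topology_def continuous_map_in_subtopology VF_def)
qed

lemma continuous_map_eval:
  assumes "continuous_map X Cinf_topology T" "x \<in> S3"
  shows "continuous_map X euclidean (\<lambda>p. T p x)"
proof -
  have "continuous_map X (prod_topology X (top_of_set (- {0}))) (\<lambda>p. (p, x))"
    using assms(2) by (intro continuous_map_pairedI) auto
  from continuous_map_compose[OF this smooth_family_jcont[OF smooth_family_radial_ext_map[OF assms(1)], unfolded jointly_continuous_def]]
  show ?thesis using assms(2) by (simp add: o_def)
qed

lemma closedin_VF: "closedin Cinf_topology VF"
proof -
  have "VF = Cinf \<inter> (\<Inter>x\<in>S3. {V \<in> topspace Cinf_topology. V x \<bullet> x \<in> {0}})"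
    by (auto simp: VF_def)
  moreover have "closedin Cinf_topology (Cinf \<inter> (\<Inter>x\<in>S3. {V \<in> topspace Cinf_topology. V x \<bullet> x \<in> {0}}))"
  proof (intro closedin_Int closedin_INT S3_nonempty)
    show "closedin Cinf_topology Cinf" using closedin_topspace[of Cinf_topology] by simp
    fix x assume x: "x \<in> S3"
    have "continuous_map Cinf_topology euclidean (\<lambda>V. V x)"
      using continuous_map_eval[of Cinf_topology "\<lambda>V. V", OF _ x] by simp
    then have "continuous_map Cinf_topology euclidean ((\<lambda>v. v \<bullet> x) \<circ> (\<lambda>V. V x))"
      by (rule continuous_map_compose) (auto intro!: continuous_intros)
    then have "continuous_map Cinf_topology euclidean (\<lambda>V. V x \<bullet> x)" by (simp add: o_def)
    then show "closedin Cinf_topology {V \<in> topspace Cinf_topology. V x \<bullet> x \<in> {0}}"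
      by (rule closedin_continuous_map_preimage) simp
  qed
  ultimately show ?thesis by simp
qed

lemma frechet_space_VF: "frechet_space VF_topology"
  unfolding VF_topology_def by (rule frechet_space_closed_subspace_Cinf[OF subspace_VF closedin_VF])

lemma continuous_map_VF_combination:
  assumes "continuous_map X VF_topology f" "continuous_map X VF_topology g" "continuous_map X euclideanreal c"
  shows "continuous_map X VF_topology (\<lambda>p. f p + c p *\<^sub>R g p)"
proof (rule continuous_map_into_VF)
  have fg: "f p \<in> VF" "g p \<in> VF" if "p \<in> topspace X" for p
    using continuous_map_image_subset_topspace[OF assms(1)] continuous_map_image_subset_topspace[OF assms(2)] that by auto
  show "smooth_family X (- {0}) (\<lambda>p. radial_ext (f p + c p *\<^sub>R g p))"
    unfolding radial_ext_linear
    by (intro smooth_family_add smooth_family_scaleR smooth_family_param_only assms(3)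
         smooth_family_radial_ext_map continuous_map_VF_imp_Cinf assms)
  fix p x assume p: "p \<in> topspace X"
  show "x \<notin> S3 \<Longrightarrow> (f p + c p *\<^sub>R g p) x = 0"
    using Cinf_zero[OF VF_D(1)[OF fg(1)[OF p]]] Cinf_zero[OF VF_D(1)[OF fg(2)[OF p]]] by (simp add: scaleR_fun_def)
  show "x \<in> S3 \<Longrightarrow> (f p + c p *\<^sub>R g p) x \<bullet> x = 0"
    using VF_D(2)[OF fg(1)[OF p]] VF_D(2)[OF fg(2)[OF p]] by (simp add: scaleR_fun_def inner_add_left)
qed

lemma openin_VF_line:
  assumes U: "openin VF_topology U" and "V \<in> U" "h \<in> VF"
  obtains d where "d > 0" "\<And>t::real. \<bar>t\<bar> < d \<Longrightarrow> V + t *\<^sub>R h \<in> U"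
proof -
  have V: "V \<in> VF" using assms openin_subset by fastforce
  have "continuous_map euclideanreal VF_topology (\<lambda>t. V + t *\<^sub>R h)"
    by (rule continuous_map_VF_combination) (use V assms in auto)
  from openin_continuous_map_preimage[OF this U]
  have "open {t. V + t *\<^sub>R h \<in> U}" by simp
  moreover have "0 \<in> {t. V + t *\<^sub>R h \<in> U}" using assms by simp
  ultimately obtain d where "d > 0" "ball 0 d \<subseteq> {t. V + t *\<^sub>R h \<in> U}" using open_contains_ball by blast
  then show ?thesis by (intro that[of d]) (auto simp: subset_iff)
qed

text \<open>Iterated derivatives of \<Phi> in its second argument, along vector fields read at the
  point k x. A direction depends on the first component of \<open>z\<close> alone, so repeated
  differentiation never differentiates the fields. Radial extensions make sense of it on an open set
  of pairs. The most recent direction stands at the head of the list.\<close>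

primrec fiber_derivative ::
    "(real^4 \<Rightarrow> real^4) \<Rightarrow> ((real^4) \<times> (real^4) \<Rightarrow> real^4) \<Rightarrow> (real^4 \<Rightarrow> real^4) list \<Rightarrow> (real^4) \<times> (real^4) \<Rightarrow> real^4" where
  "fiber_derivative k \<Phi> [] = \<Phi>"
| "fiber_derivative k \<Phi> (h # hs) =
     (\<lambda>z. frechet_derivative (fiber_derivative k \<Phi> hs) (at z) (0, radial_ext h (radial_ext k (fst z))))"

text \<open>The shift \<open>k\<close> is there for chart transitions: charts at f and at g read the
  same diffeomorphism at base points that differ by f composed with the inverse of g.\<close>

definition superposition ::
    "(real^4 \<Rightarrow> real^4) \<Rightarrow> ((real^4) \<times> (real^4) \<Rightarrow> real^4) \<Rightarrow> (real^4 \<Rightarrow> real^4) \<Rightarrow> real^4 \<Rightarrow> real^4" where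
  "superposition k \<Phi> V = (\<lambda>x. if x \<in> S3 then \<Phi> (x, V (k x)) else 0)"

lemma smooth_family_fiber_derivative:
  assumes \<Phi>: "smooth_on W \<Phi>" and W: "open W" "\<And>z. z \<in> W \<Longrightarrow> fst z \<noteq> 0"
    and k: "k \<in> Cinf" "k ` S3 \<subseteq> S3"
    and \<eta>: "\<And>\<eta>. \<eta> \<in> set \<eta>s \<Longrightarrow> continuous_map X Cinf_topology \<eta>"
  shows "smooth_family X W (\<lambda>p. fiber_derivative k \<Phi> (map (\<lambda>\<eta>. \<eta> p) \<eta>s))"
  using \<eta>
proof (induction \<eta>s)
  case Nil show ?case by (simp add: smooth_on_imp_smooth_family[OF \<Phi>])
next
  case (Cons \<eta> \<eta>s)
  have kn: "radial_ext k x \<noteq> 0" if "x \<noteq> 0" for x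
  proof -
    have "radial_ext k x \<in> S3" using k(2) normalize_in_sphere[OF that] unfolding radial_ext_def by blast
    then show ?thesis by (rule S3_nonzero)
  qed
  have "smooth_family X W (\<lambda>p z. radial_ext k (fst z))"
    by (rule smooth_family_compose[OF CinfD[OF k(1)]])
      (use W in \<open>auto intro!: smooth_family_no_param_linear bounded_linear_fst\<close>)
  then have "smooth_family X W (\<lambda>p z. radial_ext (\<eta> p) (radial_ext k (fst z)))"
    by (rule smooth_family_compose[OF smooth_family_radial_ext_map[OF Cons.prems[OF list.set_intros(1)]]])
      (use W kn in auto)
  then show ?case
    unfolding list.map fiber_derivative.simps
    by (intro smooth_family_directional_derivative Cons.IH smooth_family_Pair smooth_family_const W(1))
      (use Cons.prems in auto)
qed

text \<open>\<open>\<Phi>\<close> may depend on the parameter, so that fiber derivatives along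
  varying directions are covered.\<close>

lemma smooth_family_superposition:
  assumes \<Phi>: "smooth_family X W \<Phi>" and k: "k \<in> Cinf" "k ` S3 \<subseteq> S3"
    and V: "continuous_map X Cinf_topology V" "\<And>p x. p \<in> topspace X \<Longrightarrow> x \<in> S3 \<Longrightarrow> (x, V p (k x)) \<in> W"
  shows "smooth_family X (- {0}) (\<lambda>p. radial_ext (superposition k (\<Phi> p) (V p)))"
proof -
  let ?n = "\<lambda>x::real^4. x /\<^sub>R norm x"
  have kS: "radial_ext k x \<in> S3" if "x \<noteq> 0" for x
    using k(2) normalize_in_sphere[OF that] unfolding radial_ext_def by blast
  have "smooth_family X (- {0}) (\<lambda>p x. radial_ext (V p) (radial_ext k x))"
    by (rule smooth_family_compose[OF smooth_family_radial_ext_map[OF V(1)] CinfD[OF k(1)]])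
      (use kS S3_nonzero in auto)
  then have "smooth_family X (- {0}) (\<lambda>p x. (?n x, radial_ext (V p) (radial_ext k x)))"
    by (intro smooth_family_Pair smooth_family_normalize)
  moreover have eq: "radial_ext (V p) (radial_ext k x) = V p (k (?n x))" if "x \<noteq> 0" for p x
    using radial_ext_sphere[OF kS[OF that], of "V p"] by (simp add: radial_ext_def)
  ultimately have "smooth_family X (- {0}) (\<lambda>p x. \<Phi> p (?n x, radial_ext (V p) (radial_ext k x)))"
    using V(2) normalize_in_sphere by (intro smooth_family_compose[OF \<Phi>]) auto
  then show ?thesis
  proof (rule smooth_family_cong)
    fix p x assume "x \<in> - {0::real^4}"
    then have "?n x \<in> S3" "radial_ext (V p) (radial_ext k x) = V p (k (?n x))"
      using normalize_in_sphere eq by auto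
    then show "\<Phi> p (?n x, radial_ext (V p) (radial_ext k x)) = radial_ext (superposition k (\<Phi> p) (V p)) x"
      unfolding radial_ext_def[of "superposition k (\<Phi> p) (V p)"] by (simp add: superposition_def)
  qed auto
qed

text \<open>The derivatives are again superposition operators, built from the fiber derivatives of
  \<open>\<Phi>\<close>. At a point of the sphere this is the chain rule; convergence in the
  function space comes from the integral form of the difference quotient.\<close>

lemma frechet_smooth_superposition:
  assumes \<Phi>: "smooth_on W \<Phi>" and W: "open W" "\<And>z. z \<in> W \<Longrightarrow> fst z \<noteq> 0"
    and k: "k \<in> Cinf" "k ` S3 \<subseteq> S3" and U: "openin VF_topology U"
    and UW: "\<And>V x. V \<in> U \<Longrightarrow> x \<in> S3 \<Longrightarrow> (x, V (k x)) \<in> W"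
    and tan: "\<And>V x. V \<in> U \<Longrightarrow> x \<in> S3 \<Longrightarrow> \<Phi> (x, V (k x)) \<bullet> x = 0"
  shows "frechet_smooth VF_topology VF_topology U (superposition k \<Phi>)"
proof -
  \<comment> \<open>\<open>frechet_smooth\<close> appends a new direction on the right,
    \<open>fiber_derivative\<close> puts it at the head; hence \<open>rev\<close>.\<close>
  let ?G = "\<lambda>hs. fiber_derivative k \<Phi> (rev hs)"
  define D where "D V hs = superposition k (?G hs) V" for V hs
  have UVF: "U \<subseteq> VF" using openin_subset[OF U] by simp
  have smD: "smooth_family X (- {0}) (\<lambda>p. radial_ext (D (V p) (map (\<lambda>\<eta>. \<eta> p) \<eta>s)))"
    if V: "continuous_map X VF_topology V" "V ` topspace X \<subseteq> U"
      and \<eta>: "\<And>\<eta>. \<eta> \<in> set \<eta>s \<Longrightarrow> continuous_map X VF_topology \<eta>" for X :: "'x topology" and V \<eta>s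
    unfolding D_def
  proof (rule smooth_family_superposition[OF _ k])
    show "smooth_family X W (\<lambda>p. ?G (map (\<lambda>\<eta>. \<eta> p) \<eta>s))"
      unfolding rev_map by (rule smooth_family_fiber_derivative[OF \<Phi> W k]) (use \<eta> continuous_map_VF_imp_Cinf in auto)
  qed (use V UW in \<open>auto intro: continuous_map_VF_imp_Cinf\<close>)
  have der: "((\<lambda>t. D (V + t *\<^sub>R h) hs x) has_vector_derivative D V (hs @ [h]) x) (at 0)"
    if V: "V \<in> U" and h: "h \<in> VF" and hs: "hs \<in> lists VF" and x: "x \<in> S3" for V h hs x
  proof -
    let ?z = "(x, V (k x))" and ?X = "discrete_topology {()}"
    have "smooth_family ?X W (\<lambda>p. fiber_derivative k \<Phi> (map (\<lambda>\<eta>. \<eta> p) (map (\<lambda>h _. h) (rev hs))))"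
      by (rule smooth_family_fiber_derivative[OF \<Phi> W k]) (use hs VF_D in auto)
    then have "smooth_family ?X W (\<lambda>p. ?G hs)" by (simp add: o_def)
    from smooth_family_has_derivative[OF this _ UW[OF V x]]
    have dG: "(?G hs has_derivative frechet_derivative (?G hs) (at ?z)) (at ?z)" by simp
    have kx: "k x \<in> S3" using k x by blast
    have "((\<lambda>t. (x, V (k x) + t *\<^sub>R h (k x))) has_vector_derivative (0, h (k x))) (at 0)"
      by (auto intro!: derivative_eq_intros)
    moreover have "(?G hs has_derivative frechet_derivative (?G hs) (at ?z)) (at (x, V (k x) + 0 *\<^sub>R h (k x)))"
      using dG by simp
    ultimately have "((?G hs \<circ> (\<lambda>t. (x, V (k x) + t *\<^sub>R h (k x)))) has_vector_derivative
        frechet_derivative (?G hs) (at ?z) (0, h (k x))) (at 0)"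
      using vector_derivative_diff_chain_within[of "\<lambda>t. (x, V (k x) + t *\<^sub>R h (k x))" "(0, h (k x))" 0 UNIV "?G hs"]
      by (auto intro: has_derivative_at_withinI)
    moreover have "?G (hs @ [h]) ?z = frechet_derivative (?G hs) (at ?z) (0, h (k x))"
      using x kx by simp
    ultimately show ?thesis using x by (simp add: D_def superposition_def o_def scaleR_fun_def)
  qed
  \<comment> \<open>Tangency of the derivatives: along V + t h the inner product with x vanishes for
    all small t, hence so does its derivative.\<close>
  have DVF: "D V hs \<in> VF" if "V \<in> U" "hs \<in> lists VF" for V hs
  proof -
    have "D V hs x \<bullet> x = 0" if x: "x \<in> S3" for x
      using \<open>hs \<in> lists VF\<close> \<open>V \<in> U\<close>
    proof (induction hs arbitrary: V rule: rev_induct)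
      case Nil then show ?case using tan x by (simp add: D_def superposition_def)
    next
      case (snoc h hs)
      then have hs: "hs \<in> lists VF" "h \<in> VF" by auto
      obtain d where d: "d > 0" "\<And>t::real. \<bar>t\<bar> < d \<Longrightarrow> V + t *\<^sub>R h \<in> U"
        using openin_VF_line[OF U snoc.prems(2) hs(2)] by blast
      have "((\<lambda>t. D (V + t *\<^sub>R h) hs x \<bullet> x) has_vector_derivative D V (hs @ [h]) x \<bullet> x) (at 0)"
        by (rule bounded_linear.has_vector_derivative[OF bounded_linear_inner_left der[OF snoc.prems(2) hs(2,1) x]])
      moreover have "((\<lambda>t. D (V + t *\<^sub>R h) hs x \<bullet> x) has_vector_derivative 0) (at 0)"
        by (rule has_vector_derivative_transform_within_open[of "\<lambda>_. 0" _ _ "ball 0 d"])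
          (use d snoc.IH[OF hs(1)] in auto)
      ultimately show ?case by (rule vector_derivative_unique_at)
    qed
    moreover have "D V hs \<in> Cinf"
    proof -
      have "smooth_family (discrete_topology {()}) (- {0}) (\<lambda>p. radial_ext (D V (map (\<lambda>\<eta>. \<eta> p) (map (\<lambda>h _. h) hs))))"
        by (rule smD) (use that UVF in auto)
      then show ?thesis by (intro Cinf_from_no_param) (simp_all add: o_def D_def superposition_def)
    qed
    ultimately show ?thesis by (simp add: VF_def)
  qed
  have contD: "continuous_map X VF_topology (\<lambda>p. D (V p) (map (\<lambda>\<eta>. \<eta> p) \<eta>s))"
    if V: "continuous_map X VF_topology V" "V ` topspace X \<subseteq> U"
      and \<eta>: "\<And>\<eta>. \<eta> \<in> set \<eta>s \<Longrightarrow> continuous_map X VF_topology \<eta>" for X :: "'x topology" and V \<eta>s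
  proof (rule continuous_map_into_VF[OF smD[OF that]])
    fix p x assume p: "p \<in> topspace X"
    show "x \<notin> S3 \<Longrightarrow> D (V p) (map (\<lambda>\<eta>. \<eta> p) \<eta>s) x = 0" by (simp add: D_def superposition_def)
    have "map (\<lambda>\<eta>. \<eta> p) \<eta>s \<in> lists VF"
      using \<eta> p continuous_map_image_subset_topspace by fastforce
    then have "D (V p) (map (\<lambda>\<eta>. \<eta> p) \<eta>s) \<in> VF" using DVF V(2) p by blast
    then show "x \<in> S3 \<Longrightarrow> D (V p) (map (\<lambda>\<eta>. \<eta> p) \<eta>s) x \<bullet> x = 0" by (simp add: VF_def)
  qed
  show ?thesis
    unfolding frechet_smooth_def topspace_VF_topology
  proof (intro conjI exI[of _ D] ballI allI U)
    show "D V [] = superposition k \<Phi> V" for V by (simp add: D_def)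
    fix V hs h assume V: "V \<in> U" and hs: "hs \<in> lists VF" and h: "h \<in> VF"
    have VV: "V \<in> VF" using V UVF by auto
    have hsh: "hs @ [h] \<in> lists VF" using hs h by auto
    obtain d where d: "d > 0" "\<And>t::real. \<bar>t\<bar> < d \<Longrightarrow> V + t *\<^sub>R h \<in> U"
      using openin_VF_line[OF U V h] by blast
    let ?I = "top_of_set {0..1::real}" and ?T = "top_of_set {-d<..<d}"
    \<comment> \<open>The mean of the derivative along the segment from V to V + t h. For small t
      \<noteq> 0 it is the difference quotient and at t = 0 the derivative; being continuous in t,
      it yields the limit.\<close>
    define Q where "Q t = (\<lambda>x. integral {0..1} (\<lambda>s. D (V + (s * t) *\<^sub>R h) (hs @ [h]) x))" for t :: real
    have st: "\<bar>s * t\<bar> < d" if "s \<in> {0..1}" "t \<in> {-d<..<d}" for s t :: real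
    proof -
      have "\<bar>s * t\<bar> \<le> 1 * \<bar>t\<bar>" unfolding abs_mult using that by (intro mult_right_mono) auto
      then show ?thesis using that by auto
    qed
    have line: "continuous_map (prod_topology ?T ?I) VF_topology (\<lambda>p. V + (snd p * fst p) *\<^sub>R h)"
    proof (rule continuous_map_VF_combination)
      have "continuous_map (prod_topology ?T ?I) euclideanreal fst" "continuous_map (prod_topology ?T ?I) euclideanreal snd"
        using continuous_map_fst[of ?T ?I] continuous_map_snd[of ?T ?I] by (auto simp: continuous_map_in_subtopology)
      then show "continuous_map (prod_topology ?T ?I) euclideanreal (\<lambda>p. snd p * fst p)"
        by (intro continuous_map_real_mult)
    qed (use VV h in auto)
    have "smooth_family (prod_topology ?T ?I) (- {0}) (\<lambda>p. radial_ext (D (V + (snd p * fst p) *\<^sub>R h) (map (\<lambda>\<eta>. \<eta> p) (map (\<lambda>h _. h) (hs @ [h])))))"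
      by (rule smD[OF line]) (use d st hs h in auto)
    then have "smooth_family (prod_topology ?T ?I) (- {0}) (\<lambda>p. radial_ext (D (V + (snd p * fst p) *\<^sub>R h) (hs @ [h])))"
      by (simp add: o_def)
    from smooth_family_integral[OF this]
    have "smooth_family ?T (- {0}) (\<lambda>t. radial_ext (Q t))"
      by (simp add: Q_def radial_ext_def open_Compl)
    then have contQ: "continuous_map ?T Cinf_topology Q"
      by (rule continuous_map_into_Cinf) (simp add: Q_def D_def superposition_def)
    have Q0: "Q 0 = D V (hs @ [h])" by (simp add: Q_def)
    have Qt: "Q t = (1 / t) *\<^sub>R (D (V + t *\<^sub>R h) hs - D V hs)" if t: "t \<noteq> 0" "\<bar>t\<bar> < d" for t
    proof
      fix x
      show "Q t x = ((1 / t) *\<^sub>R (D (V + t *\<^sub>R h) hs - D V hs)) x"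
      proof (cases "x \<in> S3")
        case True
        have "((\<lambda>s. t *\<^sub>R D (V + (s * t) *\<^sub>R h) (hs @ [h]) x) has_integral
           (D (V + (1 * t) *\<^sub>R h) hs x - D (V + (0 * t) *\<^sub>R h) hs x)) {0..1}"
        proof (rule fundamental_theorem_of_calculus)
          fix s :: real assume s: "s \<in> {0..1}"
          have "t \<in> {-d<..<d}" using t(2) by auto
          then have "V + (s * t) *\<^sub>R h \<in> U" using d(2) st[OF s] by blast
          \<comment> \<open>The point 0 is written as (s - s) * t to fit the chain rule with inner
            map r \<mapsto> (r - s) * t.\<close>
          from der[OF this h hs True]
          have "((\<lambda>r. D (V + (s * t) *\<^sub>R h + r *\<^sub>R h) hs x) has_vector_derivative D (V + (s * t) *\<^sub>R h) (hs @ [h]) x) (at ((s - s) * t))"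
            by simp
          moreover have "((\<lambda>r. (r - s) * t) has_vector_derivative t) (at s)"
            by (auto intro!: derivative_eq_intros simp: has_real_derivative_iff_has_vector_derivative[symmetric])
          ultimately have "(((\<lambda>r. D (V + (s * t) *\<^sub>R h + r *\<^sub>R h) hs x) \<circ> (\<lambda>r. (r - s) * t)) has_vector_derivative
              t *\<^sub>R D (V + (s * t) *\<^sub>R h) (hs @ [h]) x) (at s)"
            by (intro vector_diff_chain_at)
          moreover have "V + (s * t) *\<^sub>R h + ((r - s) * t) *\<^sub>R h = V + (r * t) *\<^sub>R h" for r
            by (simp add: algebra_simps flip: scaleR_add_left)
          ultimately have "((\<lambda>r. D (V + (r * t) *\<^sub>R h) hs x) has_vector_derivative
              t *\<^sub>R D (V + (s * t) *\<^sub>R h) (hs @ [h]) x) (at s)"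
            by (simp only: o_def)
          then show "((\<lambda>r. D (V + (r * t) *\<^sub>R h) hs x) has_vector_derivative
              t *\<^sub>R D (V + (s * t) *\<^sub>R h) (hs @ [h]) x) (at s within {0..1})"
            by (rule has_vector_derivative_at_within)
        qed simp
        from integral_unique[OF this]
        have "t *\<^sub>R Q t x = D (V + t *\<^sub>R h) hs x - D V hs x" by (simp add: Q_def)
        then have "(1 / t) *\<^sub>R t *\<^sub>R Q t x = (1 / t) *\<^sub>R (D (V + t *\<^sub>R h) hs x - D V hs x)" by simp
        then show ?thesis using t by (simp add: scaleR_fun_def)
      qed (simp add: Q_def D_def superposition_def scaleR_fun_def)
    qed
    show "limitin VF_topology (\<lambda>t. (1 / t) *\<^sub>R (D (V + t *\<^sub>R h) hs - D V hs)) (D V (hs @ [h])) (at 0)"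
      unfolding VF_topology_def limitin_subtopology
    proof (intro conjI)
      show "D V (hs @ [h]) \<in> VF" by (rule DVF[OF V hsh])
      have ev: "\<forall>\<^sub>F t in at (0::real). \<bar>t\<bar> < d \<and> t \<noteq> 0"
        using d(1) by (auto simp: eventually_at dist_real_def intro!: exI[of _ d])
      then show "\<forall>\<^sub>F t in at 0. (1 / t) *\<^sub>R (D (V + t *\<^sub>R h) hs - D V hs) \<in> VF"
        by eventually_elim (use DVF V hs d in \<open>auto intro!: subspace_scale[OF subspace_VF] subspace_diff[OF subspace_VF]\<close>)
      show "limitin Cinf_topology (\<lambda>t. (1 / t) *\<^sub>R (D (V + t *\<^sub>R h) hs - D V hs)) (D V (hs @ [h])) (at 0)"
        unfolding limitin_def
      proof (intro conjI allI impI)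
        show "D V (hs @ [h]) \<in> topspace Cinf_topology" using DVF[OF V hsh] VF_D by auto
        fix A assume A: "openin Cinf_topology A \<and> D V (hs @ [h]) \<in> A"
        then have "openin ?T {t \<in> topspace ?T. Q t \<in> A}" using openin_continuous_map_preimage[OF contQ] by blast
        then have "open {t \<in> {-d<..<d}. Q t \<in> A}" by (simp add: openin_open_eq)
        moreover have "0 \<in> {t \<in> {-d<..<d}. Q t \<in> A}" using d(1) A Q0 by simp
        ultimately have "\<forall>\<^sub>F t in at 0. t \<in> {t \<in> {-d<..<d}. Q t \<in> A}" by (rule eventually_at_in_open')
        with ev show "\<forall>\<^sub>F t in at 0. (1 / t) *\<^sub>R (D (V + t *\<^sub>R h) hs - D V hs) \<in> A"
          by eventually_elim (use Qt in auto)
      qed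
    qed
  next
    fix n :: nat
    let ?X = "prod_topology (subtopology VF_topology U) (product_topology (\<lambda>_. VF_topology) {..<n})"
    \<comment> \<open>The product itself is the parameter space; its coordinate projections supply
      the base field and the directions.\<close>
    have "continuous_map ?X VF_topology (\<lambda>p. D (fst p) (map (\<lambda>\<eta>. \<eta> p) (map (\<lambda>i p. snd p i) [0..<n])))"
    proof (rule contD)
      show "continuous_map ?X VF_topology fst"
        using continuous_map_fst[of "subtopology VF_topology U" "product_topology (\<lambda>_. VF_topology) {..<n}"]
        by (simp add: continuous_map_in_subtopology)
      fix \<eta> :: "(real^4 \<Rightarrow> real^4) \<times> (nat \<Rightarrow> real^4 \<Rightarrow> real^4) \<Rightarrow> real^4 \<Rightarrow> real^4"
      assume "\<eta> \<in> set (map (\<lambda>i p. snd p i) [0..<n])"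
      then obtain i where i: "i < n" "\<eta> = (\<lambda>p. snd p i)" by auto
      show "continuous_map ?X VF_topology \<eta>" unfolding i(2)
        using continuous_map_compose[OF continuous_map_snd continuous_map_product_projection[of i "{..<n}" "\<lambda>_. VF_topology"]] i(1)
        by (simp add: o_def)
    qed auto
    then show "continuous_map ?X VF_topology (\<lambda>(V, h). D V (map h [0..<n]))"
      by (simp add: o_def case_prod_unfold)
  qed
qed

section \<open>The diffeomorphism group\<close>

lemma Diff_D:
  assumes "f \<in> Diff"
  shows "f \<in> Cinf" "bij_betw f S3 S3" "f ` S3 \<subseteq> S3" "x \<in> S3 \<Longrightarrow> f x \<in> S3" "smooth_on_S3 (inv_into S3 f)"
  using assms by (auto simp: Diff_def bij_betw_def)

text \<open>\<open>inv_into S3 f\<close> has unspecified values off the sphere; the value 0 there is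
  what \<open>Cinf\<close> demands.\<close>

definition inv_S3 :: "(real^4 \<Rightarrow> real^4) \<Rightarrow> real^4 \<Rightarrow> real^4" where
  "inv_S3 f = (\<lambda>x. if x \<in> S3 then inv_into S3 f x else 0)"

lemma smooth_on_S3_cong: "(\<And>x. x \<in> S3 \<Longrightarrow> f x = g x) \<Longrightarrow> smooth_on_S3 f = smooth_on_S3 g"
  unfolding smooth_on_S3_def by auto

lemma inv_S3_Cinf: "f \<in> Diff \<Longrightarrow> inv_S3 f \<in> Cinf"
  using Diff_D(5)[of f] smooth_on_S3_cong[of "inv_S3 f" "inv_into S3 f"]
  by (auto simp: Cinf_def inv_S3_def)

lemma inv_S3:
  assumes "f \<in> Diff" "x \<in> S3"
  shows "inv_S3 f x \<in> S3" "f (inv_S3 f x) = x" "inv_S3 f (f x) = x"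
  using assms Diff_D(2,4)[OF assms(1)]
  by (auto simp: inv_S3_def bij_betw_inv_into_left bij_betw_inv_into_right)
    (metis bij_betw_def inv_into_into mem_sphere_0)

lemma DiffI:
  assumes "f \<in> Cinf" "g \<in> Cinf" "\<And>x. x \<in> S3 \<Longrightarrow> f x \<in> S3" "\<And>x. x \<in> S3 \<Longrightarrow> g x \<in> S3"
    "\<And>x. x \<in> S3 \<Longrightarrow> g (f x) = x" "\<And>x. x \<in> S3 \<Longrightarrow> f (g x) = x"
  shows "f \<in> Diff"
proof -
  have bij: "bij_betw f S3 S3"
    by (rule bij_betw_byWitness[of _ g]) (use assms(3-) in blast)+
  have "inv_into S3 f x = g x" if "x \<in> S3" for x
    by (rule inv_into_f_eq) (use bij assms(3-) that in \<open>auto simp: bij_betw_def\<close>)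
  then have "smooth_on_S3 (inv_into S3 f)"
    using smooth_on_S3_cong[of "inv_into S3 f" g] assms(2) by (auto simp: Cinf_def)
  then show ?thesis using assms bij by (simp add: Diff_def)
qed

lemma inv_S3_Diff: "f \<in> Diff \<Longrightarrow> inv_S3 f \<in> Diff"
  by (rule DiffI[of _ f]) (auto simp: inv_S3 inv_S3_Cinf Diff_D(1) Diff_D(4)[simplified] inv_S3[simplified])

section \<open>Composition of sphere maps and the group structure\<close>

lemma smooth_family_compose_S3:
  assumes g: "continuous_map X Cinf_topology g" and f: "continuous_map X Cinf_topology f"
    and fS: "\<And>p x. p \<in> topspace X \<Longrightarrow> x \<in> S3 \<Longrightarrow> f p x \<in> S3"
  shows "smooth_family X (- {0}) (\<lambda>p. radial_ext (compose_S3 (g p) (f p)))"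
proof -
  have re: "radial_ext (f p) x \<in> S3" if "p \<in> topspace X" "x \<noteq> 0" for p x
    using fS[OF that(1) normalize_in_sphere[OF that(2)]] by (simp add: radial_ext_def)
  have "smooth_family X (- {0}) (\<lambda>p x. radial_ext (g p) (radial_ext (f p) x))"
    by (rule smooth_family_compose[OF smooth_family_radial_ext_map[OF g] smooth_family_radial_ext_map[OF f]])
      (use re S3_nonzero in auto)
  then show ?thesis
  proof (rule smooth_family_cong)
    fix p x assume p: "p \<in> topspace X" and x: "x \<in> - {0::real^4}"
    then have "x /\<^sub>R norm x \<in> S3" "radial_ext (g p) (radial_ext (f p) x) = g p (radial_ext (f p) x)"
      using normalize_in_sphere radial_ext_sphere[OF re[OF p]] by auto
    then show "radial_ext (g p) (radial_ext (f p) x) = radial_ext (compose_S3 (g p) (f p)) x"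
      unfolding radial_ext_def[of "compose_S3 (g p) (f p)"]
      by (simp add: compose_S3_def radial_ext_def[of "f p"])
  qed auto
qed

lemma continuous_map_compose_S3:
  assumes "continuous_map X Cinf_topology g" "continuous_map X Cinf_topology f"
    "\<And>p x. p \<in> topspace X \<Longrightarrow> x \<in> S3 \<Longrightarrow> f p x \<in> S3"
  shows "continuous_map X Cinf_topology (\<lambda>p. compose_S3 (g p) (f p))"
  by (rule continuous_map_into_Cinf[OF smooth_family_compose_S3[OF assms]]) (auto simp: compose_S3_def)

lemma compose_S3_Cinf:
  assumes "g \<in> Cinf" "f \<in> Cinf" "\<And>x. x \<in> S3 \<Longrightarrow> f x \<in> S3"
  shows "compose_S3 g f \<in> Cinf"
proof -
  have "continuous_map (discrete_topology {()}) Cinf_topology (\<lambda>_. compose_S3 g f)"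
    by (rule continuous_map_compose_S3) (use assms in auto)
  from continuous_map_image_subset_topspace[OF this] show ?thesis by simp
qed

lemma compose_S3_Diff:
  assumes "g \<in> Diff" "f \<in> Diff"
  shows "compose_S3 g f \<in> Diff"
proof (rule DiffI[of _ "compose_S3 (inv_S3 f) (inv_S3 g)"])
  show "compose_S3 g f \<in> Cinf"
    by (rule compose_S3_Cinf[OF Diff_D(1)[OF assms(1)] Diff_D(1)[OF assms(2)] Diff_D(4)[OF assms(2)]])
  show "compose_S3 (inv_S3 f) (inv_S3 g) \<in> Cinf"
    by (rule compose_S3_Cinf[OF inv_S3_Cinf[OF assms(2)] inv_S3_Cinf[OF assms(1)] inv_S3(1)[OF assms(1)]])
qed (use assms in \<open>simp_all add: compose_S3_def Diff_D(4)[simplified] inv_S3[simplified]\<close>)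

lemma compose_S3_inv_cancel:
  assumes "f \<in> Diff" "g \<in> Cinf"
  shows "compose_S3 (compose_S3 g (inv_S3 f)) f = g" "compose_S3 (compose_S3 g f) (inv_S3 f) = g"
  using assms by (auto simp: compose_S3_def fun_eq_iff inv_S3[simplified] Diff_D(4)[simplified] Cinf_zero[OF assms(2)])

text \<open>An open condition imposed at every point of a compact set is open. Chart domains have
  this form, and so does the pointwise part of chart ranges.\<close>

lemma openin_pointwise_condition:
  assumes W: "open W" and T: "continuous_map X Cinf_topology T" and k: "k \<in> Cinf" "\<And>x. x \<in> S3 \<Longrightarrow> k x \<in> S3"
  shows "openin X {p \<in> topspace X. \<forall>x\<in>S3. (k x, T p x) \<in> W}"
proof -
  have "smooth_family X (- {0}) (\<lambda>p x. (radial_ext k x, radial_ext (T p) x))"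
    by (intro smooth_family_Pair CinfD k smooth_family_radial_ext_map T)
  from jointly_continuous_open_compact[OF smooth_family_jcont[OF this] compact_S3 _ W]
  have "openin X {p \<in> topspace X. \<forall>x\<in>S3. (radial_ext k x, radial_ext (T p) x) \<in> W}" by auto
  moreover have "(\<forall>x\<in>S3. (radial_ext k x, radial_ext (T p) x) \<in> W) = (\<forall>x\<in>S3. (k x, T p x) \<in> W)" for p
    by (intro ball_cong refl) simp
  ultimately show ?thesis by simp
qed

text \<open>
  Openness of \<^const>\<open>Diff\<close>: extend self-maps of the sphere homogeneously of degree one.  A map
  that is \<open>C\<^sup>1\<close>-close to a diffeomorphism \<open>h\<close> then becomes, after composition with the extension of
  \<open>h\<^sup>-\<^sup>1\<close>, a small Lipschitz perturbation of the identity of \<open>\<real>\<^sup>4\<close>, hence a bijection.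
\<close>

definition homogeneous_ext :: "(real^4 \<Rightarrow> real^4) \<Rightarrow> real^4 \<Rightarrow> real^4" where
  "homogeneous_ext f x = norm x *\<^sub>R radial_ext f x"

lemma homogeneous_ext_zero [simp]: "homogeneous_ext f 0 = 0"
  by (simp add: homogeneous_ext_def)

lemma homogeneous_ext_sphere: "x \<in> S3 \<Longrightarrow> homogeneous_ext f x = f x"
  by (simp add: homogeneous_ext_def)

lemma homogeneous_ext_diff: "homogeneous_ext (f - g) x = homogeneous_ext f x - homogeneous_ext g x"
  unfolding homogeneous_ext_def radial_ext_linear by (simp add: algebra_simps)

lemma norm_homogeneous_ext:
  assumes "\<And>x. x \<in> S3 \<Longrightarrow> f x \<in> S3"
  shows "norm (homogeneous_ext f x) = norm x"
proof (cases "x = 0")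
  case False
  then have "norm (radial_ext f x) = 1"
    using assms[OF normalize_in_sphere[OF False]] by (simp add: radial_ext_def)
  then show ?thesis by (simp add: homogeneous_ext_def)
qed simp

lemma homogeneous_ext_compose:
  assumes "\<And>x. x \<in> S3 \<Longrightarrow> f x \<in> S3" "\<And>x. x \<in> S3 \<Longrightarrow> g (f x) = x"
  shows "homogeneous_ext g (homogeneous_ext f x) = x"
proof (cases "x = 0")
  case False
  define s where "s = x /\<^sub>R norm x"
  have s: "s \<in> S3" "x = norm x *\<^sub>R s" using False by (simp_all add: s_def)
  have fx: "homogeneous_ext f x = norm x *\<^sub>R f s" by (simp add: homogeneous_ext_def radial_ext_def s_def)
  have n: "norm (homogeneous_ext f x) = norm x" by (rule norm_homogeneous_ext[OF assms(1)])
  have "homogeneous_ext f x /\<^sub>R norm (homogeneous_ext f x) = f s"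
    unfolding n fx using False assms(1)[OF s(1)] by simp
  then have "homogeneous_ext g (homogeneous_ext f x) = norm x *\<^sub>R g (f s)"
    unfolding homogeneous_ext_def[of g] radial_ext_def n by (simp only:)
  then show ?thesis using assms(2)[OF s(1)] s(2) by simp
qed simp

lemma smooth_family_homogeneous_ext:
  assumes "f \<in> Cinf"
  shows "smooth_family X (- {0}) (\<lambda>_. homogeneous_ext f)"
proof -
  have "smooth_family X (- {0}) (\<lambda>_ x. sqrt (x \<bullet> x) *\<^sub>R radial_ext f x)"
    by (intro smooth_family_scaleR smooth_family_sqrt smooth_family_inner smooth_family_ident CinfD assms) auto
  then show ?thesis by (simp add: homogeneous_ext_def[abs_def] norm_eq_sqrt_inner)
qed

text \<open>An extension of degree one has bounded derivative off the origin: the four basis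
  directions of the radial factor contribute 4 B, the derivative of the norm contributes B.\<close>

lemma homogeneous_ext_Lipschitz:
  assumes w: "w \<in> Cinf" and B0: "\<And>x. x \<in> S3 \<Longrightarrow> norm (w x) \<le> B"
    and B1: "\<And>x b. x \<in> S3 \<Longrightarrow> b \<in> Basis \<Longrightarrow> norm (iterated_derivative [b] (radial_ext w) x) \<le> B"
  shows "norm (homogeneous_ext w x - homogeneous_ext w y) \<le> 5 * B * norm (x - y)"
proof -
  let ?X = "discrete_topology {()}" and ?u = "radial_ext w"
  have B: "B \<ge> 0" using B0 S3_nonempty norm_ge_zero order_trans by blast
  have ub: "norm (?u x) \<le> B" if "x \<noteq> 0" for x
    using B0[OF normalize_in_sphere[OF that]] by (simp add: radial_ext_def)
  have D: "(?u has_derivative frechet_derivative ?u (at x)) (at x)" if "x \<noteq> 0" for x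
    using smooth_family_has_derivative[OF CinfD[OF w, of ?X]] that by auto
  have Db: "norm (frechet_derivative ?u (at x) h) \<le> inverse (norm x) * (4 * B * norm h)" if x: "x \<noteq> 0" for x h
  proof -
    define s where "s = x /\<^sub>R norm x"
    have s: "s \<in> S3" "x = norm x *\<^sub>R s" using x by (simp_all add: s_def)
    have "norm (frechet_derivative ?u (at x) b) \<le> inverse (norm x) * B" if b: "b \<in> Basis" for b
    proof -
      have "iterated_derivative [b] ?u (norm x *\<^sub>R s) = inverse (norm x ^ length [b]) *\<^sub>R iterated_derivative [b] ?u s"
        by (rule iterated_derivative_homogeneous[OF w S3_nonzero[OF s(1)]]) (use x in auto)
      then have "iterated_derivative [b] ?u x = inverse (norm x) *\<^sub>R iterated_derivative [b] ?u s"
        using s(2) by simp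
      then show ?thesis using B1[OF s(1) b] by (simp add: mult_left_mono)
    qed
    then have "norm ((h \<bullet> b) *\<^sub>R frechet_derivative ?u (at x) b) \<le> norm h * (inverse (norm x) * B)" if b: "b \<in> Basis" for b
      unfolding norm_scaleR using Basis_le_norm[OF b, of h] b by (intro mult_mono) auto
    then have "norm (\<Sum>b\<in>Basis. (h \<bullet> b) *\<^sub>R frechet_derivative ?u (at x) b) \<le>
       of_nat (card (Basis::(real^4) set)) * (norm h * (inverse (norm x) * B))"
      by (intro sum_norm_bound) auto
    then show ?thesis
      using linear_basis_expansion[OF has_derivative_linear[OF D[OF x]], of h] by (simp add: mult_ac)
  qed
  have DF: "(homogeneous_ext w has_derivative (\<lambda>h. norm x *\<^sub>R frechet_derivative ?u (at x) h + (x \<bullet> h / norm x) *\<^sub>R ?u x)) (at x)"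
    if x: "x \<noteq> 0" for x
  proof -
    have "(norm has_derivative (\<lambda>h. x \<bullet> h / norm x)) (at x)"
      using has_derivative_norm[OF x] by (simp add: sgn_div_norm inner_commute divide_inverse mult.commute)
    from has_derivative_scaleR[OF this D[OF x]]
    show ?thesis by (simp add: homogeneous_ext_def[abs_def])
  qed
  have DFb: "norm (norm z *\<^sub>R frechet_derivative ?u (at z) h + (z \<bullet> h / norm z) *\<^sub>R ?u z) \<le> 5 * B * norm h" if z: "z \<noteq> 0" for z h
  proof -
    have "norm (norm z *\<^sub>R frechet_derivative ?u (at z) h) \<le> norm z * (inverse (norm z) * (4 * B * norm h))"
      unfolding norm_scaleR abs_norm_cancel by (intro mult_left_mono Db z) auto
    also have "\<dots> = 4 * B * norm h" using z by simp
    finally have 1: "norm (norm z *\<^sub>R frechet_derivative ?u (at z) h) \<le> 4 * B * norm h" .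
    have "\<bar>z \<bullet> h / norm z\<bar> \<le> norm h"
      using Cauchy_Schwarz_ineq2[of z h] z by (simp add: field_simps)
    then have 2: "norm ((z \<bullet> h / norm z) *\<^sub>R ?u z) \<le> norm h * B"
      unfolding norm_scaleR using ub[OF z] by (intro mult_mono) auto
    show ?thesis using norm_triangle_mono[OF 1 2] by (simp add: algebra_simps)
  qed
  show ?thesis
  \<comment> \<open>The extension need not be differentiable at 0. If the segment passes through 0,
    then |x| + |y| = |x - y| and linear growth suffices.\<close>
  proof (cases "0 \<in> closed_segment x y")
    case False
    show ?thesis
    proof (rule differentiable_bound[of "closed_segment x y" "homogeneous_ext w"
          "\<lambda>z h. norm z *\<^sub>R frechet_derivative ?u (at z) h + (z \<bullet> h / norm z) *\<^sub>R ?u z"])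
      fix z assume "z \<in> closed_segment x y"
      then have z: "z \<noteq> 0" using False by auto
      show "(homogeneous_ext w has_derivative (\<lambda>h. norm z *\<^sub>R frechet_derivative ?u (at z) h + (z \<bullet> h / norm z) *\<^sub>R ?u z)) (at z within closed_segment x y)"
        by (rule has_derivative_at_withinI[OF DF[OF z]])
      show "onorm (\<lambda>h. norm z *\<^sub>R frechet_derivative ?u (at z) h + (z \<bullet> h / norm z) *\<^sub>R ?u z) \<le> 5 * B"
        by (rule onorm_le) (rule DFb[OF z])
    qed auto
  next
    case True
    have n: "norm (homogeneous_ext w z) \<le> B * norm z" for z
    proof (cases "z = 0")
      case False
      then show ?thesis using ub[OF False] by (simp add: homogeneous_ext_def mult.commute mult_left_mono)
    qed simp
    have "norm (homogeneous_ext w x - homogeneous_ext w y) \<le> B * norm x + B * norm y"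
      by (rule order_trans[OF norm_triangle_ineq4 add_mono[OF n n]])
    also have "\<dots> = B * norm (x - y)"
      using True between_mem_segment[of x y 0] by (simp add: between dist_norm algebra_simps)
    also have "\<dots> \<le> 5 * B * norm (x - y)" using B by (intro mult_right_mono) auto
    finally show ?thesis .
  qed
qed

lemma Cinf_Lipschitz_bound:
  assumes "w \<in> Cinf"
  obtains B where "B > 0" "\<And>x y. norm (homogeneous_ext w x - homogeneous_ext w y) \<le> B * norm (x - y)"
proof -
  define M where "M = Max (insert (Cinf_seminorm [] w) ((\<lambda>b. Cinf_seminorm [b] w) ` Basis))"
  have M: "Cinf_seminorm [] w \<le> M" "b \<in> Basis \<Longrightarrow> Cinf_seminorm [b] w \<le> M" for b
    unfolding M_def by (rule Max_ge, simp, simp)+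
  have "norm (homogeneous_ext w x - homogeneous_ext w y) \<le> 5 * M * norm (x - y)" for x y
  proof (rule homogeneous_ext_Lipschitz[OF assms])
    fix x assume x: "x \<in> S3"
    show "norm (w x) \<le> M" using order_trans[OF Cinf_seminorm_upper[OF assms x, of "[]"] M(1)] radial_ext_sphere[OF x, of w] by simp
    show "norm (iterated_derivative [b] (radial_ext w) x) \<le> M" if "b \<in> Basis" for b
      by (rule order_trans[OF Cinf_seminorm_upper[OF assms x] M(2)[OF that]])
  qed
  moreover have "5 * M * norm (x - y) \<le> (\<bar>5 * M\<bar> + 1) * norm (x - y)" for x y :: "real^4"
    by (intro mult_right_mono) auto
  ultimately have "norm (homogeneous_ext w x - homogeneous_ext w y) \<le> (\<bar>5 * M\<bar> + 1) * norm (x - y)" for x y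
    by (rule order_trans)
  then show ?thesis by (intro that[of "\<bar>5 * M\<bar> + 1"]) auto
qed

text \<open>The solutions are the fixed points of the contraction x \<mapsto> y - r x.\<close>

lemma perturbation_of_identity_surj:
  fixes r :: "'a::euclidean_space \<Rightarrow> 'a"
  assumes r: "\<And>x y. norm (r x - r y) \<le> (1/2) * norm (x - y)"
  shows "\<exists>x. x + r x = y"
proof -
  have "\<exists>!x. y - r x = x"
  proof (rule banach_fix_type[of "1/2"])
    show "\<forall>x z. dist (y - r x) (y - r z) \<le> 1/2 * dist x z"
      using r by (auto simp: dist_norm) (metis norm_minus_commute)
  qed auto
  then obtain x where "y - r x = x" by blast
  then have "x + r x = y" by (simp add: algebra_simps)
  then show ?thesis ..
qed

text \<open>The derivative of \<open>G\<close> at y is the inverse of that of \<open>F\<close> at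
  \<open>G y\<close>. By Cramer's rule its entries are quotients of polynomials in the partial
  derivatives of \<open>F\<close>, so class n of \<open>G\<close> gives class n + 1. The lower bound
  \<open>c\<close> makes the derivative injective, hence its determinant nonzero.\<close>

lemma smooth_family_inverse_map:
  fixes F G :: "real^4 \<Rightarrow> real^4"
  assumes F: "smooth_family X U (\<lambda>_. F)" "topspace X \<noteq> {}" and U: "open U" "open V"
    and FG: "\<And>y. y \<in> V \<Longrightarrow> G y \<in> U" "\<And>y. y \<in> V \<Longrightarrow> F (G y) = y" and contG: "continuous_on V G"
    and c: "c > 0" "\<And>x h. x \<in> U \<Longrightarrow> norm (frechet_derivative F (at x) h) \<ge> c * norm h"
  shows "smooth_family X V (\<lambda>_. G)"
proof -
  obtain p0 where p0: "p0 \<in> topspace X" using F(2) by blast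
  let ?A = "\<lambda>x. frechet_derivative F (at x)"
  have D: "(F has_derivative ?A x) (at x)" if "x \<in> U" for x
    using smooth_family_has_derivative[OF F(1) p0 that] .
  have lin: "linear (?A x)" if "x \<in> U" for x using D[OF that] has_derivative_linear by blast
  have inj: "inj (?A x)" if "x \<in> U" for x
    unfolding linear_injective_0[OF lin[OF that]]
  proof (intro allI impI)
    fix h assume "?A x h = 0"
    then have "c * norm h \<le> 0" using c(2)[OF that, of h] by simp
    then show "h = 0" using c(1) by (simp add: mult_le_0_iff)
  qed
  define M where "M x = matrix (?A x)" for x
  have det: "det (M x) \<noteq> 0" if "x \<in> U" for x
    using inj[OF that] det_nz_iff_inj[OF lin[OF that]] unfolding M_def by simp
  define inv where "inv x h = (\<chi> k. det (\<chi> i j. if j = k then h $ i else M x $ i $ j) / det (M x))" for x h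
  have inv: "?A x k = h \<longleftrightarrow> k = inv x h" if "x \<in> U" for x k h
  proof -
    have "?A x k = M x *v k" unfolding M_def using lin[OF that] by (simp add: matrix_works)
    then show ?thesis unfolding inv_def by (simp only: cramer[OF det[OF that]])
  qed
  have invA: "inv x (?A x k) = k" if "x \<in> U" for x k using inv[OF that] by metis
  have Ainv: "?A x (inv x h) = h" if "x \<in> U" for x h using inv[OF that] by metis
  have bl: "bounded_linear (inv x)" if x: "x \<in> U" for x
  proof -
    have "linear (inv x)"
    proof
      show "inv x (a + b) = inv x a + inv x b" for a b
        using inv[OF x, of "inv x a + inv x b" "a + b"] by (simp add: linear_add[OF lin[OF x]] Ainv[OF x])
      show "inv x (r *\<^sub>R a) = r *\<^sub>R inv x a" for r a
        using inv[OF x, of "r *\<^sub>R inv x a" "r *\<^sub>R a"] by (simp add: linear_scale[OF lin[OF x]] Ainv[OF x])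
    qed
    then show ?thesis by (rule linear_conv_bounded_linear[THEN iffD1])
  qed
  have comp: "smooth_family X U (\<lambda>_ x. M x $ i $ j)" for i j
  proof -
    have "smooth_family X U (\<lambda>_ x. ?A x (axis j 1) \<bullet> axis i 1)"
      by (intro smooth_family_inner smooth_family_derivative smooth_family_const F U)
    then show ?thesis by (simp add: M_def matrix_def inner_axis)
  qed
  have smdet: "smooth_family X U (\<lambda>_ x. det (N x))"
    if "\<And>i j. smooth_family X U (\<lambda>_ x. N x $ i $ j)" for N :: "real^4 \<Rightarrow> real^4^4"
    unfolding det_def by (intro smooth_family_sum smooth_family_mult smooth_family_const smooth_family_prod that)
  have sminv: "smooth_family X U (\<lambda>_ x. inv x h)" for h
  proof (rule smooth_family_components)
    fix b :: "real^4" assume "b \<in> Basis"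
    then obtain k where b: "b = axis k 1" by (auto simp: Basis_vec_def)
    have "smooth_family X U (\<lambda>_ x. det (\<chi> i j. if j = k then h $ i else M x $ i $ j) * inverse (det (M x)))"
    proof (intro smooth_family_mult smooth_family_inverse smdet comp U(1))
      show "smooth_family X U (\<lambda>_ x. (\<chi> i j. if j = k then h $ i else M x $ i $ j) $ i $ j)" for i j
        by (cases "j = k") (simp_all add: comp smooth_family_const)
    qed (use det in auto)
    then show "smooth_family X U (\<lambda>_ x. inv x h \<bullet> b)"
      by (simp add: inv_def b inner_axis divide_inverse)
  qed
  have DG: "(G has_derivative inv (G y)) (at y)" if y: "y \<in> V" for y
  proof (rule has_derivative_inverse_basic[where f = F and g = G and y = y, OF D[OF FG(1)[OF y]] bl[OF FG(1)[OF y]]])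
    show "inv (G y) \<circ> ?A (G y) = id" using invA[OF FG(1)[OF y]] by auto
    show "continuous (at y) G" using contG U(2) y by (simp add: continuous_on_eq_continuous_at)
  qed (use U y FG in auto)
  have "C_family n X V (\<lambda>_. G)" for n
  proof (induction n)
    case 0 then show ?case by (simp add: jointly_continuous_no_param contG)
  next
    case (Suc n)
    show ?case
    proof (rule C_family_SucI[of _ _ _ "\<lambda>_ y. inv (G y)"])
      show "C_family n X V (\<lambda>p y. inv (G y) h)" for h
        by (rule C_family_compose[OF smooth_familyD[OF sminv] Suc]) (use FG U in auto)
    qed (use DG contG in \<open>auto intro: jointly_continuous_no_param\<close>)
  qed
  then show ?thesis by (simp add: smooth_family_def)
qed

text \<open>An expansion bound passes to the derivative by comparing increments along short
  multiples of \<open>h\<close>.\<close>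

lemma has_derivative_lower_bound:
  fixes f :: "'a::real_normed_vector \<Rightarrow> 'b::real_normed_vector"
  assumes D: "(f has_derivative A) (at x)" and le: "\<And>y. c * norm (y - x) \<le> norm (f y - f x)"
  shows "c * norm h \<le> norm (A h)"
proof (cases "h = 0")
  case True
  then show ?thesis by simp
next
  case False
  show ?thesis
  proof (rule field_le_epsilon)
    fix e :: real assume "e > 0"
    then have e': "e / norm h > 0" using False by simp
    obtain d where d: "d > 0" "\<And>y. norm (y - x) < d \<Longrightarrow> norm (f y - f x - A (y - x)) \<le> e / norm h * norm (y - x)"
      using D e' unfolding has_derivative_at_alt by blast
    define t where "t = d / (2 * norm h)"
    have t: "t > 0" "t * norm h < d" using d(1) False by (auto simp: t_def)
    have A: "A (t *\<^sub>R h) = t *\<^sub>R A h" using has_derivative_linear[OF D] by (rule linear_scale)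
    have "c * (t * norm h) \<le> norm (f (x + t *\<^sub>R h) - f x)" using le[of "x + t *\<^sub>R h"] t by simp
    also have "\<dots> \<le> norm (A (t *\<^sub>R h)) + norm (f (x + t *\<^sub>R h) - f x - A (t *\<^sub>R h))"
      by (metis add.commute diff_add_cancel norm_triangle_ineq)
    also have "\<dots> \<le> t * norm (A h) + e / norm h * (t * norm h)"
      using d(2)[of "x + t *\<^sub>R h"] t by (simp add: A)
    finally have "t * (c * norm h) \<le> t * (norm (A h) + e)" using False by (simp add: algebra_simps)
    then show "c * norm h \<le> norm (A h) + e" using t by simp
  qed
qed

lemma Diff_of_close:
  assumes h: "h \<in> Diff" and g: "g \<in> Cinf" "\<And>x. x \<in> S3 \<Longrightarrow> g x \<in> S3"
    and K: "K > 0" "\<And>x y. norm (homogeneous_ext (inv_S3 h) x - homogeneous_ext (inv_S3 h) y) \<le> K * norm (x - y)"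
    and L: "\<And>x y. norm (homogeneous_ext (g - h) x - homogeneous_ext (g - h) y) \<le> 1 / (2 * K) * norm (x - y)"
  shows "g \<in> Diff"
proof -
  let ?G = "homogeneous_ext g" and ?H = "homogeneous_ext h" and ?I = "homogeneous_ext (inv_S3 h)"
  have HI: "?H (?I x) = x" for x
    by (rule homogeneous_ext_compose) (use h inv_S3 in auto)
  have IH: "?I (?H x) = x" for x
    by (rule homogeneous_ext_compose) (use h inv_S3 Diff_D(4)[OF h] in auto)
  \<comment> \<open>After composition with \<open>?I\<close> the map \<open>?G\<close> is the
    identity plus \<open>r\<close>; the constants K and 1 / (2 K) multiply to the contraction factor
    1/2.\<close>
  define r where "r y = homogeneous_ext (g - h) (?I y)" for y
  have Gr: "?G (?I y) = y + r y" for y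
    by (simp add: r_def homogeneous_ext_diff HI)
  have r: "norm (r x - r y) \<le> (1/2) * norm (x - y)" for x y
  proof -
    have "norm (r x - r y) \<le> 1 / (2 * K) * norm (?I x - ?I y)" unfolding r_def by (rule L)
    also have "\<dots> \<le> 1 / (2 * K) * (K * norm (x - y))" by (intro mult_left_mono K) (use K in simp)
    also have "\<dots> = (1/2) * norm (x - y)" using K by simp
    finally show ?thesis .
  qed
  \<comment> \<open>This estimate serves three times: for injectivity of \<open>?G\<close>, for
    continuity of its inverse, and for the lower bound on its derivative.\<close>
  have lower: "norm (x - y) \<le> 2 * K * norm (?G x - ?G y)" for x y
  proof -
    have "?G x - ?G y = (?H x - ?H y) + (r (?H x) - r (?H y))"
      using Gr[of "?H x"] Gr[of "?H y"] by (simp add: IH)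
    then have "norm (?H x - ?H y) \<le> norm (?G x - ?G y) + norm (r (?H x) - r (?H y))"
      using norm_triangle_ineq4[of "?G x - ?G y" "r (?H x) - r (?H y)"] by simp
    then have "norm (?H x - ?H y) \<le> 2 * norm (?G x - ?G y)" using r[of "?H x" "?H y"] by simp
    moreover have "norm (x - y) \<le> K * norm (?H x - ?H y)" using K(2)[of "?H x" "?H y"] by (simp add: IH)
    moreover have "K * norm (?H x - ?H y) \<le> K * (2 * norm (?G x - ?G y))"
      using calculation(1) K(1) by (intro mult_left_mono) auto
    ultimately show ?thesis by simp
  qed
  have surj: "\<exists>x. ?G x = y" for y
    using perturbation_of_identity_surj[OF r, of y] Gr by metis
  define J where "J y = (SOME x. ?G x = y)" for y
  have GJ: "?G (J y) = y" for y unfolding J_def by (rule someI_ex[OF surj])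
  have JG: "J (?G x) = x" for x using lower[of "J (?G x)" x] by (simp add: GJ)
  have nG: "norm (?G x) = norm x" for x by (rule norm_homogeneous_ext[OF g(2)])
  have nJ: "norm (J y) = norm y" for y using nG[of "J y"] by (simp add: GJ)
  have contJ: "continuous_on (- {0}) J"
  proof (rule continuous_onI)
    fix x e assume "e > (0::real)"
    show "\<exists>d>0. \<forall>x'\<in>- {0}. dist x' x < d \<longrightarrow> dist (J x') (J x) \<le> e"
    proof (intro exI[of _ "e / (2 * K)"] conjI ballI impI)
      fix x' assume "dist x' x < e / (2 * K)"
      then have "2 * K * dist x' x < e" using K(1) by (simp add: field_simps)
      then show "dist (J x') (J x) \<le> e" using lower[of "J x'" "J x"] by (simp add: GJ dist_norm)
    qed (use \<open>e > 0\<close> K in auto)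
  qed
  let ?X = "discrete_topology {()}"
  have smG: "smooth_family ?X (- {0}) (\<lambda>_. ?G)" by (rule smooth_family_homogeneous_ext[OF g(1)])
  have dlow: "norm (frechet_derivative ?G (at x) k) \<ge> (1 / (2 * K)) * norm k" if x: "x \<in> - {0}" for x k
  proof -
    have "(?G has_derivative frechet_derivative ?G (at x)) (at x)"
      using smooth_family_has_derivative[OF smG _ x] by simp
    then show ?thesis
      by (rule has_derivative_lower_bound) (use lower K(1) in \<open>simp add: field_simps\<close>)
  qed
  have smJ: "smooth_family ?X (- {0}) (\<lambda>_. J)"
  proof (rule smooth_family_inverse_map[OF smG])
    show "J y \<in> - {0}" if "y \<in> - {0}" for y using nJ[of y] that by auto
    show "norm (frechet_derivative ?G (at x) k) \<ge> (1 / (2 * K)) * norm k" if "x \<in> - {0}" for x k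
      by (rule dlow[OF that])
  qed (use K(1) GJ contJ in auto)
  define j where "j x = (if x \<in> S3 then J x else 0)" for x
  have gS: "?G x = g x" if "x \<in> S3" for x by (rule homogeneous_ext_sphere[OF that])
  have jS: "j x \<in> S3" if "x \<in> S3" for x using that nJ by (simp add: j_def)
  have "j \<in> Cinf"
  proof (rule CinfI)
    show "smooth_on_S3 j" unfolding smooth_on_S3_def
      by (intro exI[of _ "- {0}"] exI[of _ J]) (use smooth_family_imp_smooth_on[OF smJ] in \<open>auto simp: j_def\<close>)
  qed (simp add: j_def)
  then show ?thesis
  proof (rule DiffI[OF g(1)])
    show "g x \<in> S3" if "x \<in> S3" for x by (rule g(2)[OF that])
    show "j x \<in> S3" if "x \<in> S3" for x by (rule jS[OF that])
    show "j (g x) = x" if "x \<in> S3" for x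
      using JG[of x] gS[OF that] g(2)[OF that] by (simp add: j_def)
    show "g (j x) = x" if "x \<in> S3" for x
      using GJ[of x] gS[OF jS[OF that]] that by (simp add: j_def)
  qed
qed

text \<open>\<open>Diff\<close> is not open in \<open>Cinf\<close>, because nearby maps may leave
  the sphere. Openness among self-maps is enough, since chart parametrizations always land in the
  sphere.\<close>

lemma Diff_open_in_self_maps:
  assumes h: "h \<in> Diff"
  obtains N where "openin Cinf_topology N" "h \<in> N" "\<And>g. g \<in> N \<Longrightarrow> \<forall>x\<in>S3. g x \<in> S3 \<Longrightarrow> g \<in> Diff"
proof -
  have hC: "h \<in> Cinf" by (rule Diff_D(1)[OF h])
  obtain K where K: "K > 0" "\<And>x y. norm (homogeneous_ext (inv_S3 h) x - homogeneous_ext (inv_S3 h) y) \<le> K * norm (x - y)"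
    using Cinf_Lipschitz_bound[OF inv_S3_Cinf[OF h]] by metis
  \<comment> \<open>With the factor 5 of \<open>homogeneous_ext_Lipschitz\<close> this produces the
    constant 1 / (2 K) of \<open>Diff_of_close\<close>.\<close>
  define e where "e = 1 / (10 * K)"
  have e: "e > 0" using K by (simp add: e_def)
  define Q where "Q = insert (Cinf_seminorm []) ((\<lambda>b. Cinf_seminorm [b]) ` Basis)"
  define N where "N = {g \<in> Cinf. \<forall>p\<in>Q. p (g - h) < e}"
  have Q: "finite Q" "Q \<subseteq> Cinf_seminorm ` lists Basis" by (auto simp: Q_def)
  have "openin Cinf_topology {g \<in> Cinf. p (g - h) < e}" if p: "p \<in> Q" for p
    unfolding Cinf_topology_def seminorm_topology_def
  proof (rule topology_generated_by_Basis)
    have "p \<in> Cinf_seminorm ` lists Basis" using p Q by blast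
    then show "{g \<in> Cinf. p (g - h) < e} \<in> {{y \<in> Cinf. p (y - x) < e} |p x e. p \<in> Cinf_seminorm ` lists Basis \<and> x \<in> Cinf \<and> 0 < e}"
      using hC e by blast
  qed
  then have "openin Cinf_topology (\<Inter>p\<in>Q. {g \<in> Cinf. p (g - h) < e})"
    by (intro openin_INT2) (use Q in \<open>auto simp: Q_def\<close>)
  moreover have "(\<Inter>p\<in>Q. {g \<in> Cinf. p (g - h) < e}) = N" by (auto simp: N_def Q_def)
  ultimately have "openin Cinf_topology N" by simp
  moreover have "h \<in> N" using hC e seminorm_on_zero[OF seminorm_on_Cinf subspace_Cinf] by (auto simp: N_def Q_def)
  moreover have "g \<in> Diff" if gN: "g \<in> N" and gS: "\<forall>x\<in>S3. g x \<in> S3" for g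
  proof (rule Diff_of_close[OF h _ bspec[OF gS] K])
    show gC: "g \<in> Cinf" using gN by (simp add: N_def)
    have gh: "g - h \<in> Cinf" using gC hC subspace_diff[OF subspace_Cinf] by blast
    have b: "Cinf_seminorm [] (g - h) \<le> e" "b \<in> Basis \<Longrightarrow> Cinf_seminorm [b] (g - h) \<le> e" for b
      using gN by (auto simp: N_def Q_def)
    show "norm (homogeneous_ext (g - h) x - homogeneous_ext (g - h) y) \<le> 1 / (2 * K) * norm (x - y)" for x y
    proof -
      have "norm (homogeneous_ext (g - h) x - homogeneous_ext (g - h) y) \<le> 5 * e * norm (x - y)"
      proof (rule homogeneous_ext_Lipschitz[OF gh])
        fix x assume x: "x \<in> S3"
        show "norm ((g - h) x) \<le> e"
          using order_trans[OF Cinf_seminorm_upper[OF gh x, of "[]"] b(1)] radial_ext_sphere[OF x, of "g - h"] by simp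
        show "norm (iterated_derivative [b] (radial_ext (g - h)) x) \<le> e" if "b \<in> Basis" for b
          by (rule order_trans[OF Cinf_seminorm_upper[OF gh x] b(2)[OF that]])
      qed
      then show ?thesis by (simp add: e_def)
    qed
  qed
  ultimately show ?thesis by (rule that)
qed

lemma openin_preimage_Diff:
  assumes T: "continuous_map X Cinf_topology T" and S: "\<And>p x. p \<in> topspace X \<Longrightarrow> x \<in> S3 \<Longrightarrow> T p x \<in> S3"
  shows "openin X {p \<in> topspace X. T p \<in> Diff}"
proof (subst openin_subopen, intro ballI)
  fix p assume "p \<in> {p \<in> topspace X. T p \<in> Diff}"
  then have p: "p \<in> topspace X" "T p \<in> Diff" by auto
  obtain N where N: "openin Cinf_topology N" "T p \<in> N" "\<And>g. g \<in> N \<Longrightarrow> \<forall>x\<in>S3. g x \<in> S3 \<Longrightarrow> g \<in> Diff"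
    by (rule Diff_open_in_self_maps[OF p(2)]) (rule that)
  show "\<exists>M. openin X M \<and> p \<in> M \<and> M \<subseteq> {p \<in> topspace X. T p \<in> Diff}"
    by (rule exI[of _ "{q \<in> topspace X. T q \<in> N}"])
      (use p N S openin_continuous_map_preimage[OF T N(1)] in auto)
qed

section \<open>\<open>Diff\<close> as a topological space and its charts\<close>

lemma topspace_Diff_topology [simp]: "topspace Diff_topology = Diff"
  using Diff_D(1) by (auto simp: Diff_topology_def)

lemma continuous_map_Diff_imp_Cinf: "continuous_map X Diff_topology T \<Longrightarrow> continuous_map X Cinf_topology T"
  by (simp add: Diff_topology_def continuous_map_in_subtopology)

lemma continuous_map_Diff_id: "continuous_map Diff_topology Cinf_topology (\<lambda>f. f)"
  using continuous_map_Diff_imp_Cinf[of Diff_topology "\<lambda>f. f"] by simp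

lemma Hausdorff_Diff_topology: "Hausdorff_space Diff_topology"
  unfolding Hausdorff_space_def
proof (intro allI impI)
  fix f g assume "f \<in> topspace Diff_topology \<and> g \<in> topspace Diff_topology \<and> f \<noteq> g"
  then have fg: "f \<in> Diff" "g \<in> Diff" "f \<noteq> g" by auto
  then obtain x where x: "f x \<noteq> g x" by blast
  then have xS: "x \<in> S3" using Cinf_zero[OF Diff_D(1)[OF fg(1)], of x] Cinf_zero[OF Diff_D(1)[OF fg(2)], of x] by metis
  obtain U V where UV: "open U" "open V" "f x \<in> U" "g x \<in> V" "U \<inter> V = {}"
    using hausdorff[OF x] by blast
  have c: "continuous_map Diff_topology euclidean (\<lambda>f. f x)"
    by (rule continuous_map_eval[OF continuous_map_Diff_id xS])
  have o: "openin Diff_topology {f \<in> topspace Diff_topology. f x \<in> U}" "openin Diff_topology {f \<in> topspace Diff_topology. f x \<in> V}"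
    using openin_continuous_map_preimage[OF c] UV(1,2) by auto
  show "\<exists>U V. openin Diff_topology U \<and> openin Diff_topology V \<and> f \<in> U \<and> g \<in> V \<and> disjnt U V"
    by (intro exI conjI) (rule o(1), rule o(2), use UV fg in \<open>auto simp: disjnt_def\<close>)
qed

definition id_S3 :: "real^4 \<Rightarrow> real^4" where
  "id_S3 x = (if x \<in> S3 then x else 0)"

lemma id_S3_Cinf: "id_S3 \<in> Cinf"
proof (rule Cinf_from_no_param)
  show "smooth_family (discrete_topology {()}) (- {0}) (\<lambda>_. radial_ext id_S3)"
    by (rule smooth_family_cong[OF smooth_family_normalize]) (auto simp: radial_ext_def id_S3_def)
qed (simp add: id_S3_def)

text \<open>
  A local addition: fibrewise diffeomorphisms \<open>E x\<close> from open subsets of the tangent spaces onto open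
  subsets of the sphere, with inverses \<open>L x\<close>.  Every such family yields charts of \<^const>\<open>Diff\<close>.
\<close>

locale local_addition =
  fixes E L :: "(real^4) \<times> (real^4) \<Rightarrow> real^4" and OE OL :: "((real^4) \<times> (real^4)) set"
  assumes smE: "smooth_on OE E" and oE: "open OE" and smL: "smooth_on OL L" and oL: "open OL"
    and E: "\<And>x v. x \<in> S3 \<Longrightarrow> v \<bullet> x = 0 \<Longrightarrow> (x, v) \<in> OE \<Longrightarrow> E (x, v) \<in> S3 \<and> (x, E (x, v)) \<in> OL \<and> L (x, E (x, v)) = v"
    and L: "\<And>x y. x \<in> S3 \<Longrightarrow> y \<in> S3 \<Longrightarrow> (x, y) \<in> OL \<Longrightarrow> L (x, y) \<bullet> x = 0 \<and> (x, L (x, y)) \<in> OE \<and> E (x, L (x, y)) = y"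
begin

definition chart_dom :: "(real^4 \<Rightarrow> real^4) \<Rightarrow> (real^4 \<Rightarrow> real^4) set" where
  "chart_dom f = {g \<in> Diff. \<forall>x\<in>S3. (f x, g x) \<in> OL}"

text \<open>Composing with the inverse of f turns a section along f into a vector field, so all
  charts share the model space \<open>VF\<close>.\<close>

definition chart_log :: "(real^4 \<Rightarrow> real^4) \<Rightarrow> (real^4 \<Rightarrow> real^4) \<Rightarrow> real^4 \<Rightarrow> real^4" where
  "chart_log f g = (\<lambda>x. if x \<in> S3 then L (x, g (inv_S3 f x)) else 0)"

definition chart_param :: "(real^4 \<Rightarrow> real^4) \<Rightarrow> (real^4 \<Rightarrow> real^4) \<Rightarrow> real^4 \<Rightarrow> real^4" where
  "chart_param f V = (\<lambda>x. if x \<in> S3 then E (f x, V (f x)) else 0)"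

definition chart_range :: "(real^4 \<Rightarrow> real^4) \<Rightarrow> (real^4 \<Rightarrow> real^4) set" where
  "chart_range f = {V \<in> VF. (\<forall>x\<in>S3. (x, V x) \<in> OE) \<and> chart_param f V \<in> Diff}"

lemma chart_log_superposition: "chart_log f g = superposition id_S3 L (compose_S3 g (inv_S3 f))"
  by (auto simp: chart_log_def superposition_def compose_S3_def id_S3_def)

lemma chart_param_superposition:
  "f \<in> Diff \<Longrightarrow> chart_param f V = compose_S3 (superposition id_S3 E V) f"
  using Diff_D(4) by (auto simp: chart_param_def superposition_def compose_S3_def id_S3_def fun_eq_iff)

lemma chart_param_sphere:
  assumes "f \<in> Diff" "V \<in> VF" "\<And>x. x \<in> S3 \<Longrightarrow> (x, V x) \<in> OE" "x \<in> S3"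
  shows "chart_param f V x \<in> S3"
proof -
  have "f x \<in> S3" by (rule Diff_D(4)[OF assms(1,4)])
  then have "E (f x, V (f x)) \<in> S3" using E[of "f x" "V (f x)"] VF_D(2)[OF assms(2)] assms(3) by blast
  then show ?thesis unfolding chart_param_def if_P[OF assms(4)] .
qed

lemma continuous_map_chart_param:
  assumes f: "f \<in> Diff" and V: "continuous_map X VF_topology V" "\<And>p x. p \<in> topspace X \<Longrightarrow> x \<in> S3 \<Longrightarrow> (x, V p x) \<in> OE"
  shows "continuous_map X Cinf_topology (\<lambda>p. chart_param f (V p))"
  unfolding chart_param_superposition[OF f]
proof (rule continuous_map_compose_S3)
  have "smooth_family X (- {0}) (\<lambda>p. radial_ext (superposition id_S3 E (V p)))"
    by (rule smooth_family_superposition[OF smooth_on_imp_smooth_family[OF smE]])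
      (use V id_S3_Cinf in \<open>auto simp: id_S3_def intro: continuous_map_VF_imp_Cinf\<close>)
  then show "continuous_map X Cinf_topology (\<lambda>p. superposition id_S3 E (V p))"
    by (rule continuous_map_into_Cinf) (simp add: superposition_def)
qed (use f Diff_D(1,4) in auto)

lemma continuous_map_chart_log:
  assumes f: "f \<in> Diff" and g: "continuous_map X Cinf_topology g"
    "\<And>p x. p \<in> topspace X \<Longrightarrow> x \<in> S3 \<Longrightarrow> g p x \<in> S3"
    "\<And>p x. p \<in> topspace X \<Longrightarrow> x \<in> S3 \<Longrightarrow> (f x, g p x) \<in> OL"
  shows "continuous_map X VF_topology (\<lambda>p. chart_log f (g p))"
proof (rule continuous_map_into_VF)
  have *: "g p (inv_S3 f x) \<in> S3" "(x, g p (inv_S3 f x)) \<in> OL" if "p \<in> topspace X" "x \<in> S3" for p x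
    using g(2,3)[OF that(1) inv_S3(1)[OF f that(2)]] inv_S3(2)[OF f that(2)] by auto
  show "smooth_family X (- {0}) (\<lambda>p. radial_ext (chart_log f (g p)))"
    unfolding chart_log_superposition
  proof (rule smooth_family_superposition[OF smooth_on_imp_smooth_family[OF smL] id_S3_Cinf])
    show "continuous_map X Cinf_topology (\<lambda>p. compose_S3 (g p) (inv_S3 f))"
      by (rule continuous_map_compose_S3[OF g(1)]) (use inv_S3_Cinf[OF f] inv_S3(1)[OF f] in auto)
    show "(x, compose_S3 (g p) (inv_S3 f) (id_S3 x)) \<in> OL" if "p \<in> topspace X" "x \<in> S3" for p x
      using *(2)[OF that] that(2) by (simp add: compose_S3_def id_S3_def)
  qed (auto simp: id_S3_def)
  show "chart_log f (g p) x \<bullet> x = 0" if "p \<in> topspace X" "x \<in> S3" for p x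
    using L[OF that(2) *[OF that]] that(2) by (simp add: chart_log_def)
qed (simp add: chart_log_def)

lemma chart_log_in_range:
  assumes f: "f \<in> Diff" and g: "g \<in> chart_dom f"
  shows "chart_param f (chart_log f g) = g" "chart_log f g \<in> chart_range f"
proof -
  have gD: "g \<in> Diff" and gO: "\<And>x. x \<in> S3 \<Longrightarrow> (f x, g x) \<in> OL" using g by (auto simp: chart_dom_def)
  have eq: "chart_log f g (f x) = L (f x, g x)" if "x \<in> S3" for x
    using that Diff_D(4)[OF f that] inv_S3(3)[OF f that] by (simp add: chart_log_def)
  show p: "chart_param f (chart_log f g) = g"
  proof
    fix x show "chart_param f (chart_log f g) x = g x"
    proof (cases "x \<in> S3")
      case True
      then show ?thesis
        using L[OF Diff_D(4)[OF f True] Diff_D(4)[OF gD True] gO[OF True]] eq[OF True] by (simp add: chart_param_def)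
    qed (use Cinf_zero[OF Diff_D(1)[OF gD]] in \<open>simp add: chart_param_def\<close>)
  qed
  have "continuous_map (discrete_topology {()}) VF_topology (\<lambda>_. chart_log f g)"
    by (rule continuous_map_chart_log[OF f]) (use Diff_D(1,4)[OF gD] gO in auto)
  from continuous_map_image_subset_topspace[OF this] have "chart_log f g \<in> VF" by simp
  moreover have "(x, chart_log f g x) \<in> OE" if "x \<in> S3" for x
    using L[of x "g (inv_S3 f x)"] gO[OF inv_S3(1)[OF f that]] inv_S3(1,2)[OF f that] Diff_D(4)[OF gD inv_S3(1)[OF f that]] that
    by (simp add: chart_log_def)
  ultimately show "chart_log f g \<in> chart_range f" using p gD by (simp add: chart_range_def)
qed

lemma chart_param_in_dom:
  assumes f: "f \<in> Diff" and V: "V \<in> chart_range f"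
  shows "chart_log f (chart_param f V) = V" "chart_param f V \<in> chart_dom f"
proof -
  have VV: "V \<in> VF" "\<And>x. x \<in> S3 \<Longrightarrow> (x, V x) \<in> OE" "chart_param f V \<in> Diff" using V by (auto simp: chart_range_def)
  have E': "(x, E (x, V x)) \<in> OL" "L (x, E (x, V x)) = V x" if "x \<in> S3" for x
    using E[OF that VF_D(2)[OF VV(1) that] VV(2)[OF that]] by auto
  show "chart_log f (chart_param f V) = V"
  proof
    fix x show "chart_log f (chart_param f V) x = V x"
    proof (cases "x \<in> S3")
      case True
      then show ?thesis using E'(2)[OF True] inv_S3(1,2)[OF f True] by (simp add: chart_log_def chart_param_def)
    qed (use Cinf_zero[OF VF_D(1)[OF VV(1)]] in \<open>simp add: chart_log_def\<close>)
  qed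
  show "chart_param f V \<in> chart_dom f"
    unfolding chart_dom_def using VV(3) E'(1)[OF Diff_D(4)[OF f]] by (auto simp: chart_param_def)
qed

lemma openin_chart_dom:
  assumes f: "f \<in> Diff" shows "openin Diff_topology (chart_dom f)"
  using openin_pointwise_condition[OF oL continuous_map_Diff_id Diff_D(1)[OF f] Diff_D(4)[OF f]]
  by (simp add: chart_dom_def)

lemma openin_chart_range:
  assumes f: "f \<in> Diff" shows "openin VF_topology (chart_range f)"
proof -
  let ?A = "{V \<in> topspace VF_topology. \<forall>x\<in>S3. (id_S3 x, V x) \<in> OE}"
  have A: "openin VF_topology ?A"
    by (rule openin_pointwise_condition[OF oE _ id_S3_Cinf])
      (auto simp: id_S3_def intro: continuous_map_VF_imp_Cinf)
  have VA: "V \<in> VF" "\<And>x. x \<in> S3 \<Longrightarrow> (x, V x) \<in> OE" if "V \<in> ?A" for V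
    using that by (auto simp: id_S3_def)
  have tsA: "topspace (subtopology VF_topology ?A) = ?A" using openin_subset[OF A] by (simp add: inf_absorb2)
  \<comment> \<open>Restricting to \<open>?A\<close> first guarantees values in the sphere, the
    setting in which being a diffeomorphism is an open condition.\<close>
  have "continuous_map (subtopology VF_topology ?A) Cinf_topology (\<lambda>V. chart_param f V)"
  proof (rule continuous_map_chart_param[OF f])
    show "continuous_map (subtopology VF_topology ?A) VF_topology (\<lambda>V. V)"
      by (rule continuous_map_from_subtopology) simp
    show "(x, V x) \<in> OE" if "V \<in> topspace (subtopology VF_topology ?A)" "x \<in> S3" for V x
      using VA(2) that unfolding tsA by blast
  qed
  then have "openin (subtopology VF_topology ?A) {V \<in> topspace (subtopology VF_topology ?A). chart_param f V \<in> Diff}"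
    by (rule openin_preimage_Diff) (unfold tsA, rule chart_param_sphere[OF f VA], assumption+)
  then have "openin VF_topology {V \<in> ?A. chart_param f V \<in> Diff}"
    unfolding tsA using openin_open_subtopology[OF A] by blast
  moreover have "{V \<in> ?A. chart_param f V \<in> Diff} = chart_range f" by (auto simp: chart_range_def id_S3_def)
  ultimately show ?thesis by simp
qed

lemma homeomorphic_maps_chart:
  assumes f: "f \<in> Diff"
  shows "homeomorphic_maps (subtopology Diff_topology (chart_dom f)) (subtopology VF_topology (chart_range f))
    (chart_log f) (chart_param f)"
proof -
  have ts: "topspace (subtopology Diff_topology (chart_dom f)) = chart_dom f"
    "topspace (subtopology VF_topology (chart_range f)) = chart_range f"
    using openin_subset[OF openin_chart_dom[OF f]] openin_subset[OF openin_chart_range[OF f]] by (auto simp: inf_absorb2)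
  have "continuous_map (subtopology Diff_topology (chart_dom f)) VF_topology (\<lambda>g. chart_log f g)"
    by (rule continuous_map_chart_log[OF f continuous_map_from_subtopology[OF continuous_map_Diff_id]])
      (use Diff_D(4) in \<open>auto simp: ts chart_dom_def\<close>)
  then have c1: "continuous_map (subtopology Diff_topology (chart_dom f)) (subtopology VF_topology (chart_range f)) (chart_log f)"
    by (rule continuous_map_into_subtopology) (use chart_log_in_range(2)[OF f] in \<open>simp add: ts Pi_iff\<close>)
  have "continuous_map (subtopology VF_topology (chart_range f)) Cinf_topology (\<lambda>V. chart_param f V)"
    by (rule continuous_map_chart_param[OF f])
      (auto simp: ts chart_range_def intro: continuous_map_from_subtopology)
  then have "continuous_map (subtopology VF_topology (chart_range f)) Diff_topology (chart_param f)"
    unfolding Diff_topology_def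
    by (rule continuous_map_into_subtopology) (auto simp: ts chart_range_def)
  then have c2: "continuous_map (subtopology VF_topology (chart_range f)) (subtopology Diff_topology (chart_dom f)) (chart_param f)"
    by (rule continuous_map_into_subtopology) (use chart_param_in_dom(2)[OF f] in \<open>simp add: ts Pi_iff\<close>)
  show ?thesis
    unfolding homeomorphic_maps_def ts
    using c1 c2 chart_log_in_range(1)[OF f] chart_param_in_dom(1)[OF f] by blast
qed

text \<open>Agreement with \<open>chart_log f\<close> is asked only on the domain: the charts of
  \<open>Diff_atlas\<close> are given as \<open>inv_into\<close>, which is unspecified
  elsewhere.\<close>

lemma chart_log_image:
  assumes f: "f \<in> Diff" and "\<And>g. g \<in> chart_dom f \<Longrightarrow> \<phi> g = chart_log f g"
  shows "\<phi> ` chart_dom f = chart_range f"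
proof -
  have "chart_log f ` chart_dom f = chart_range f"
    using chart_log_in_range[OF f] chart_param_in_dom[OF f] by (auto simp: image_iff) (metis)
  then show ?thesis using assms(2) by (metis image_cong)
qed

lemma chart_chart_log:
  assumes f: "f \<in> Diff" and "\<And>g. g \<in> chart_dom f \<Longrightarrow> \<phi> g = chart_log f g"
  shows "chart Diff_topology VF_topology (chart_dom f) \<phi>"
proof -
  have "homeomorphic_map (subtopology Diff_topology (chart_dom f)) (subtopology VF_topology (chart_range f)) (chart_log f)"
    using homeomorphic_maps_chart[OF f] homeomorphic_maps_map by blast
  then have "homeomorphic_map (subtopology Diff_topology (chart_dom f)) (subtopology VF_topology (chart_range f)) \<phi>"
    by (rule homeomorphic_map_eq) (use assms(2) in auto)
  then show ?thesis
    using openin_chart_dom[OF f] openin_chart_range[OF f] chart_log_image[OF f assms(2)] by (simp add: chart_def)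
qed

lemma inv_into_chart_log:
  assumes f: "f \<in> Diff" and "\<And>g. g \<in> chart_dom f \<Longrightarrow> \<phi> g = chart_log f g" and V: "V \<in> chart_range f"
  shows "inv_into (chart_dom f) \<phi> V = chart_param f V"
proof (rule inv_into_f_eq)
  show "inj_on \<phi> (chart_dom f)"
    by (rule inj_on_inverseI[of _ "chart_param f"]) (simp add: assms(2) chart_log_in_range(1)[OF f])
qed (use assms(2) chart_param_in_dom[OF f V] in auto)

end

section \<open>Smoothness of chart transitions\<close>

lemma frechet_smooth_cong:
  assumes "frechet_smooth E F U f" "\<And>x. x \<in> U \<Longrightarrow> f x = g x"
  shows "frechet_smooth E F U g"
proof -
  from assms(1) obtain D where D: "openin E U" "\<forall>x\<in>U. D x [] = f x"
    "\<forall>x\<in>U. \<forall>hs\<in>lists (topspace E). \<forall>h\<in>topspace E.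
       limitin F (\<lambda>t. (1 / t) *\<^sub>R (D (x + t *\<^sub>R h) hs - D x hs)) (D x (hs @ [h])) (at (0::real))"
    "\<forall>n. continuous_map (prod_topology (subtopology E U) (product_topology (\<lambda>_. E) {..<n})) F (\<lambda>(x, h). D x (map h [0..<n]))"
    unfolding frechet_smooth_def by (elim conjE exE) (rule that)
  show ?thesis unfolding frechet_smooth_def
    by (intro conjI exI[of _ D] D(1,3,4)) (use D(2) assms(2) in simp)
qed

text \<open>Two local additions at once, because the chart adapted to the Hopf fibration has to be
  compatible with the atlas of the exponential map.\<close>

locale two_local_additions = A: local_addition E L OE OL + B: local_addition E' L' OE' OL'
  for E L OE OL E' L' OE' OL'
begin

text \<open>With k equal to f composed with the inverse of g, the transition sends V to x \<mapsto>
  \<open>L' (x, E (k x, V (k x)))\<close>. This is a superposition operator, and only its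
  finite-dimensional symbol has to be smooth.\<close>

lemma frechet_smooth_transition:
  assumes f: "f \<in> Diff" and g: "g \<in> Diff"
    and \<phi>: "\<And>h. h \<in> A.chart_dom f \<Longrightarrow> \<phi> h = A.chart_log f h"
    and \<psi>: "\<And>h. h \<in> B.chart_dom g \<Longrightarrow> \<psi> h = B.chart_log g h"
  shows "frechet_smooth VF_topology VF_topology (\<phi> ` (A.chart_dom f \<inter> B.chart_dom g))
    (\<lambda>v. \<psi> (inv_into (A.chart_dom f) \<phi> v))"
proof -
  define U where "U = {V \<in> A.chart_range f. A.chart_param f V \<in> B.chart_dom g}"
  have img: "\<phi> ` (A.chart_dom f \<inter> B.chart_dom g) = U"
  proof (intro equalityI subsetI)
    fix V assume "V \<in> \<phi> ` (A.chart_dom f \<inter> B.chart_dom g)"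
    then obtain h where h: "h \<in> A.chart_dom f" "h \<in> B.chart_dom g" "V = A.chart_log f h" using \<phi> by auto
    then show "V \<in> U" using A.chart_log_in_range[OF f h(1)] by (simp add: U_def)
  next
    fix V assume V: "V \<in> U"
    then have "V = \<phi> (A.chart_param f V)" "A.chart_param f V \<in> A.chart_dom f"
      using A.chart_param_in_dom[OF f] \<phi> by (auto simp: U_def)
    then show "V \<in> \<phi> ` (A.chart_dom f \<inter> B.chart_dom g)" using V unfolding U_def by blast
  qed
  let ?R = "A.chart_range f"
  have tsR: "topspace (subtopology VF_topology ?R) = ?R"
    using openin_subset[OF A.openin_chart_range[OF f]] by (simp add: inf_absorb2)
  have cp: "continuous_map (subtopology VF_topology ?R) Diff_topology (A.chart_param f)"
    using A.homeomorphic_maps_chart[OF f] by (auto simp: homeomorphic_maps_def continuous_map_in_subtopology)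
  have oU: "openin VF_topology U"
  proof -
    have "openin (subtopology VF_topology ?R) {V \<in> topspace (subtopology VF_topology ?R). A.chart_param f V \<in> B.chart_dom g}"
      by (rule openin_continuous_map_preimage[OF cp B.openin_chart_dom[OF g]])
    then show ?thesis unfolding tsR U_def using openin_open_subtopology[OF A.openin_chart_range[OF f]] by blast
  qed
  define k where "k = compose_S3 f (inv_S3 g)"
  have kD: "k \<in> Diff" unfolding k_def by (rule compose_S3_Diff[OF f inv_S3_Diff[OF g]])
  have kx: "k x = f (inv_S3 g x)" if "x \<in> S3" for x using that by (simp add: k_def compose_S3_def)
  \<comment> \<open>The base point is replaced by its image under k, radially extended because
    smoothness needs an open set of pairs.\<close>
  define \<kappa> where "\<kappa> z = (radial_ext k (fst z), snd z)" for z :: "(real^4) \<times> (real^4)"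
  let ?X = "discrete_topology {()}"
  let ?W0 = "{z::(real^4) \<times> (real^4). fst z \<noteq> 0}"
  have oW0: "open ?W0" by (intro open_Collect_neq continuous_intros)
  have sm\<kappa>: "smooth_family ?X ?W0 (\<lambda>_. \<kappa>)"
    unfolding \<kappa>_def
    by (intro smooth_family_Pair smooth_family_compose[OF CinfD[OF Diff_D(1)[OF kD]]]
         smooth_family_no_param_linear bounded_linear_fst bounded_linear_snd oW0) auto
  \<comment> \<open>\<open>W1\<close>, and then \<open>W\<close>, cut down to the pairs to which
    \<open>E\<close>, and next \<open>L'\<close>, may be applied.\<close>
  define W1 where "W1 = {z \<in> ?W0. \<kappa> z \<in> OE}"
  have oW1: "open W1"
    using continuous_open_preimage[OF jointly_continuous_at_param[OF smooth_family_jcont[OF sm\<kappa>]] oW0 A.oE]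
    by (simp add: W1_def Collect_conj_eq vimage_def)
  have smE1: "smooth_family ?X W1 (\<lambda>_ z. (fst z, E (\<kappa> z)))"
    by (intro smooth_family_Pair smooth_family_compose[OF smooth_on_imp_smooth_family[OF A.smE] smooth_family_subset[OF sm\<kappa>]]
         smooth_family_no_param_linear bounded_linear_fst oW1) (auto simp: W1_def)
  define W where "W = {z \<in> W1. (fst z, E (\<kappa> z)) \<in> OL'}"
  have oW: "open W"
    using continuous_open_preimage[OF jointly_continuous_at_param[OF smooth_family_jcont[OF smE1]] oW1 B.oL]
    by (simp add: W_def Collect_conj_eq vimage_def)
  define \<Phi> where "\<Phi> z = L' (fst z, E (\<kappa> z))" for z
  have "smooth_family ?X W (\<lambda>_. \<Phi>)"
    unfolding \<Phi>_def
    by (intro smooth_family_compose[OF smooth_on_imp_smooth_family[OF B.smL] smooth_family_subset[OF smE1]] oW)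
      (auto simp: W_def)
  then have sm\<Phi>: "smooth_on W \<Phi>" using smooth_on_iff_smooth_family[OF oW] by blast
  have key: "(x, V (k x)) \<in> W" "B.chart_log g (A.chart_param f V) x = \<Phi> (x, V (k x))" "\<Phi> (x, V (k x)) \<bullet> x = 0"
    if V: "V \<in> U" and x: "x \<in> S3" for V x
  proof -
    have VR: "V \<in> VF" "\<And>x. x \<in> S3 \<Longrightarrow> (x, V x) \<in> OE" "A.chart_param f V \<in> Diff"
      "\<And>x. x \<in> S3 \<Longrightarrow> (g x, A.chart_param f V x) \<in> OL'"
      using V by (auto simp: U_def A.chart_range_def B.chart_dom_def)
    have gx: "inv_S3 g x \<in> S3" "g (inv_S3 g x) = x" using inv_S3[OF g x] by auto
    have kS: "k x \<in> S3" by (rule Diff_D(4)[OF kD x])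
    have \<kappa>: "\<kappa> (x, V (k x)) = (k x, V (k x))" using x by (simp add: \<kappa>_def)
    have cp: "A.chart_param f V (inv_S3 g x) = E (k x, V (k x))"
      using gx(1) by (simp add: A.chart_param_def kx[OF x])
    have OL': "(x, E (k x, V (k x))) \<in> OL'" using VR(4)[OF gx(1)] gx(2) cp by simp
    have "E (k x, V (k x)) \<in> S3" using A.E[OF kS VF_D(2)[OF VR(1) kS] VR(2)[OF kS]] by simp
    from B.L[OF x this OL'] show "\<Phi> (x, V (k x)) \<bullet> x = 0" by (simp add: \<Phi>_def \<kappa>)
    show "(x, V (k x)) \<in> W" using S3_nonzero[OF x] VR(2)[OF kS] OL' by (simp add: W_def W1_def \<kappa>)
    show "B.chart_log g (A.chart_param f V) x = \<Phi> (x, V (k x))" using x cp by (simp add: B.chart_log_def \<Phi>_def \<kappa>)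
  qed
  have "frechet_smooth VF_topology VF_topology U (superposition k \<Phi>)"
  proof (rule frechet_smooth_superposition[OF sm\<Phi> oW _ Diff_D(1,3)[OF kD] oU])
    show "(x, V (k x)) \<in> W" if "V \<in> U" "x \<in> S3" for V x by (rule key(1)[OF that])
    show "\<Phi> (x, V (k x)) \<bullet> x = 0" if "V \<in> U" "x \<in> S3" for V x by (rule key(3)[OF that])
  qed (auto simp: W_def W1_def)
  then show ?thesis unfolding img
  proof (rule frechet_smooth_cong)
    fix V assume V: "V \<in> U"
    then have "inv_into (A.chart_dom f) \<phi> V = A.chart_param f V"
      by (intro A.inv_into_chart_log[OF f \<phi>]) (auto simp: U_def)
    moreover have "\<psi> (A.chart_param f V) = B.chart_log g (A.chart_param f V)" using V \<psi> by (simp add: U_def)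
    moreover have "B.chart_log g (A.chart_param f V) = superposition k \<Phi> V"
    proof
      fix x show "B.chart_log g (A.chart_param f V) x = superposition k \<Phi> V x"
      proof (cases "x \<in> S3")
        case True
        then show ?thesis unfolding key(2)[OF V True] by (simp add: superposition_def)
      qed (simp add: superposition_def B.chart_log_def)
    qed
    ultimately show "superposition k \<Phi> V = \<psi> (inv_into (A.chart_dom f) \<phi> V)" by simp
  qed
qed

end

lemma charts_compatible_local_additions:
  assumes "two_local_additions E L OE OL E' L' OE' OL'" and f: "f \<in> Diff" and g: "g \<in> Diff"
    and \<phi>: "\<And>h. h \<in> local_addition.chart_dom OL f \<Longrightarrow> \<phi> h = local_addition.chart_log L f h"
    and \<psi>: "\<And>h. h \<in> local_addition.chart_dom OL' g \<Longrightarrow> \<psi> h = local_addition.chart_log L' g h"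
  shows "charts_compatible VF_topology (local_addition.chart_dom OL f) \<phi> VF_topology (local_addition.chart_dom OL' g) \<psi>"
proof -
  interpret P: two_local_additions E L OE OL E' L' OE' OL' by fact
  interpret Q: two_local_additions E' L' OE' OL' E L OE OL ..
  show ?thesis unfolding charts_compatible_def
  proof
    show "frechet_smooth VF_topology VF_topology (\<phi> ` (P.A.chart_dom f \<inter> P.B.chart_dom g))
      (\<lambda>v. \<psi> (inv_into (P.A.chart_dom f) \<phi> v))"
      by (rule P.frechet_smooth_transition[OF f g]) (use \<phi> \<psi> in auto)
    have "frechet_smooth VF_topology VF_topology (\<psi> ` (P.B.chart_dom g \<inter> P.A.chart_dom f))
      (\<lambda>v. \<phi> (inv_into (P.B.chart_dom g) \<psi> v))"
      by (rule Q.frechet_smooth_transition[OF g f]) (use \<phi> \<psi> in auto)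
    then show "frechet_smooth VF_topology VF_topology (\<psi> ` (P.A.chart_dom f \<inter> P.B.chart_dom g))
      (\<lambda>v. \<phi> (inv_into (P.B.chart_dom g) \<psi> v))" by (simp add: Int_commute)
  qed
qed

section \<open>The Riemannian exponential map\<close>

text \<open>Termwise differentiation gives another everywhere convergent power series.\<close>

lemma smooth_family_power_series:
  fixes c :: "nat \<Rightarrow> real"
  assumes "\<And>y. summable (\<lambda>n. c n * y ^ n)"
  shows "smooth_family X UNIV (\<lambda>_ x. \<Sum>n. c n * x ^ n)"
proof -
  have "C_family m X UNIV (\<lambda>_ x. \<Sum>n. c n * x ^ n)" for m
    using assms
  proof (induction m arbitrary: c)
    case 0
    have "isCont (\<lambda>x. \<Sum>n. c n * x ^ n) x" for x
      using termdiffs_strong_converges_everywhere[OF 0] by (rule DERIV_isCont)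
    then show ?case by (simp add: jointly_continuous_no_param continuous_at_imp_continuous_on)
  next
    case (Suc m)
    have D: "((\<lambda>x. \<Sum>n. c n * x ^ n) has_field_derivative (\<Sum>n. diffs c n * x ^ n)) (at x)" for x
      by (rule termdiffs_strong_converges_everywhere[OF Suc.prems])
    have jc: "jointly_continuous X UNIV (\<lambda>_ x. \<Sum>n. c n * x ^ n)"
      by (intro jointly_continuous_no_param continuous_at_imp_continuous_on ballI DERIV_isCont[OF D])
    show ?case
    proof (rule C_family_SucI[OF jc])
      show "((\<lambda>x. \<Sum>n. c n * x ^ n) has_derivative (\<lambda>h. (\<Sum>n. diffs c n * x ^ n) * h)) (at x)" for x
        using D unfolding has_field_derivative_def by simp
      show "C_family m X UNIV (\<lambda>p x. (\<Sum>n. diffs c n * x ^ n) * h)" for h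
        by (intro C_family_bilinear[OF bounded_bilinear_mult] Suc.IH termdiff_converges_all Suc.prems C_family_const)
    qed
  qed
  then show ?thesis by (simp add: smooth_family_def)
qed

text \<open>\<open>cos \<circ> sqrt\<close> and \<open>sin \<circ> sqrt / sqrt\<close> as entire functions of one variable.\<close>

definition cos_root :: "real \<Rightarrow> real" where
  "cos_root s = (\<Sum>n. ((-1) ^ n / fact (2 * n)) * s ^ n)"

definition sinc_root :: "real \<Rightarrow> real" where
  "sinc_root s = (\<Sum>n. ((-1) ^ n / fact (2 * n + 1)) * s ^ n)"

lemma summable_cos_sinc_root:
  fixes y :: real
  shows "summable (\<lambda>n. ((-1) ^ n / fact (2 * n)) * y ^ n)" "summable (\<lambda>n. ((-1) ^ n / fact (2 * n + 1)) * y ^ n)"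
proof -
  have *: "summable (\<lambda>n. ((-1) ^ n / fact (k n)) * y ^ n)" if "\<And>n. n \<le> k n" for k :: "nat \<Rightarrow> nat"
  proof (rule summable_comparison_test'[OF summable_exp[of "\<bar>y\<bar>"], of 0])
    fix n :: nat
    have "inverse (fact (k n)) \<le> (inverse (fact n) :: real)"
      by (intro le_imp_inverse_le fact_mono that) auto
    then show "norm (((-1) ^ n / fact (k n)) * y ^ n) \<le> inverse (fact n) * \<bar>y\<bar> ^ n"
      by (auto simp: abs_mult power_abs divide_inverse intro!: mult_right_mono)
  qed
  show "summable (\<lambda>n. ((-1) ^ n / fact (2 * n)) * y ^ n)" by (rule *) simp
  show "summable (\<lambda>n. ((-1) ^ n / fact (2 * n + 1)) * y ^ n)" by (rule *) simp
qed

lemma smooth_family_cos_root: "smooth_family X UNIV (\<lambda>_. cos_root)"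
  unfolding cos_root_def[abs_def] by (rule smooth_family_power_series[OF summable_cos_sinc_root(1)])

lemma smooth_family_sinc_root: "smooth_family X UNIV (\<lambda>_. sinc_root)"
  unfolding sinc_root_def[abs_def] by (rule smooth_family_power_series[OF summable_cos_sinc_root(2)])

lemma cos_root_square: "cos_root (r\<^sup>2) = cos r"
  using sums_unique[OF cos_paired[of r]] by (simp add: cos_root_def power_mult)

lemma sinc_root_square: "r * sinc_root (r\<^sup>2) = sin r"
proof -
  have "r * sinc_root (r\<^sup>2) = (\<Sum>n. r * (((-1) ^ n / fact (2 * n + 1)) * (r\<^sup>2) ^ n))"
    unfolding sinc_root_def by (rule suminf_mult[symmetric, OF summable_cos_sinc_root(2)])
  also have "\<dots> = (\<Sum>n. (- 1) ^ n / (fact (2 * n + 1)) * r ^ (2 * n + 1))"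
  proof -
    have "r * (((-1) ^ n / fact (2 * n + 1)) * (r\<^sup>2) ^ n) = (- 1) ^ n / (fact (2 * n + 1)) * r ^ (2 * n + 1)" for n
      by (simp only: power_mult[symmetric] power_add power_one_right mult_ac)
    then show ?thesis by (simp only:)
  qed
  also have "\<dots> = sin r" using sums_unique[OF sin_paired[of r]] by simp
  finally show ?thesis .
qed

lemma cos_sinc_root_identity: "s \<ge> 0 \<Longrightarrow> (cos_root s)\<^sup>2 + s * (sinc_root s)\<^sup>2 = 1"
  using cos_root_square[of "sqrt s"] sinc_root_square[of "sqrt s"] sin_cos_squared_add2[of "sqrt s"]
  by (metis power_mult_distrib real_sqrt_pow2)

text \<open>The chain rule for cos (sqrt s), read off from the coefficients so that it holds for s
  \<le> 0 as well.\<close>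

lemma DERIV_cos_root: "(cos_root has_field_derivative - (sinc_root s / 2)) (at s)"
proof -
  have "diffs (\<lambda>n. (-1) ^ n / fact (2 * n)) n = (- 1 / 2) * ((-1) ^ n / fact (2 * n + 1) :: real)" for n
  proof -
    have "diffs (\<lambda>n. (-1) ^ n / fact (2 * n)) n = - (real (Suc n) * ((-1) ^ n / (real (2 * Suc n) * fact (2 * n + 1))))"
      by (simp add: diffs_def)
    also have "\<dots> = (- 1 / 2) * ((-1) ^ n / fact (2 * n + 1))"
      by (simp add: field_simps del: fact_Suc of_nat_Suc) (simp add: algebra_simps)
    finally show ?thesis .
  qed
  then have "(\<Sum>n. diffs (\<lambda>n. (-1) ^ n / fact (2 * n)) n * s ^ n) = (\<Sum>n. (- 1 / 2) * (((-1) ^ n / fact (2 * n + 1)) * s ^ n))"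
    by (simp only: mult.assoc)
  also have "\<dots> = (- 1 / 2) * sinc_root s"
    unfolding sinc_root_def by (rule suminf_mult[OF summable_cos_sinc_root(2)])
  finally have "(\<Sum>n. diffs (\<lambda>n. (-1) ^ n / fact (2 * n)) n * s ^ n) = - (sinc_root s / 2)" by simp
  then show ?thesis
    using termdiffs_strong_converges_everywhere[OF summable_cos_sinc_root(1), of s] unfolding cos_root_def[abs_def] by simp
qed

lemma sinc_root_pos:
  assumes "s < pi\<^sup>2" shows "sinc_root s > 0"
proof (cases "s > 0")
  case True
  have "sqrt s < pi" using assms by (simp add: real_less_lsqrt)
  then have "sin (sqrt s) > 0" using True by (intro sin_gt_zero) auto
  then show ?thesis using sinc_root_square[of "sqrt s"] True by (metis less_eq_real_def real_sqrt_gt_zero real_sqrt_pow2 zero_less_mult_pos)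
next
  case False
  \<comment> \<open>For s \<le> 0 all terms of the series are nonnegative, and the term with n = 0
    is 1.\<close>
  have eq: "((-1) ^ n / fact (2 * n + 1)) * s ^ n = (- s) ^ n / fact (2 * n + 1)" for n
    by (simp flip: power_mult_distrib)
  show ?thesis unfolding sinc_root_def
    by (rule suminf_pos2[OF summable_cos_sinc_root(2), of _ 0]) (unfold eq, use False in auto)
qed

lemma cos_root_decreasing:
  assumes "s < t" "t \<le> pi\<^sup>2" shows "cos_root t < cos_root s"
proof (rule DERIV_neg_imp_decreasing_open[OF assms(1)])
  show "\<exists>y. (cos_root has_field_derivative y) (at x) \<and> y < 0" if "s < x" "x < t" for x
    using DERIV_cos_root[of x] sinc_root_pos[of x] that assms by (intro exI[of _ "- (sinc_root x / 2)"]) auto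
  show "continuous_on {s..t} cos_root"
    by (intro continuous_at_imp_continuous_on ballI DERIV_isCont[OF DERIV_cos_root])
qed

lemma cos_root_0: "cos_root 0 = 1" and cos_root_pi: "cos_root (pi\<^sup>2) = - 1"
  using cos_root_square[of 0] cos_root_square[of pi] by simp_all

text \<open>The square of arccos, continued past the value 1. Admitting s down to -1 makes s = 0 an
  interior point, so the logarithm becomes smooth at the diagonal, where arccos itself is not
  differentiable.\<close>

definition arccos_square :: "real \<Rightarrow> real" where
  "arccos_square c = (SOME s. s \<in> {-1<..<pi\<^sup>2} \<and> cos_root s = c)"

text \<open>The left end is cos \<pi>, the value of \<open>cos_root\<close> at pi^2. The right end
  is the hyperbolic cosine of 1, which exceeds 1.\<close>

abbreviation arccos_square_dom :: "real set" where
  "arccos_square_dom \<equiv> {-1<..<cos_root (-1)}"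

lemma arccos_square:
  assumes "c \<in> arccos_square_dom"
  shows "arccos_square c \<in> {-1<..<pi\<^sup>2}" "cos_root (arccos_square c) = c"
proof -
  have "\<exists>s\<ge>-1. s \<le> pi\<^sup>2 \<and> cos_root s = c"
    by (rule IVT2)
      (use assms cos_root_pi DERIV_isCont[OF DERIV_cos_root] order_trans[of "-1" 0 "pi\<^sup>2"] in auto)
  then obtain s where "s \<ge> -1" "s \<le> pi\<^sup>2" "cos_root s = c" by blast
  moreover from this have "s \<noteq> -1" "s \<noteq> pi\<^sup>2" using assms cos_root_pi by auto
  ultimately have "s \<in> {-1<..<pi\<^sup>2} \<and> cos_root s = c" by auto
  then have "arccos_square c \<in> {-1<..<pi\<^sup>2} \<and> cos_root (arccos_square c) = c"
    unfolding arccos_square_def by (rule someI)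
  then show "arccos_square c \<in> {-1<..<pi\<^sup>2}" "cos_root (arccos_square c) = c" by auto
qed

lemma cos_root_in_dom: "s \<in> {-1<..<pi\<^sup>2} \<Longrightarrow> cos_root s \<in> arccos_square_dom"
  using cos_root_decreasing[of "-1" s] cos_root_decreasing[of s "pi\<^sup>2"] cos_root_pi by auto

lemma arccos_square_cos_root:
  assumes "s \<in> {-1<..<pi\<^sup>2}" shows "arccos_square (cos_root s) = s"
proof -
  note a = arccos_square[OF cos_root_in_dom[OF assms]]
  show ?thesis
    using cos_root_decreasing[of s "arccos_square (cos_root s)"] cos_root_decreasing[of "arccos_square (cos_root s)" s] a assms
    by (cases s "arccos_square (cos_root s)" rule: linorder_cases) auto
qed

lemma DERIV_arccos_square:
  assumes c: "c \<in> arccos_square_dom"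
  shows "(arccos_square has_field_derivative inverse (- (sinc_root (arccos_square c) / 2))) (at c)"
proof (rule DERIV_inverse_function[where f = cos_root and g = arccos_square and a = "-1" and b = "cos_root (-1)", OF DERIV_cos_root])
  let ?s = "arccos_square c"
  note s = arccos_square[OF c]
  \<comment> \<open>Midpoints between s and the two ends of the interval (-1, pi^2), bounding a
    closed interval around s on which \<open>arccos_square\<close> inverts
    \<open>cos_root\<close>.\<close>
  define a b where "a = (?s - 1) / 2" and "b = (?s + pi\<^sup>2) / 2"
  have ab: "-1 < a" "a < ?s" "?s < b" "b < pi\<^sup>2" using s by (auto simp: a_def b_def field_simps)
  have "isCont arccos_square (cos_root ?s)"
    by (rule isCont_inverse_function2[OF ab(2,3)])
      (use ab arccos_square_cos_root DERIV_isCont[OF DERIV_cos_root] in auto)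
  then show "isCont arccos_square c" using s by simp
  show "- (sinc_root ?s / 2) \<noteq> 0" using sinc_root_pos[of ?s] s by auto
qed (use c arccos_square in auto)

text \<open>The derivative is a smooth function of \<open>arccos_square\<close> itself, so class n
  implies class n + 1.\<close>

lemma smooth_family_arccos_square: "smooth_family X arccos_square_dom (\<lambda>_. arccos_square)"
proof -
  have inv: "smooth_family X {-1<..<pi\<^sup>2} (\<lambda>_ s. inverse (- (sinc_root s / 2)))"
  proof (rule smooth_family_inverse)
    have "smooth_family X {-1<..<pi\<^sup>2} (\<lambda>_ s. - (sinc_root s * (1/2)))"
      by (intro smooth_family_minus smooth_family_mult smooth_family_const smooth_family_subset[OF smooth_family_sinc_root]) auto
    then show "smooth_family X {-1<..<pi\<^sup>2} (\<lambda>_ s. - (sinc_root s / 2))" by simp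
    show "- (sinc_root s / 2) \<noteq> 0" if "s \<in> {-1<..<pi\<^sup>2}" for s using sinc_root_pos[of s] that by auto
  qed auto
  have jc: "jointly_continuous X arccos_square_dom (\<lambda>_. arccos_square)"
    by (intro jointly_continuous_no_param continuous_at_imp_continuous_on ballI DERIV_isCont[OF DERIV_arccos_square])
  have "C_family n X arccos_square_dom (\<lambda>_. arccos_square)" for n
  proof (induction n)
    case 0 then show ?case using jc by simp
  next
    case (Suc n)
    show ?case
    proof (rule C_family_SucI[OF jc])
      show "(arccos_square has_derivative (\<lambda>h. inverse (- (sinc_root (arccos_square c) / 2)) * h)) (at c)"
        if "c \<in> arccos_square_dom" for c
        using DERIV_arccos_square[OF that] unfolding has_field_derivative_def .
      show "C_family n X arccos_square_dom (\<lambda>p c. inverse (- (sinc_root (arccos_square c) / 2)) * h)" for h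
        by (intro C_family_bilinear[OF bounded_bilinear_mult] C_family_const
             C_family_compose[OF smooth_familyD[OF inv] Suc]) (use arccos_square(1) in auto)
    qed
  qed
  then show ?thesis by (simp add: smooth_family_def)
qed

section \<open>The exponential map of the sphere and its inverse\<close>

definition exp_map :: "(real^4) \<times> (real^4) \<Rightarrow> real^4" where
  "exp_map z = cos_root (snd z \<bullet> snd z) *\<^sub>R fst z + sinc_root (snd z \<bullet> snd z) *\<^sub>R snd z"

text \<open>If y = cos r x + (sin r / r) v with r = |v|, then x . y = cos r. Solving for v leaves
  the factor sin r / r, which is \<open>sinc_root\<close> at r^2.\<close>

definition log_map :: "(real^4) \<times> (real^4) \<Rightarrow> real^4" where
  "log_map z = inverse (sinc_root (arccos_square (fst z \<bullet> snd z))) *\<^sub>R (snd z - (fst z \<bullet> snd z) *\<^sub>R fst z)"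

definition exp_dom :: "((real^4) \<times> (real^4)) set" where
  "exp_dom = {z. snd z \<bullet> snd z < pi\<^sup>2}"

text \<open>For points of the sphere this says that y is not antipodal to x, since x . y \<le> 1 is
  always below the right end.\<close>

definition log_dom :: "((real^4) \<times> (real^4)) set" where
  "log_dom = {z. fst z \<bullet> snd z \<in> arccos_square_dom}"

text \<open>Formulas in v . v avoid the norm, which is not smooth at v = 0. The default value of
  division by 0 is harmless, as it multiplies v = 0.\<close>

lemma exp_map_eq_sphere_exp: "exp_map (x, v) = sphere_exp x v"
proof -
  have "sinc_root (v \<bullet> v) *\<^sub>R v = (sin (norm v) / norm v) *\<^sub>R v"
    using sinc_root_square[of "norm v"] by (cases "v = 0") (auto simp: power2_norm_eq_inner field_simps)
  then show ?thesis using cos_root_square[of "norm v"] by (simp add: exp_map_def sphere_exp_def power2_norm_eq_inner)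
qed

lemma smooth_family_fst_ident: "smooth_family X U (\<lambda>_. fst)"
  by (rule smooth_family_no_param_linear[OF bounded_linear_fst])

lemma smooth_family_snd_ident: "smooth_family X U (\<lambda>_. snd)"
  by (rule smooth_family_no_param_linear[OF bounded_linear_snd])

lemma S3_inner: "x \<in> S3 \<longleftrightarrow> x \<bullet> x = 1"
  by (simp add: norm_eq_1)

interpretation std: local_addition exp_map log_map exp_dom log_dom
proof
  show oE: "open exp_dom" unfolding exp_dom_def by (intro open_Collect_less continuous_intros)
  show oL: "open log_dom"
    unfolding log_dom_def greaterThanLessThan_iff by (intro open_Collect_conj open_Collect_less continuous_intros)
  have "smooth_family (discrete_topology {()}) exp_dom (\<lambda>_. exp_map)"
    unfolding exp_map_def[abs_def]
    by (intro smooth_family_add smooth_family_scaleR smooth_family_compose[OF smooth_family_cos_root]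
         smooth_family_compose[OF smooth_family_sinc_root] smooth_family_inner smooth_family_fst_ident smooth_family_snd_ident oE) auto
  then show "smooth_on exp_dom exp_map" by (simp add: smooth_on_iff_smooth_family[OF oE])
  have ac: "smooth_family (discrete_topology {()}) log_dom (\<lambda>_ z. arccos_square (fst z \<bullet> snd z))"
    by (intro smooth_family_compose[OF smooth_family_arccos_square] smooth_family_inner smooth_family_fst_ident smooth_family_snd_ident oL)
      (auto simp: log_dom_def)
  have "sinc_root (arccos_square (fst z \<bullet> snd z)) \<noteq> 0" if "z \<in> log_dom" for z
    using sinc_root_pos arccos_square(1)[of "fst z \<bullet> snd z"] that by (fastforce simp: log_dom_def)
  then have "smooth_family (discrete_topology {()}) log_dom (\<lambda>_. log_map)"
    unfolding log_map_def[abs_def]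
    by (intro smooth_family_scaleR smooth_family_diff smooth_family_inverse smooth_family_compose[OF smooth_family_sinc_root ac]
         smooth_family_inner smooth_family_fst_ident smooth_family_snd_ident oL) auto
  then show "smooth_on log_dom log_map" by (simp add: smooth_on_iff_smooth_family[OF oL])
next
  fix x v :: "real^4" assume x: "x \<in> S3" and vx: "v \<bullet> x = 0" and v: "(x, v) \<in> exp_dom"
  define s where "s = v \<bullet> v"
  have s: "0 \<le> s" "s < pi\<^sup>2" "s \<in> {-1<..<pi\<^sup>2}" using v by (auto simp: s_def exp_dom_def intro: less_le_trans[of _ 0])
  have xx: "x \<bullet> x = 1" using x by (simp only: S3_inner)
  have xE: "x \<bullet> exp_map (x, v) = cos_root s"
    using vx xx by (simp add: exp_map_def s_def inner_add_right inner_commute)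
  have "exp_map (x, v) \<bullet> exp_map (x, v) = (cos_root s)\<^sup>2 + s * (sinc_root s)\<^sup>2"
    using vx xx by (simp add: exp_map_def s_def inner_add_right inner_add_left inner_commute power2_eq_square mult_ac)
  then have "exp_map (x, v) \<in> S3" using cos_sinc_root_identity[OF s(1)] by (simp only: S3_inner)
  moreover have "(x, exp_map (x, v)) \<in> log_dom"
    using cos_root_in_dom[OF s(3)] xE by (simp add: log_dom_def)
  moreover have "log_map (x, exp_map (x, v)) = v"
    using sinc_root_pos[OF s(2)] unfolding log_map_def fst_conv snd_conv xE arccos_square_cos_root[OF s(3)]
    by (simp add: exp_map_def s_def)
  ultimately show "exp_map (x, v) \<in> S3 \<and> (x, exp_map (x, v)) \<in> log_dom \<and> log_map (x, exp_map (x, v)) = v" by blast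
next
  fix x y :: "real^4" assume x: "x \<in> S3" and y: "y \<in> S3" and xy: "(x, y) \<in> log_dom"
  define c s where "c = x \<bullet> y" and "s = arccos_square c"
  have xx: "x \<bullet> x = 1" "y \<bullet> y = 1" using x y by (simp_all only: S3_inner)
  have c: "c \<in> arccos_square_dom" using xy by (simp add: log_dom_def c_def)
  have s: "s \<in> {-1<..<pi\<^sup>2}" "cos_root s = c" using arccos_square[OF c] by (simp_all add: s_def)
  have S: "sinc_root s > 0" using sinc_root_pos s by simp
  \<comment> \<open>This places \<open>arccos_square c\<close> in the range s \<ge> 0, where cos^2 +
    s sinc^2 = 1 is available.\<close>
  have "c \<le> 1" using norm_cauchy_schwarz[of x y] x y by (simp add: c_def)
  then have s0: "s \<ge> 0" using cos_root_decreasing[of s 0] s(2) cos_root_0 by (force simp: not_le)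
  have L: "log_map (x, y) = inverse (sinc_root s) *\<^sub>R (y - c *\<^sub>R x)" by (simp add: log_map_def c_def s_def)
  have "log_map (x, y) \<bullet> x = 0" unfolding L inner_scaleR_left using xx by (simp add: c_def inner_diff_left inner_commute[of y x])
  moreover have LL: "log_map (x, y) \<bullet> log_map (x, y) = s"
  proof -
    have "(y - c *\<^sub>R x) \<bullet> (y - c *\<^sub>R x) = 1 - c\<^sup>2"
      using xx by (simp add: inner_diff_left inner_diff_right c_def inner_commute power2_eq_square)
    also have "\<dots> = s * (sinc_root s)\<^sup>2" using cos_sinc_root_identity[OF s0] s(2) by simp
    finally have *: "(y - c *\<^sub>R x) \<bullet> (y - c *\<^sub>R x) = s * (sinc_root s)\<^sup>2" .
    show ?thesis unfolding L inner_scaleR_left inner_scaleR_right * using S by (simp add: power2_eq_square field_simps)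
  qed
  moreover have "exp_map (x, log_map (x, y)) = y"
    unfolding exp_map_def snd_conv LL fst_conv s(2) using S by (simp add: L)
  ultimately show "log_map (x, y) \<bullet> x = 0 \<and> (x, log_map (x, y)) \<in> exp_dom \<and> exp_map (x, log_map (x, y)) = y"
    using s by (simp add: exp_dom_def)
qed

section \<open>Identification with the given atlas\<close>

lemma exp_field_eq_chart_param:
  "f \<in> Diff \<Longrightarrow> Diff_parametrization f V = std.chart_param f V"
  using Diff_D(4) by (auto simp: Diff_parametrization_def compose_S3_def exp_field_def std.chart_param_def exp_map_eq_sphere_exp fun_eq_iff)

text \<open>\<open>exp_domain\<close> refers to the chart at the identity. As \<open>Diff\<close> is
  a group, composing with f does not affect membership in it.\<close>

lemma exp_domain_eq_chart_range:
  assumes f: "f \<in> Diff" shows "exp_domain = std.chart_range f"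
proof -
  have "exp_field V \<in> Diff \<longleftrightarrow> Diff_parametrization f V \<in> Diff" for V
  proof
    assume "Diff_parametrization f V \<in> Diff"
    from compose_S3_Diff[OF this inv_S3_Diff[OF f]]
    have "compose_S3 (compose_S3 (exp_field V) f) (inv_S3 f) \<in> Diff" by (simp add: Diff_parametrization_def)
    moreover have "compose_S3 (compose_S3 (exp_field V) f) (inv_S3 f) = exp_field V"
      using inv_S3(1,2)[OF f] by (auto simp: compose_S3_def exp_field_def fun_eq_iff)
    ultimately show "exp_field V \<in> Diff" by simp
  qed (simp add: Diff_parametrization_def compose_S3_Diff f)
  moreover have "norm v < pi \<longleftrightarrow> (x, v) \<in> exp_dom" for x v :: "real^4"
    using power_strict_mono[of "norm v" pi 2] power2_less_imp_less[of "norm v" pi]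
    by (auto simp: exp_dom_def power2_norm_eq_inner)
  ultimately show ?thesis
    unfolding exp_domain_def std.chart_range_def exp_field_eq_chart_param[OF f, symmetric] by blast
qed

lemma std_chart:
  assumes f: "f \<in> Diff"
  shows "Diff_parametrization f ` exp_domain = std.chart_dom f"
    and "g \<in> std.chart_dom f \<Longrightarrow> inv_into exp_domain (Diff_parametrization f) g = std.chart_log f g"
proof -
  have eq: "Diff_parametrization f = std.chart_param f" using exp_field_eq_chart_param[OF f] by blast
  show "Diff_parametrization f ` exp_domain = std.chart_dom f"
    unfolding eq exp_domain_eq_chart_range[OF f]
  proof (intro equalityI subsetI)
    show "g \<in> std.chart_param f ` std.chart_range f" if "g \<in> std.chart_dom f" for g
      using std.chart_log_in_range[OF f that] by (metis imageI)
  qed (use std.chart_param_in_dom[OF f] in auto)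
  assume g: "g \<in> std.chart_dom f"
  show "inv_into exp_domain (Diff_parametrization f) g = std.chart_log f g"
    unfolding eq exp_domain_eq_chart_range[OF f]
  proof (rule inv_into_f_eq)
    show "inj_on (std.chart_param f) (std.chart_range f)"
      by (rule inj_on_inverseI[of _ "std.chart_log f"]) (rule std.chart_param_in_dom(1)[OF f])
  qed (use std.chart_log_in_range[OF f g] in auto)
qed

lemma Diff_atlasE:
  assumes "(U, \<phi>) \<in> Diff_atlas"
  obtains f where "f \<in> Diff" "U = std.chart_dom f" "\<And>g. g \<in> std.chart_dom f \<Longrightarrow> \<phi> g = std.chart_log f g"
proof -
  obtain f where f: "f \<in> Diff" "U = Diff_parametrization f ` exp_domain" "\<phi> = inv_into exp_domain (Diff_parametrization f)"
    using assms unfolding Diff_atlas_def by blast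
  show ?thesis by (rule that[OF f(1)]) (use f std_chart[OF f(1)] in auto)
qed

lemma frechet_manifold_Diff: "frechet_manifold Diff_topology VF_topology Diff_atlas"
  unfolding frechet_manifold_def
proof (intro conjI Hausdorff_Diff_topology frechet_space_VF)
  show "\<forall>(U, \<phi>)\<in>Diff_atlas. chart Diff_topology VF_topology U \<phi>"
  proof clarify
    fix U \<phi> assume "(U, \<phi>) \<in> Diff_atlas"
    then obtain f where "f \<in> Diff" "U = std.chart_dom f" "\<And>g. g \<in> std.chart_dom f \<Longrightarrow> \<phi> g = std.chart_log f g"
      by (rule Diff_atlasE) (rule that)
    then show "chart Diff_topology VF_topology U \<phi>" using std.chart_chart_log by blast
  qed
  have "f \<in> std.chart_dom f" if "f \<in> Diff" for f
  proof -
    have "f x \<bullet> f x = 1" if "x \<in> S3" for x using Diff_D(4)[OF \<open>f \<in> Diff\<close> that] by (simp only: S3_inner)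
    moreover have "1 \<in> arccos_square_dom" using cos_root_in_dom[of 0] cos_root_0 by simp
    ultimately show ?thesis using that unfolding std.chart_dom_def by (simp add: log_dom_def)
  qed
  then have "f \<in> (\<Union>(U, \<phi>)\<in>Diff_atlas. U)" if "f \<in> Diff" for f
    using that std_chart(1)[OF that] unfolding Diff_atlas_def by fastforce
  moreover have "U \<subseteq> Diff" if "(U, \<phi>) \<in> Diff_atlas" for U \<phi>
    using that by (rule Diff_atlasE) (auto simp: std.chart_dom_def)
  ultimately show "(\<Union>(U, \<phi>)\<in>Diff_atlas. U) = topspace Diff_topology" by fastforce
  show "\<forall>(U, \<phi>)\<in>Diff_atlas. \<forall>(V, \<psi>)\<in>Diff_atlas. charts_compatible VF_topology U \<phi> VF_topology V \<psi>"
  proof clarify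
    fix U \<phi> V \<psi> assume "(U, \<phi>) \<in> Diff_atlas"
    then obtain f where f: "f \<in> Diff" "U = std.chart_dom f" "\<And>g. g \<in> std.chart_dom f \<Longrightarrow> \<phi> g = std.chart_log f g"
      by (rule Diff_atlasE) (rule that)
    assume "(V, \<psi>) \<in> Diff_atlas"
    then obtain h where h: "h \<in> Diff" "V = std.chart_dom h" "\<And>g. g \<in> std.chart_dom h \<Longrightarrow> \<psi> g = std.chart_log h g"
      by (rule Diff_atlasE) (rule that)
    have "two_local_additions exp_map log_map exp_dom log_dom exp_map log_map exp_dom log_dom" ..
    from charts_compatible_local_additions[OF this f(1) h(1) f(3) h(3)]
    show "charts_compatible VF_topology U \<phi> VF_topology V \<psi>" using f(2) h(2) by simp
  qed
qed

section \<open>Hopf fibrations\<close>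

lemma Cinf_continuous_on:
  assumes "f \<in> Cinf" shows "continuous_on S3 (radial_ext f)"
proof -
  have "continuous_on (- {0}) (radial_ext f)"
    using jointly_continuous_at_param[OF smooth_family_jcont[OF CinfD[OF assms, of "discrete_topology {()}"]], of "()"] by simp
  then show ?thesis by (rule continuous_on_subset) auto
qed

locale hopf =
  fixes J :: "real^4 \<Rightarrow> real^4"
  assumes ocs: "orthogonal_complex_structure J"
begin

lemma linear_J: "linear J" and J_inner: "J u \<bullet> J v = u \<bullet> v" and JJ: "J (J v) = - v"
  using ocs by (auto simp: orthogonal_complex_structure_def orthogonal_transformation_def)

lemma bounded_linear_J: "bounded_linear J"
  using linear_J by (rule linear_conv_bounded_linear[THEN iffD1])

lemmas J_linear = linear_add[OF linear_J] linear_diff[OF linear_J] linear_scale[OF linear_J] linear_neg[OF linear_J] linear_0[OF linear_J]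

lemma J_skew: "u \<bullet> J v = - (J u \<bullet> v)"
  using J_inner[of "J u" v] by (simp add: JJ)

lemma J_self: "v \<bullet> J v = 0" "J v \<bullet> v = 0"
  using J_skew[of v v] by (simp_all add: inner_commute)

definition cmul :: "complex \<Rightarrow> real^4 \<Rightarrow> real^4" where
  "cmul z v = Re z *\<^sub>R v + Im z *\<^sub>R J v"

lemma cmul_cmul: "cmul z (cmul w v) = cmul (z * w) v"
  by (simp add: cmul_def J_linear JJ algebra_simps)

lemma cmul_1 [simp]: "cmul 1 v = v" by (simp add: cmul_def)

lemma cmul_linear: "cmul z (u + v) = cmul z u + cmul z v" "cmul z (u - v) = cmul z u - cmul z v"
   "cmul z (c *\<^sub>R v) = c *\<^sub>R cmul z v" "cmul z 0 = 0" "cmul (of_real c * z) v = c *\<^sub>R cmul z v"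
  by (simp_all add: cmul_def J_linear algebra_simps)

lemma bounded_linear_cmul: "bounded_linear (cmul z)"
  unfolding cmul_def by (intro bounded_linear_add bounded_linear_scaleR_right bounded_linear_J
      bounded_linear_compose[OF bounded_linear_scaleR_right bounded_linear_J])

lemma cmul_J: "cmul z (J v) = J (cmul z v)"
  by (simp add: cmul_def J_linear)

lemma cmul_inner_cmul: "cmul z u \<bullet> cmul z v = (cmod z)\<^sup>2 * (u \<bullet> v)"
proof -
  have "cmul z u \<bullet> cmul z v = ((Re z)\<^sup>2 + (Im z)\<^sup>2) * (u \<bullet> v)"
    unfolding cmul_def
    by (simp add: inner_add_left inner_add_right J_inner J_skew[of u v] algebra_simps power2_eq_square)
  then show ?thesis by (simp only: cmod_power2)
qed

lemma norm_cmul: "norm (cmul z v) = cmod z * norm v"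
proof (rule power2_eq_imp_eq)
  show "(norm (cmul z v))\<^sup>2 = (cmod z * norm v)\<^sup>2"
    unfolding power_mult_distrib power2_norm_eq_inner cmul_inner_cmul ..
qed auto

lemma cmul_cancel:
  assumes "z \<noteq> 0" "cmul z u = cmul z v" shows "u = v"
proof -
  have "cmul (inverse z) (cmul z u) = cmul (inverse z) (cmul z v)" by (simp only: assms(2))
  then show ?thesis unfolding cmul_cmul left_inverse[OF assms(1)] cmul_1 .
qed

definition rot :: "real \<Rightarrow> real^4 \<Rightarrow> real^4" where
  "rot t = cmul (cis t)"

lemma rot_rot: "rot s (rot t v) = rot (s + t) v"
  by (simp add: rot_def cmul_cmul cis_mult)

lemma rot_0 [simp]: "rot 0 v = v" by (simp add: rot_def)

lemma rot_2pi [simp]: "rot (2 * pi) v = v" by (simp add: rot_def)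

lemma norm_rot [simp]: "norm (rot t v) = norm v" by (simp add: rot_def norm_cmul)

lemma rot_S3: "x \<in> S3 \<Longrightarrow> rot t x \<in> S3" by simp

lemma rot_inner: "rot t u \<bullet> rot t v = u \<bullet> v" by (simp add: rot_def cmul_inner_cmul)

lemma rot_J: "rot t (J v) = J (rot t v)" by (simp add: rot_def cmul_J)

lemma rot_eq: "rot t v = cos t *\<^sub>R v + sin t *\<^sub>R J v" by (simp add: rot_def cmul_def)

lemma bounded_linear_rot: "bounded_linear (rot t)" unfolding rot_def by (rule bounded_linear_cmul)

lemma rot_linear: "rot t (u + v) = rot t u + rot t v" "rot t (u - v) = rot t u - rot t v"
   "rot t (c *\<^sub>R v) = c *\<^sub>R rot t v" "rot t 0 = 0"
  by (simp_all add: rot_def cmul_linear)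

text \<open>Reducing the angle to one period lets the shift in the circle average lie in
  [0, 1].\<close>

lemma rot_representative:
  obtains t' where "0 \<le> t'" "t' < 2 * pi" "\<And>v. rot t v = rot t' v"
proof -
  obtain t' where "0 \<le> t'" "t' < 2 * pi" "cos t = cos t'" "sin t = sin t'"
    using sincos_total_2pi[of "cos t" "sin t"] by auto
  then show ?thesis by (intro that[of t']) (auto simp: rot_eq)
qed

definition circle :: "real^4 \<Rightarrow> (real^4) set" where
  "circle x = range (\<lambda>t. rot t x)"

lemma circle_self: "x \<in> circle x" unfolding circle_def by (rule range_eqI[of _ _ 0]) simp

lemma circle_subset_S3: "x \<in> S3 \<Longrightarrow> circle x \<subseteq> S3" by (auto simp: circle_def)

lemma circle_eq: "y \<in> circle x \<Longrightarrow> circle y = circle x"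
proof -
  assume "y \<in> circle x"
  then obtain t where t: "y = rot t x" by (auto simp: circle_def)
  show ?thesis unfolding circle_def
  proof (intro equalityI subsetI)
    show "z \<in> range (\<lambda>s. rot s x)" if "z \<in> range (\<lambda>s. rot s y)" for z
      using that by (auto simp: t rot_rot)
    fix z assume "z \<in> range (\<lambda>s. rot s x)"
    then obtain s where "z = rot s x" by blast
    then have "z = rot (s - t) y" by (simp add: t rot_rot)
    then show "z \<in> range (\<lambda>s. rot s y)" by blast
  qed
qed

text \<open>For a unit vector u this is the component of v orthogonal to the complex line of u. It
  turns membership in a fiber into an equation, hence into a closed condition.\<close>

definition line_defect :: "real^4 \<Rightarrow> real^4 \<Rightarrow> real^4" where
  "line_defect u v = v - (v \<bullet> u) *\<^sub>R u - (v \<bullet> J u) *\<^sub>R J u"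

lemma circle_iff_line_defect:
  assumes "u \<in> S3" "v \<in> S3" shows "v \<in> circle u \<longleftrightarrow> line_defect u v = 0"
proof
  have u: "u \<bullet> u = 1" "J u \<bullet> J u = 1" using assms(1) by (simp_all only: S3_inner J_inner)
  show "line_defect u v = 0" if "v \<in> circle u"
  proof -
    obtain t where t: "v = cos t *\<^sub>R u + sin t *\<^sub>R J u" using \<open>v \<in> circle u\<close> by (auto simp: circle_def rot_eq)
    then show ?thesis using u J_self[of u] by (simp add: line_defect_def inner_add_left)
  qed
  assume "line_defect u v = 0"
  then have v: "v = (v \<bullet> u) *\<^sub>R u + (v \<bullet> J u) *\<^sub>R J u" by (simp add: line_defect_def algebra_simps)
  define \<alpha> \<beta> where "\<alpha> = v \<bullet> u" and "\<beta> = v \<bullet> J u"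
  have v': "v = \<alpha> *\<^sub>R u + \<beta> *\<^sub>R J u" using v by (simp add: \<alpha>_def \<beta>_def)
  have "v \<bullet> v = \<alpha>\<^sup>2 + \<beta>\<^sup>2" unfolding v' using u J_self[of u]
    by (simp add: inner_add_left inner_add_right power2_eq_square)
  then have "\<alpha>\<^sup>2 + \<beta>\<^sup>2 = 1" using assms(2) by (simp only: S3_inner)
  then obtain t where "\<alpha> = cos t" "\<beta> = sin t" using sincos_total_2pi by blast
  then show "v \<in> circle u" unfolding circle_def using v' by (auto simp: rot_eq)
qed

lemma sphere_Int_complex_line:
  assumes "v \<noteq> 0" shows "S3 \<inter> span {v, J v} = circle (v /\<^sub>R norm v)"
proof -
  define u where "u = v /\<^sub>R norm v"
  have u: "u \<in> S3" "v = norm v *\<^sub>R u" using assms by (simp_all add: u_def)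
  have Ju: "J v = norm v *\<^sub>R J u" by (subst u(2)) (simp only: J_linear)
  have uu: "u \<bullet> u = 1" "J u \<bullet> J u = 1" using u(1) by (simp_all only: S3_inner J_inner)
  show ?thesis unfolding u_def[symmetric]
  proof (intro equalityI subsetI)
    fix x assume x: "x \<in> S3 \<inter> span {v, J v}"
    then obtain a b where "x = a *\<^sub>R v + b *\<^sub>R J v"
      by (auto simp: span_insert algebra_simps)
    then have "x = (a * norm v) *\<^sub>R u + (b * norm v) *\<^sub>R J u" using u(2) Ju by (metis scaleR_scaleR)
    then have "line_defect u x = 0" using uu J_self[of u] by (simp add: line_defect_def inner_add_left)
    then show "x \<in> circle u" using circle_iff_line_defect[OF u(1)] x by blast
  next
    fix x assume x: "x \<in> circle u"
    then obtain t where t: "x = cos t *\<^sub>R u + sin t *\<^sub>R J u" by (auto simp: circle_def rot_eq)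
    have "u \<in> span {v, J v}" unfolding u_def by (intro span_scale span_base) simp
    moreover have "J u \<in> span {v, J v}" unfolding u_def J_linear by (intro span_scale span_base) simp
    ultimately have "x \<in> span {v, J v}" unfolding t by (intro span_add span_scale)
    then show "x \<in> S3 \<inter> span {v, J v}" using x circle_subset_S3[OF u(1)] by blast
  qed
qed

lemma hopf_fibers: "{S3 \<inter> L | L. L \<in> complex_lines J} = circle ` S3"
proof (intro equalityI subsetI)
  fix C assume "C \<in> {S3 \<inter> L | L. L \<in> complex_lines J}"
  then obtain v where v: "v \<noteq> 0" "C = S3 \<inter> span {v, J v}" by (auto simp: complex_lines_def)
  then show "C \<in> circle ` S3" using sphere_Int_complex_line[OF v(1)] normalize_in_sphere[OF v(1)] by blast
next
  fix C assume "C \<in> circle ` S3"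
  then obtain x where x: "x \<in> S3" "C = circle x" by blast
  then have "C = S3 \<inter> span {x, J x}" using sphere_Int_complex_line[OF S3_nonzero[OF x(1)]] by simp
  then show "C \<in> {S3 \<inter> L | L. L \<in> complex_lines J}" using S3_nonzero[OF x(1)] unfolding complex_lines_def by blast
qed

text \<open>The fiber onto which the circle of x is mapped contains f x, so it can only be the
  circle of f x.\<close>

definition AutH :: "(real^4 \<Rightarrow> real^4) set" where
  "AutH = {f \<in> Diff. \<forall>x\<in>S3. f ` circle x = circle (f x)}"

lemma Aut_eq: "Aut {S3 \<inter> L | L. L \<in> complex_lines J} = AutH"
proof -
  have "f ` circle x \<in> circle ` S3 \<longleftrightarrow> f ` circle x = circle (f x)" if "f \<in> Diff" "x \<in> S3" for f x
  proof
    assume "f ` circle x \<in> circle ` S3"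
    then obtain y where y: "f ` circle x = circle y" by blast
    then have "f x \<in> circle y" using circle_self by blast
    then show "f ` circle x = circle (f x)" using circle_eq y by simp
  qed (use Diff_D(4) that in blast)
  then have "(\<forall>x\<in>S3. f ` circle x \<in> circle ` S3) \<longleftrightarrow> (\<forall>x\<in>S3. f ` circle x = circle (f x))" if "f \<in> Diff" for f
    using that by (intro ball_cong refl)
  moreover have "(\<forall>C\<in>circle ` S3. f ` C \<in> circle ` S3) \<longleftrightarrow> (\<forall>x\<in>S3. f ` circle x \<in> circle ` S3)" for f by blast
  ultimately show ?thesis unfolding Aut_def hopf_fibers AutH_def by (intro Collect_cong conj_cong refl) (simp only:)
qed

lemma AutH_compose:
  assumes "f \<in> AutH" "g \<in> AutH" shows "compose_S3 g f \<in> AutH"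
proof -
  have fg: "f \<in> Diff" "g \<in> Diff" using assms by (auto simp: AutH_def)
  have "compose_S3 g f ` circle x = circle (compose_S3 g f x)" if x: "x \<in> S3" for x
  proof -
    have "compose_S3 g f ` circle x = g ` f ` circle x"
      using circle_subset_S3[OF x] unfolding image_image compose_S3_def by (intro image_cong) auto
    also have "\<dots> = circle (g (f x))" using assms x Diff_D(4)[OF fg(1) x] by (simp add: AutH_def)
    finally show ?thesis using x by (simp add: compose_S3_def)
  qed
  then show ?thesis using compose_S3_Diff[OF fg(2,1)] by (simp add: AutH_def)
qed

lemma AutH_inverse:
  assumes "f \<in> AutH" shows "inv_S3 f \<in> AutH"
proof -
  have f: "f \<in> Diff" using assms by (simp add: AutH_def)
  have "inv_S3 f ` circle y = circle (inv_S3 f y)" if y: "y \<in> S3" for y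
  proof -
    define x where "x = inv_S3 f y"
    have x: "x \<in> S3" "f x = y" using inv_S3[OF f y] by (auto simp: x_def)
    have "inv_S3 f ` circle y = inv_S3 f ` f ` circle x" using assms x by (simp add: AutH_def)
    also have "\<dots> = circle x"
      using circle_subset_S3[OF x(1)] inv_S3(3)[OF f] unfolding image_image by (auto simp: subset_iff)
    finally show ?thesis by (simp add: x_def)
  qed
  then show ?thesis using inv_S3_Diff[OF f] by (simp add: AutH_def)
qed

text \<open>Inclusions for f and for its inverse replace the equality of fibers. Each constrains
  values at single points, to which a closedness argument applies.\<close>

lemma AutH_iff_circles:
  assumes f: "f \<in> Diff"
  shows "f \<in> AutH \<longleftrightarrow> (\<forall>x\<in>S3. \<forall>t. f (rot t x) \<in> circle (f x)) \<and> (\<forall>y\<in>S3. \<forall>t. inv_S3 f (rot t y) \<in> circle (inv_S3 f y))"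
proof
  assume "f \<in> AutH"
  then show "(\<forall>x\<in>S3. \<forall>t. f (rot t x) \<in> circle (f x)) \<and> (\<forall>y\<in>S3. \<forall>t. inv_S3 f (rot t y) \<in> circle (inv_S3 f y))"
    using AutH_inverse[of f] unfolding AutH_def circle_def by blast
next
  assume R: "(\<forall>x\<in>S3. \<forall>t. f (rot t x) \<in> circle (f x)) \<and> (\<forall>y\<in>S3. \<forall>t. inv_S3 f (rot t y) \<in> circle (inv_S3 f y))"
  have "f ` circle x = circle (f x)" if x: "x \<in> S3" for x
  proof (intro equalityI subsetI)
    show "y \<in> circle (f x)" if "y \<in> f ` circle x" for y using that R x by (auto simp: circle_def)
    fix y assume y: "y \<in> circle (f x)"
    have "inv_S3 f y \<in> circle (inv_S3 f (f x))" using R Diff_D(4)[OF f x] y by (auto simp: circle_def)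
    then have "inv_S3 f y \<in> circle x" using inv_S3(3)[OF f x] by simp
    moreover have "y = f (inv_S3 f y)" using inv_S3(2)[OF f] y circle_subset_S3[OF Diff_D(4)[OF f x]] by auto
    ultimately show "y \<in> f ` circle x" by blast
  qed
  then show "f \<in> AutH" using f by (simp add: AutH_def)
qed

text \<open>Let g be uniformly close to f and let x be the preimage of y under g. Then f x is close
  to g x = y, and continuity of the inverse of f brings x close to the preimage of y under
  f.\<close>

lemma continuous_map_inverse_eval:
  assumes y: "y \<in> S3" shows "continuous_map Diff_topology euclidean (\<lambda>f. inv_S3 f y)"
proof -
  have "continuous_map Diff_topology Met_TC.mtopology (\<lambda>f. inv_S3 f y)"
    unfolding Met_TC.continuous_map_to_metric
  proof (intro ballI allI impI)
    fix f and e :: real assume "f \<in> topspace Diff_topology" and e: "0 < e"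
    then have f: "f \<in> Diff" by simp
    have "continuous_on S3 (radial_ext (inv_S3 f))"
      by (rule Cinf_continuous_on[OF inv_S3_Cinf[OF f]])
    then obtain d where d: "d > 0" "\<And>z. z \<in> S3 \<Longrightarrow> dist z y < d \<Longrightarrow> dist (radial_ext (inv_S3 f) z) (radial_ext (inv_S3 f) y) < e"
      using e y unfolding continuous_on_iff by meson
    have jc: "jointly_continuous Diff_topology (- {0}) radial_ext"
      by (rule smooth_family_jcont[OF smooth_family_radial_ext_map[OF continuous_map_Diff_id]])
    obtain N where N: "openin Diff_topology N" "f \<in> N"
      "\<And>g x. g \<in> N \<Longrightarrow> x \<in> S3 \<Longrightarrow> dist (radial_ext g x) (radial_ext f x) < d"
      by (rule jointly_continuous_uniform[OF jc compact_S3 _ _ d(1), of f]) (use f S3_nonzero in auto)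
    show "\<exists>N. openin Diff_topology N \<and> f \<in> N \<and> (\<forall>g\<in>N. inv_S3 g y \<in> Met_TC.mball (inv_S3 f y) e)"
    proof (intro exI[of _ N] conjI ballI N(1,2))
      fix g assume g: "g \<in> N"
      then have gD: "g \<in> Diff" using openin_subset[OF N(1)] by auto
      define x where "x = inv_S3 g y"
      have x: "x \<in> S3" "g x = y" using inv_S3[OF gD y] by (auto simp: x_def)
      have "dist (f x) y < d" using N(3)[OF g x(1)] x by (simp add: dist_commute)
      from d(2)[OF Diff_D(4)[OF f x(1)] this]
      have "dist (inv_S3 f (f x)) (inv_S3 f y) < e" using Diff_D(4)[OF f x(1)] y by simp
      then show "inv_S3 g y \<in> Met_TC.mball (inv_S3 f y) e"
        using inv_S3(3)[OF f x(1)] by (simp add: x_def dist_commute)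
    qed
  qed
  then show ?thesis by simp
qed

lemma closedin_AutH: "closedin Diff_topology AutH"
proof -
  have cl: "closedin Diff_topology {f \<in> topspace Diff_topology. line_defect (F f) (G f) \<in> {0}}"
    if "continuous_map Diff_topology euclidean F" "continuous_map Diff_topology euclidean G" for F G
  proof (rule closedin_continuous_map_preimage)
    have "continuous_on UNIV (\<lambda>z. line_defect (fst z) (snd z))"
      unfolding line_defect_def by (intro continuous_intros linear_continuous_on_compose[OF _ linear_J])
    moreover have "continuous_map Diff_topology (prod_topology euclidean euclidean) (\<lambda>f. (F f, G f))"
      by (rule continuous_map_pairedI[OF that])
    ultimately show "continuous_map Diff_topology euclidean (\<lambda>f. line_defect (F f) (G f))"
      using continuous_map_compose[of Diff_topology euclidean "\<lambda>f. (F f, G f)" euclidean "\<lambda>z. line_defect (fst z) (snd z)"]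
      by (simp add: o_def)
  qed simp
  have "AutH = topspace Diff_topology \<inter> (\<Inter>x\<in>S3. \<Inter>t. {f \<in> topspace Diff_topology. line_defect (f x) (f (rot t x)) \<in> {0}})
    \<inter> (\<Inter>y\<in>S3. \<Inter>t. {f \<in> topspace Diff_topology. line_defect (inv_S3 f y) (inv_S3 f (rot t y)) \<in> {0}})"
    (is "_ = ?R")
  proof -
    have A: "f \<in> AutH \<longleftrightarrow> (\<forall>x\<in>S3. \<forall>t. line_defect (f x) (f (rot t x)) = 0) \<and>
       (\<forall>y\<in>S3. \<forall>t. line_defect (inv_S3 f y) (inv_S3 f (rot t y)) = 0)" if f: "f \<in> Diff" for f
    proof -
      have "f (rot t x) \<in> circle (f x) \<longleftrightarrow> line_defect (f x) (f (rot t x)) = 0" if "x \<in> S3" for x t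
        by (rule circle_iff_line_defect[OF Diff_D(4)[OF f that] Diff_D(4)[OF f rot_S3[OF that]]])
      moreover have "inv_S3 f (rot t x) \<in> circle (inv_S3 f x) \<longleftrightarrow> line_defect (inv_S3 f x) (inv_S3 f (rot t x)) = 0" if "x \<in> S3" for x t
        by (rule circle_iff_line_defect[OF inv_S3(1)[OF f that] inv_S3(1)[OF f rot_S3[OF that]]])
      ultimately show ?thesis unfolding AutH_iff_circles[OF f] by (metis (no_types, lifting))
    qed
    have B: "f \<in> ?R \<longleftrightarrow> f \<in> Diff \<and> (\<forall>x\<in>S3. \<forall>t. line_defect (f x) (f (rot t x)) = 0) \<and>
       (\<forall>y\<in>S3. \<forall>t. line_defect (inv_S3 f y) (inv_S3 f (rot t y)) = 0)" for f
      by auto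
    have C: "f \<in> AutH \<Longrightarrow> f \<in> Diff" for f by (simp add: AutH_def)
    show ?thesis
    proof (rule set_eqI)
      fix f show "f \<in> AutH \<longleftrightarrow> f \<in> ?R" using A[of f] C[of f] unfolding B by argo
    qed
  qed
  moreover have "closedin Diff_topology ?R"
    by (intro closedin_Int closedin_INT closedin_topspace S3_nonempty UNIV_not_empty cl
        continuous_map_eval continuous_map_Diff_id continuous_map_inverse_eval rot_S3)
  ultimately show ?thesis by simp
qed

end

section \<open>The local addition adapted to the Hopf fibration\<close>

context hopf begin

text \<open>For x on the sphere and v tangent at x, the part of v orthogonal to the fiber direction
  J x.\<close>

definition hcomp :: "real^4 \<Rightarrow> real^4 \<Rightarrow> real^4" where
  "hcomp x v = v - (v \<bullet> J x) *\<^sub>R J x"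

text \<open>The reciprocal norm of (1 + a J)(x + b) for x on the sphere: the complex factor has
  modulus sqrt (1 + a^2), and b is orthogonal to the unit vector x.\<close>

definition hopf_scale :: "(real^4) \<times> (real^4) \<Rightarrow> real" where
  "hopf_scale z = inverse (sqrt (1 + (snd z \<bullet> J (fst z))\<^sup>2)) *
     inverse (sqrt (1 + hcomp (fst z) (snd z) \<bullet> hcomp (fst z) (snd z)))"

definition hopf_exp :: "(real^4) \<times> (real^4) \<Rightarrow> real^4" where
  "hopf_exp z = hopf_scale z *\<^sub>R cmul (Complex 1 (snd z \<bullet> J (fst z))) (fst z + hcomp (fst z) (snd z))"

text \<open>If y = n (1 + a J)(x + b), then y . x = n and y . J x = n a, which gives a as a
  quotient. The rest of y is n (1 + a J) b, and applying n - n a J to it yields (n^2 + n^2 a^2)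
  b.\<close>

definition hopf_log :: "(real^4) \<times> (real^4) \<Rightarrow> real^4" where
  "hopf_log z = ((snd z \<bullet> J (fst z)) * inverse (snd z \<bullet> fst z)) *\<^sub>R J (fst z) +
     inverse ((snd z \<bullet> fst z)\<^sup>2 + (snd z \<bullet> J (fst z))\<^sup>2) *\<^sub>R
       ((snd z \<bullet> fst z) *\<^sub>R line_defect (fst z) (snd z) - (snd z \<bullet> J (fst z)) *\<^sub>R J (line_defect (fst z) (snd z)))"

definition hopf_log_dom :: "((real^4) \<times> (real^4)) set" where
  "hopf_log_dom = {z. 0 < snd z \<bullet> fst z}"

lemma one_plus_pos: "0 < 1 + (a::real)\<^sup>2" "0 < 1 + b \<bullet> (b::real^4)"
  by (simp_all add: add_pos_nonneg)

lemma hopf_scale_pos: "hopf_scale z > 0"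
  unfolding hopf_scale_def by (intro mult_pos_pos) (simp_all add: one_plus_pos)

lemma hopf_scale_square:
  "(hopf_scale (x, v))\<^sup>2 * (1 + (v \<bullet> J x)\<^sup>2) * (1 + hcomp x v \<bullet> hcomp x v) = 1"
proof -
  have "(hopf_scale (x, v))\<^sup>2 = inverse (1 + (v \<bullet> J x)\<^sup>2) * inverse (1 + hcomp x v \<bullet> hcomp x v)"
    using one_plus_pos(1)[of "v \<bullet> J x"] one_plus_pos(2)[of "hcomp x v"]
    by (simp add: hopf_scale_def power_mult_distrib power_inverse less_imp_le)
  moreover have "inverse A * inverse B * A * B = 1" if "A > 0" "B > 0" for A B :: real
    using that by (simp add: field_simps)
  ultimately show ?thesis using one_plus_pos(1)[of "v \<bullet> J x"] one_plus_pos(2)[of "hcomp x v"] by simp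
qed

lemma unit_J: assumes "x \<in> S3" shows "x \<bullet> x = 1" "J x \<bullet> J x = 1" "x \<bullet> J x = 0" "J x \<bullet> x = 0"
  using assms J_self by (simp_all only: S3_inner J_inner)

lemma J_horizontal: "u \<bullet> x = 0 \<Longrightarrow> u \<bullet> J x = 0 \<Longrightarrow> J u \<bullet> x = 0 \<and> J u \<bullet> J x = 0"
  using J_skew[of u x] J_inner[of u x] by simp

lemma hcomp_horizontal:
  assumes "x \<in> S3" "v \<bullet> x = 0" shows "hcomp x v \<bullet> x = 0" "hcomp x v \<bullet> J x = 0"
  using assms(2) unit_J[OF assms(1)] by (simp_all add: hcomp_def inner_diff_left)

lemma line_defect_horizontal:
  assumes "x \<in> S3" shows "line_defect x v \<bullet> x = 0" "line_defect x v \<bullet> J x = 0"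
  using unit_J[OF assms(1)] by (simp_all add: line_defect_def inner_diff_left)

lemma hopf_exp_S3:
  assumes x: "x \<in> S3" and v: "v \<bullet> x = 0"
  shows "hopf_exp (x, v) \<in> S3"
proof -
  let ?b = "hcomp x v" and ?a = "v \<bullet> J x"
  have "(x + ?b) \<bullet> (x + ?b) = 1 + ?b \<bullet> ?b"
    using hcomp_horizontal[OF x v] unit_J[OF x] by (simp add: inner_add_left inner_add_right inner_commute)
  moreover have "(cmod (Complex 1 ?a))\<^sup>2 = 1 + ?a\<^sup>2" by (simp add: cmod_power2)
  ultimately have "hopf_exp (x, v) \<bullet> hopf_exp (x, v) = (hopf_scale (x, v))\<^sup>2 * (1 + ?a\<^sup>2) * (1 + ?b \<bullet> ?b)"
    by (simp add: hopf_exp_def cmul_inner_cmul power2_eq_square mult_ac)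
  then show ?thesis using hopf_scale_square by (simp only: S3_inner)
qed

sublocale hopf: local_addition hopf_exp hopf_log UNIV hopf_log_dom
proof
  let ?X = "discrete_topology {()}"
  note sm = smooth_family_fst_ident smooth_family_snd_ident smooth_family_linear[OF bounded_linear_J]
  show oL: "open hopf_log_dom" unfolding hopf_log_dom_def by (intro open_Collect_less continuous_intros)
  have smh: "smooth_family ?X U (\<lambda>_ z. hcomp (fst z) (snd z))" for U
    unfolding hcomp_def by (intro smooth_family_diff smooth_family_scaleR smooth_family_inner sm)
  have "smooth_family ?X UNIV (\<lambda>_ z. hopf_scale z)"
    unfolding hopf_scale_def power2_eq_square
    by (intro smooth_family_mult smooth_family_inverse smooth_family_sqrt smooth_family_add smooth_family_const
         smooth_family_inner smh sm open_UNIV)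
       (simp_all add: one_plus_pos one_plus_pos[unfolded power2_eq_square] less_imp_neq[THEN not_sym] del: mult_eq_0_iff)
  then have "smooth_family ?X UNIV (\<lambda>_. hopf_exp)"
    unfolding hopf_exp_def[abs_def] cmul_def complex.sel
    by (intro smooth_family_scaleR smooth_family_add smooth_family_const smooth_family_inner smh sm)
  then show "smooth_on UNIV hopf_exp" by (simp add: smooth_on_iff_smooth_family)
  have smd: "smooth_family ?X U (\<lambda>_ z. line_defect (fst z) (snd z))" for U
    unfolding line_defect_def by (intro smooth_family_diff smooth_family_scaleR smooth_family_inner sm)
  have pos: "0 < (snd z \<bullet> fst z) * (snd z \<bullet> fst z) + (snd z \<bullet> J (fst z)) * (snd z \<bullet> J (fst z))" if "z \<in> hopf_log_dom" for z
    using that by (intro add_pos_nonneg) (auto simp: hopf_log_dom_def)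
  have "smooth_family ?X hopf_log_dom (\<lambda>_. hopf_log)"
    unfolding hopf_log_def[abs_def] power2_eq_square
  proof (intro smooth_family_add smooth_family_diff smooth_family_scaleR smooth_family_mult smooth_family_inverse
         smooth_family_inner smd sm oL)
    show "(snd z \<bullet> fst z) * (snd z \<bullet> fst z) + (snd z \<bullet> J (fst z)) * (snd z \<bullet> J (fst z)) \<noteq> 0" if "z \<in> hopf_log_dom" for z
      using pos[OF that] by linarith
    show "snd z \<bullet> fst z \<noteq> 0" if "z \<in> hopf_log_dom" for z using that by (simp add: hopf_log_dom_def)
  qed
  then show "smooth_on hopf_log_dom hopf_log" by (simp add: smooth_on_iff_smooth_family[OF oL])
next
  fix x v :: "real^4" assume x: "x \<in> S3" and v: "v \<bullet> x = 0"
  define a b n y where "a = v \<bullet> J x" and "b = hcomp x v" and "n = hopf_scale (x, v)" and "y = hopf_exp (x, v)"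
  note u = unit_J[OF x]
  have n: "n > 0" by (simp add: n_def hopf_scale_pos)
  have b: "b \<bullet> x = 0" "b \<bullet> J x = 0" "J b \<bullet> x = 0" "J b \<bullet> J x = 0"
    using hcomp_horizontal[OF x v] J_horizontal[of b x] by (auto simp: b_def)
  have y: "y = n *\<^sub>R (x + b + a *\<^sub>R J x + a *\<^sub>R J b)"
    by (simp add: y_def hopf_exp_def cmul_def a_def b_def n_def J_linear algebra_simps)
  have yx: "y \<bullet> x = n" "y \<bullet> J x = n * a" unfolding y using u b by (simp_all add: inner_add_left)
  have w: "line_defect x y = n *\<^sub>R (b + a *\<^sub>R J b)"
    unfolding line_defect_def yx by (simp add: y algebra_simps)
  have "n *\<^sub>R line_defect x y - (n * a) *\<^sub>R J (line_defect x y) = (n\<^sup>2 + (n * a)\<^sup>2) *\<^sub>R b"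
    unfolding w by (simp add: J_linear JJ algebra_simps power2_eq_square)
  moreover have "n\<^sup>2 + (n * a)\<^sup>2 > 0" using n by (intro add_pos_nonneg) auto
  ultimately have "hopf_log (x, y) = a *\<^sub>R J x + b"
    using n by (simp add: hopf_log_def yx)
  also have "\<dots> = v" by (simp add: a_def b_def hcomp_def)
  finally show "hopf_exp (x, v) \<in> S3 \<and> (x, hopf_exp (x, v)) \<in> hopf_log_dom \<and> hopf_log (x, hopf_exp (x, v)) = v"
    using hopf_exp_S3[OF x v] n yx(1) by (simp add: y_def hopf_log_dom_def)
next
  fix x y :: "real^4" assume x: "x \<in> S3" and y: "y \<in> S3" and xy: "(x, y) \<in> hopf_log_dom"
  define \<alpha> \<beta> w where "\<alpha> = y \<bullet> x" and "\<beta> = y \<bullet> J x" and "w = line_defect x y"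
  define r where "r = inverse (\<alpha>\<^sup>2 + \<beta>\<^sup>2)"
  define a b where "a = \<beta> * inverse \<alpha>" and "b = r *\<^sub>R (\<alpha> *\<^sub>R w - \<beta> *\<^sub>R J w)"
  note u = unit_J[OF x]
  have \<alpha>: "\<alpha> > 0" using xy by (simp add: hopf_log_dom_def \<alpha>_def)
  have "\<alpha>\<^sup>2 + \<beta>\<^sup>2 > 0" using \<alpha> by (intro add_pos_nonneg) auto
  then have "\<alpha>\<^sup>2 + \<beta>\<^sup>2 \<noteq> 0" by (rule less_imp_neq[THEN not_sym])
  then have r: "r * (\<alpha>\<^sup>2 + \<beta>\<^sup>2) = 1" unfolding r_def by (rule left_inverse)
  have V: "hopf_log (x, y) = a *\<^sub>R J x + b" by (simp add: hopf_log_def a_def b_def \<alpha>_def \<beta>_def w_def r_def)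
  have wh: "w \<bullet> x = 0" "w \<bullet> J x = 0" "J w \<bullet> x = 0" "J w \<bullet> J x = 0"
    using line_defect_horizontal[OF x, of y] J_horizontal[of w x] by (auto simp: w_def)
  have bh: "b \<bullet> x = 0" "b \<bullet> J x = 0" using wh by (simp_all add: b_def inner_diff_left)
  have Vx: "hopf_log (x, y) \<bullet> x = 0" "hopf_log (x, y) \<bullet> J x = a" unfolding V using u bh by (simp_all add: inner_add_left)
  have hc: "hcomp x (hopf_log (x, y)) = b" unfolding hcomp_def Vx(2) by (simp add: V)
  have "b + a *\<^sub>R J b = (r * (\<alpha> + a * \<beta>)) *\<^sub>R w + (r * (a * \<alpha> - \<beta>)) *\<^sub>R J w"
    by (simp add: b_def J_linear JJ algebra_simps)
  also have "r * (a * \<alpha> - \<beta>) = 0" using \<alpha> by (simp add: a_def)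
  also have "r * (\<alpha> + a * \<beta>) = inverse \<alpha> * (r * (\<alpha>\<^sup>2 + \<beta>\<^sup>2))"
    using \<alpha> by (simp add: a_def power2_eq_square field_simps)
  finally have bw: "b + a *\<^sub>R J b = inverse \<alpha> *\<^sub>R w" by (simp add: r)
  have "y = \<alpha> *\<^sub>R x + \<beta> *\<^sub>R J x + w" by (simp add: w_def line_defect_def \<alpha>_def \<beta>_def)
  then have "inverse \<alpha> *\<^sub>R y = x + a *\<^sub>R J x + inverse \<alpha> *\<^sub>R w"
    using \<alpha> by (simp add: a_def scaleR_add_right mult.commute)
  then have "cmul (Complex 1 a) (x + b) = inverse \<alpha> *\<^sub>R y"
    using bw by (simp add: cmul_def J_linear algebra_simps)
  then have Ey: "hopf_exp (x, hopf_log (x, y)) = (hopf_scale (x, hopf_log (x, y)) * inverse \<alpha>) *\<^sub>R y"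
    by (simp add: hopf_exp_def Vx hc)
  \<comment> \<open>\<open>hopf_exp\<close> returns a positive multiple of y. Both are unit vectors,
    so they agree without computing the scale.\<close>
  have "norm (hopf_exp (x, hopf_log (x, y))) = 1" using hopf_exp_S3[OF x Vx(1)] by simp
  then have "hopf_scale (x, hopf_log (x, y)) * inverse \<alpha> = 1"
    unfolding Ey norm_scaleR using y hopf_scale_pos[of "(x, hopf_log (x, y))"] \<alpha> by simp
  then have "hopf_exp (x, hopf_log (x, y)) = y" using Ey by simp
  then show "hopf_log (x, y) \<bullet> x = 0 \<and> (x, hopf_log (x, y)) \<in> UNIV \<and> hopf_exp (x, hopf_log (x, y)) = y"
    using Vx by simp
qed auto

section \<open>Horizontal parts and circle averages\<close>

definition hfield :: "(real^4 \<Rightarrow> real^4) \<Rightarrow> real^4 \<Rightarrow> real^4" where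
  "hfield V = (\<lambda>x. hcomp x (V x))"

text \<open>The mean over the circle group of its action on fields by conjugation.\<close>

definition avg :: "(real^4 \<Rightarrow> real^4) \<Rightarrow> real^4 \<Rightarrow> real^4" where
  "avg B = (\<lambda>x. integral {0..1} (\<lambda>s. rot (- (2 * pi * s)) (B (rot (2 * pi * s) x))))"

lemma continuous_map_into_VF_hfield:
  assumes V: "continuous_map X VF_topology V"
  shows "continuous_map X VF_topology (\<lambda>p. hfield (V p))"
proof (rule continuous_map_into_VF)
  have VV: "V p \<in> VF" if "p \<in> topspace X" for p
    using continuous_map_image_subset_topspace[OF V] that by auto
  let ?n = "\<lambda>x::real^4. x /\<^sub>R norm x"
  have "smooth_family X (- {0}) (\<lambda>p x. radial_ext (V p) x - (radial_ext (V p) x \<bullet> J (?n x)) *\<^sub>R J (?n x))"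
    by (intro smooth_family_diff smooth_family_scaleR smooth_family_inner smooth_family_linear[OF bounded_linear_J]
         smooth_family_normalize smooth_family_radial_ext_map continuous_map_VF_imp_Cinf V)
  then show "smooth_family X (- {0}) (\<lambda>p. radial_ext (hfield (V p)))"
    by (simp add: radial_ext_def hfield_def hcomp_def)
  fix p x assume p: "p \<in> topspace X"
  show "x \<notin> S3 \<Longrightarrow> hfield (V p) x = 0"
    using Cinf_zero[OF VF_D(1)[OF VV[OF p]], of x] by (simp add: hfield_def hcomp_def)
  show "x \<in> S3 \<Longrightarrow> hfield (V p) x \<bullet> x = 0"
    using hcomp_horizontal(1)[OF _ VF_D(2)[OF VV[OF p]], of x] by (simp add: hfield_def)
qed

lemma continuous_map_single:
  "continuous_map (discrete_topology {()}) VF_topology (\<lambda>_. V) \<longleftrightarrow> V \<in> VF"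
  using continuous_map_image_subset_topspace[of "discrete_topology {()}" VF_topology "\<lambda>_. V"] by auto

lemma hfield_VF: "V \<in> VF \<Longrightarrow> hfield V \<in> VF"
  using continuous_map_into_VF_hfield[of "discrete_topology {()}" "\<lambda>_. V"] continuous_map_single by blast

lemma hfield_horizontal: "V \<in> VF \<Longrightarrow> x \<in> S3 \<Longrightarrow> hfield V x \<bullet> x = 0 \<and> hfield V x \<bullet> J x = 0"
  using hcomp_horizontal[OF _ VF_D(2)] by (simp add: hfield_def)

lemma continuous_on_orbit:
  assumes B: "B \<in> Cinf" and x: "x \<in> S3"
  shows "continuous_on UNIV (\<lambda>t. B (rot t x))"
proof -
  have "continuous_on UNIV (\<lambda>t. radial_ext B (rot t x))"
    by (rule continuous_on_compose2[OF Cinf_continuous_on[OF B]])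
      (use rot_S3[OF x] in \<open>auto simp: rot_eq intro!: continuous_intros\<close>)
  then show ?thesis using radial_ext_sphere[OF rot_S3[OF x]] by simp
qed

lemma continuous_on_avg_integrand:
  assumes B: "B \<in> Cinf" and x: "x \<in> S3"
  shows "continuous_on UNIV (\<lambda>s. rot (- (2 * pi * s)) (B (rot (2 * pi * s) x)))"
proof -
  have c: "continuous_on UNIV (\<lambda>s. B (rot (2 * pi * s) x))"
    by (rule continuous_on_compose2[OF continuous_on_orbit[OF B x]]) (auto intro!: continuous_intros)
  show ?thesis unfolding rot_eq[of "- (2 * pi * _)"]
    by (intro continuous_intros c linear_continuous_on_compose[OF c linear_J])
qed

lemma avg_integrable:
  assumes "B \<in> Cinf" "x \<in> S3"
  shows "(\<lambda>s. rot (- (2 * pi * s)) (B (rot (2 * pi * s) x))) integrable_on {0..1}"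
  by (intro integrable_continuous_interval continuous_on_subset[OF continuous_on_avg_integrand[OF assms]]) auto

text \<open>Rotations are isometries, so orthogonality to the transported vector
  \<open>rot s u\<close> survives averaging. It is used with u = x for tangency and with u = J x for
  horizontality.\<close>

lemma avg_inner:
  assumes "B \<in> Cinf" "x \<in> S3" "\<And>s. B (rot s x) \<bullet> rot s u = 0"
  shows "avg B x \<bullet> u = 0"
proof -
  have "avg B x \<bullet> u = integral {0..1} ((\<lambda>v. v \<bullet> u) \<circ> (\<lambda>s. rot (- (2 * pi * s)) (B (rot (2 * pi * s) x))))"
    unfolding avg_def by (rule integral_linear[symmetric, OF avg_integrable[OF assms(1,2)] bounded_linear_inner_left])
  also have "(\<lambda>v. v \<bullet> u) \<circ> (\<lambda>s. rot (- (2 * pi * s)) (B (rot (2 * pi * s) x))) = (\<lambda>s. 0)"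
  proof
    fix s
    have "rot (- (2 * pi * s)) (B (rot (2 * pi * s) x)) \<bullet> rot (- (2 * pi * s)) (rot (2 * pi * s) u) = 0"
      unfolding rot_inner by (rule assms(3))
    then show "((\<lambda>v. v \<bullet> u) \<circ> (\<lambda>s. rot (- (2 * pi * s)) (B (rot (2 * pi * s) x)))) s = 0"
      by (simp add: rot_rot)
  qed
  finally show ?thesis by simp
qed

lemma avg_off_sphere: "B \<in> Cinf \<Longrightarrow> x \<notin> S3 \<Longrightarrow> avg B x = 0"
  using Cinf_zero[of B] by (simp add: avg_def rot_linear)

lemma smooth_family_rot:
  assumes "smooth_family X U u" "continuous_map X euclideanreal c"
  shows "smooth_family X U (\<lambda>p x. rot (c p) (u p x))"
proof -
  have "continuous_map X euclideanreal (cos \<circ> c)" "continuous_map X euclideanreal (sin \<circ> c)"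
    by (auto intro!: continuous_map_compose[OF assms(2)] continuous_intros)
  then have "continuous_map X euclideanreal (\<lambda>p. cos (c p))" "continuous_map X euclideanreal (\<lambda>p. sin (c p))"
    by (simp_all add: o_def)
  then show ?thesis unfolding rot_eq
    by (intro smooth_family_add smooth_family_scaleR smooth_family_param_only smooth_family_linear[OF bounded_linear_J] assms(1))
qed

lemma rot_eq_0: "rot t x = 0 \<longleftrightarrow> x = 0"
  using norm_rot[of t x] by (metis norm_eq_zero)

lemma continuous_map_into_VF_avg:
  assumes B: "continuous_map X VF_topology B"
  shows "continuous_map X VF_topology (\<lambda>p. avg (B p))"
proof (rule continuous_map_into_VF)
  have BV: "B p \<in> VF" if "p \<in> topspace X" for p
    using continuous_map_image_subset_topspace[OF B] that by auto
  let ?Y = "prod_topology X (top_of_set {0..1::real})"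
  have snd: "continuous_map ?Y euclideanreal snd"
    using continuous_map_snd[of X "top_of_set {0..1::real}"] by (simp add: continuous_map_in_subtopology)
  have c: "continuous_map ?Y euclideanreal (\<lambda>p. k * snd p)" for k :: real
    by (intro continuous_map_real_mult snd) simp
  have rb: "smooth_family ?Y (- {0}) (\<lambda>p. radial_ext (B (fst p)))"
    using smooth_family_radial_ext_map[OF continuous_map_compose[OF continuous_map_fst continuous_map_VF_imp_Cinf[OF B]]]
    by (simp add: o_def)
  have "smooth_family ?Y (- {0}) (\<lambda>p x. radial_ext (B (fst p)) (rot (2 * pi * snd p) x))"
    by (rule smooth_family_compose[OF rb smooth_family_rot[OF smooth_family_ident c]])
       (auto simp: rot_eq_0)
  from smooth_family_integral[OF smooth_family_rot[OF this c[of "- (2 * pi)"]]]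
  have "smooth_family X (- {0}) (\<lambda>p x. integral {0..1} (\<lambda>s. rot (- (2 * pi * s)) (radial_ext (B p) (rot (2 * pi * s) x))))"
    by (simp add: open_Compl)
  moreover have "radial_ext (B p) (rot t x) = B p (rot t (x /\<^sub>R norm x))" for p t x
    by (simp add: radial_ext_def rot_linear)
  moreover have "radial_ext (avg (B p)) =
      (\<lambda>x. integral {0..1} (\<lambda>s. rot (- (2 * pi * s)) (B p (rot (2 * pi * s) (x /\<^sub>R norm x)))))" for p
    by (simp only: radial_ext_def avg_def)
  ultimately show "smooth_family X (- {0}) (\<lambda>p. radial_ext (avg (B p)))" by (simp only:)
  fix p x assume p: "p \<in> topspace X"
  show "x \<notin> S3 \<Longrightarrow> avg (B p) x = 0" by (rule avg_off_sphere[OF VF_D(1)[OF BV[OF p]]])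
  show "avg (B p) x \<bullet> x = 0" if "x \<in> S3"
    by (rule avg_inner[OF VF_D(1)[OF BV[OF p]] that]) (rule VF_D(2)[OF BV[OF p] rot_S3[OF that]])
qed

lemma avg_VF: "B \<in> VF \<Longrightarrow> avg B \<in> VF"
  using continuous_map_into_VF_avg[of "discrete_topology {()}" "\<lambda>_. B"] continuous_map_single by blast

lemma integral_periodic_shift:
  fixes g :: "real \<Rightarrow> 'a::euclidean_space"
  assumes g: "continuous_on UNIV g" "\<And>s. g (s + 1) = g s" and c: "0 \<le> c" "c \<le> 1"
  shows "integral {0..1} (\<lambda>s. g (s + c)) = integral {0..1} g"
proof -
  have int: "g integrable_on {a..b}" for a b
    by (intro integrable_continuous_interval continuous_on_subset[OF g(1)]) auto
  have shift: "integral {a..b} (\<lambda>s. g (s + d)) = integral {a + d..b + d} g" for a b d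
    using integral_shift_Icc_real[of a b g d] by (simp add: o_def add.commute)
  have "integral {0..1} (\<lambda>s. g (s + c)) = integral {c..1 + c} g" using shift[of 0 1 c] by simp
  also have "\<dots> = integral {c..1} g + integral {1..1 + c} g"
    by (rule Henstock_Kurzweil_Integration.integral_combine[symmetric]) (use c int in auto)
  also have "integral {1..1 + c} g = integral {0..c} g" using shift[of 0 c 1] g(2) by (simp add: add.commute)
  also have "integral {c..1} g + integral {0..c} g = integral {0..1} g"
    using Henstock_Kurzweil_Integration.integral_combine[of 0 c 1 g] c int by (simp add: add.commute)
  finally show ?thesis .
qed

text \<open>Rotating x by t shifts the integration variable by t / (2 \<pi>), and the integrand has
  period 1.\<close>

lemma avg_equivariant:
  assumes B: "B \<in> Cinf" and x: "x \<in> S3"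
  shows "avg B (rot t x) = rot t (avg B x)"
proof -
  obtain t' where t': "0 \<le> t'" "t' < 2 * pi" "\<And>v. rot t v = rot t' v" using rot_representative[of t] by metis
  define g where "g s = rot (- (2 * pi * s)) (B (rot (2 * pi * s) x))" for s
  define c where "c = t' / (2 * pi)"
  have c: "0 \<le> c" "c \<le> 1" "2 * pi * c = t'" using t' by (auto simp: c_def)
  have per: "g (s + 1) = g s" for s
  proof -
    have "2 * pi * (s + 1) = 2 * pi * s + 2 * pi" "- (2 * pi * s) = - (2 * pi * (s + 1)) + 2 * pi"
      by (simp_all add: algebra_simps)
    then have "rot (2 * pi * (s + 1)) v = rot (2 * pi * s) v"
      "rot (- (2 * pi * s)) v = rot (- (2 * pi * (s + 1))) v" for v
      by (simp_all only: rot_rot[symmetric] rot_2pi)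
    then show ?thesis by (simp add: g_def)
  qed
  have gc: "continuous_on UNIV g" unfolding g_def[abs_def] by (rule continuous_on_avg_integrand[OF B x])
  have e: "rot (- (2 * pi * s)) (B (rot (2 * pi * s) (rot t x))) = rot t' (g (s + c))" for s
  proof -
    have "2 * pi * (s + c) = 2 * pi * s + t'" using c(3) by (simp add: algebra_simps)
    then show ?thesis by (simp add: g_def t'(3) rot_rot)
  qed
  have gi: "(\<lambda>s. g (s + c)) integrable_on {0..1}"
    by (intro integrable_continuous_interval continuous_on_compose2[OF gc] continuous_intros) auto
  have "avg B (rot t x) = integral {0..1} (rot t' \<circ> (\<lambda>s. g (s + c)))"
    unfolding avg_def e by (simp add: o_def)
  also have "\<dots> = rot t' (integral {0..1} (\<lambda>s. g (s + c)))"
    by (rule integral_linear[OF gi bounded_linear_rot])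
  also have "\<dots> = rot t (avg B x)"
    unfolding integral_periodic_shift[OF gc per c(1,2)] by (simp add: avg_def g_def[abs_def] t'(3))
  finally show ?thesis .
qed

lemma avg_of_equivariant:
  assumes "\<And>t. B (rot t x) = rot t (B x)" shows "avg B x = B x"
  by (simp add: avg_def assms rot_rot)

lemma avg_linear:
  assumes "B \<in> Cinf" "C \<in> Cinf"
  shows "avg (B + C) = avg B + avg C" "avg (B - C) = avg B - avg C" "avg (c *\<^sub>R B) = c *\<^sub>R avg B"
proof -
  have BC: "B + C \<in> Cinf" "B - C \<in> Cinf" "c *\<^sub>R B \<in> Cinf"
    using assms subspace_Cinf by (auto simp only: subspace_add subspace_diff subspace_scale)
  have "avg (B + C) x = avg B x + avg C x \<and> avg (B - C) x = avg B x - avg C x \<and> avg (c *\<^sub>R B) x = c *\<^sub>R avg B x" for x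
  proof (cases "x \<in> S3")
    case True
    note i = avg_integrable[OF assms(1) True] avg_integrable[OF assms(2) True]
    show ?thesis
      using Henstock_Kurzweil_Integration.integral_add[OF i] Henstock_Kurzweil_Integration.integral_diff[OF i]
      by (simp add: avg_def rot_linear scaleR_fun_def)
  next
    case False
    then show ?thesis
      unfolding avg_off_sphere[OF BC(1) False] avg_off_sphere[OF BC(2) False] avg_off_sphere[OF BC(3) False]
        avg_off_sphere[OF assms(1) False] avg_off_sphere[OF assms(2) False] by simp
  qed
  then show "avg (B + C) = avg B + avg C" "avg (B - C) = avg B - avg C" "avg (c *\<^sub>R B) = c *\<^sub>R avg B"
    unfolding fun_eq_iff plus_fun_apply minus_apply scaleR_fun_def by blast+
qed

text \<open>The kernel consists of the fields that project to the base of the fibration. Vertical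
  fields are among them, in accordance with automorphisms being free to move points along the
  fibers.\<close>

definition nonbasic :: "(real^4 \<Rightarrow> real^4) \<Rightarrow> real^4 \<Rightarrow> real^4" where
  "nonbasic V = hfield V - avg (hfield V)"

end

section \<open>The projection and its meaning for automorphisms\<close>

context hopf begin

lemma nonbasic_VF: "V \<in> VF \<Longrightarrow> nonbasic V \<in> VF"
  unfolding nonbasic_def by (intro subspace_diff[OF subspace_VF] hfield_VF avg_VF)

lemma continuous_map_VF_diff:
  assumes "continuous_map X VF_topology f" "continuous_map X VF_topology g"
  shows "continuous_map X VF_topology (\<lambda>p. f p - g p)"
  using continuous_map_VF_combination[OF assms, of "\<lambda>_. -1"] by simp

lemma continuous_map_nonbasic: "continuous_map VF_topology VF_topology nonbasic"
proof -
  have "continuous_map VF_topology VF_topology (\<lambda>V. V)" by simp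
  then show ?thesis unfolding nonbasic_def[abs_def]
    by (intro continuous_map_VF_diff continuous_map_into_VF_avg continuous_map_into_VF_hfield)
qed

lemma hfield_linear: "hfield (V + W) = hfield V + hfield W" "hfield (V - W) = hfield V - hfield W"
  "hfield (c *\<^sub>R V) = c *\<^sub>R hfield V"
  by (auto simp: hfield_def hcomp_def fun_eq_iff scaleR_fun_def inner_add_left inner_diff_left algebra_simps)

lemma nonbasic_add:
  assumes "V \<in> VF" "W \<in> VF" shows "nonbasic (V + W) = nonbasic V + nonbasic W"
  unfolding nonbasic_def hfield_linear avg_linear(1)[OF VF_D(1)[OF hfield_VF[OF assms(1)]] VF_D(1)[OF hfield_VF[OF assms(2)]]]
  by (simp add: fun_eq_iff)

lemma nonbasic_scaleR:
  assumes "V \<in> VF" shows "nonbasic (c *\<^sub>R V) = c *\<^sub>R nonbasic V"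
  unfolding nonbasic_def hfield_linear avg_linear(3)[OF VF_D(1)[OF hfield_VF[OF assms]] VF_D(1)[OF hfield_VF[OF assms]]]
  by (simp add: algebra_simps)

lemma avg_avg:
  assumes "B \<in> Cinf" "avg B \<in> Cinf" shows "avg (avg B) = avg B"
proof
  fix x show "avg (avg B) x = avg B x"
  proof (cases "x \<in> S3")
    case True
    then show ?thesis by (intro avg_of_equivariant avg_equivariant assms(1))
  qed (simp add: avg_off_sphere[OF assms(2)] avg_off_sphere[OF assms(1)])
qed

text \<open>\<open>nonbasic V\<close> is horizontal, because averaging preserves horizontality, and
  it has average zero, because averaging is idempotent.\<close>

lemma nonbasic_idem:
  assumes V: "V \<in> VF" shows "nonbasic (nonbasic V) = nonbasic V"
proof -
  let ?B = "hfield V"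
  have B: "?B \<in> VF" "avg ?B \<in> VF" using V by (auto intro: hfield_VF avg_VF)
  have "hfield (nonbasic V) = nonbasic V"
  proof
    fix x show "hfield (nonbasic V) x = nonbasic V x"
    proof (cases "x \<in> S3")
      case True
      have "avg ?B x \<bullet> J x = 0"
        by (rule avg_inner[OF VF_D(1)[OF B(1)] True]) (use hfield_horizontal[OF V rot_S3[OF True]] in \<open>simp add: rot_J\<close>)
      then have "nonbasic V x \<bullet> J x = 0"
        using hfield_horizontal[OF V True] by (simp add: nonbasic_def inner_diff_left)
      then show ?thesis by (simp add: hfield_def hcomp_def)
    next
      case False
      then show ?thesis using Cinf_zero[OF VF_D(1)[OF nonbasic_VF[OF V]] False] by (simp add: hfield_def hcomp_def)
    qed
  qed
  moreover have "avg (nonbasic V) = 0"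
    unfolding nonbasic_def avg_linear(2)[OF VF_D(1)[OF B(1)] VF_D(1)[OF B(2)]] avg_avg[OF VF_D(1)[OF B(1)] VF_D(1)[OF B(2)]]
    by simp
  ultimately show ?thesis unfolding nonbasic_def[of "nonbasic V"] by simp
qed

lemma nonbasic_eq_0_iff:
  assumes V: "V \<in> VF"
  shows "nonbasic V = 0 \<longleftrightarrow> (\<forall>x\<in>S3. \<forall>t. hfield V (rot t x) = rot t (hfield V x))"
proof
  have B: "hfield V \<in> Cinf" by (rule VF_D(1)[OF hfield_VF[OF V]])
  show "\<forall>x\<in>S3. \<forall>t. hfield V (rot t x) = rot t (hfield V x)" if "nonbasic V = 0"
  proof -
    have "hfield V = avg (hfield V)" using that by (simp add: nonbasic_def)
    then show ?thesis using avg_equivariant[OF B] by metis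
  qed
  assume R: "\<forall>x\<in>S3. \<forall>t. hfield V (rot t x) = rot t (hfield V x)"
  show "nonbasic V = 0"
  proof
    fix x show "nonbasic V x = 0 x"
    proof (cases "x \<in> S3")
      case True
      then have "avg (hfield V) x = hfield V x" using R by (intro avg_of_equivariant) blast
      then show ?thesis by (simp add: nonbasic_def)
    qed (simp add: Cinf_zero[OF VF_D(1)[OF nonbasic_VF[OF V]]])
  qed
qed

text \<open>The complex scalar \<mu> with \<open>hopf_exp (x, v)\<close> = \<mu> (x + b), where b is
  the horizontal part; the vertical part of v enters through \<mu> alone.\<close>

definition hopf_factor :: "real^4 \<Rightarrow> real^4 \<Rightarrow> complex" where
  "hopf_factor x v = of_real (hopf_scale (x, v)) * Complex 1 (v \<bullet> J x)"

lemma hopf_exp_factor: "hopf_exp (x, v) = cmul (hopf_factor x v) (x + hcomp x v)"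
  by (simp only: hopf_exp_def hopf_factor_def cmul_linear(5) fst_conv snd_conv)

lemma hopf_factor_nonzero: "hopf_factor x v \<noteq> 0"
  using hopf_scale_pos[of "(x, v)"] by (auto simp: hopf_factor_def complex_eq_iff)

text \<open>The space is the orthogonal sum of the complex line of x and its complement.\<close>

lemma cmul_decomposition_unique:
  assumes x: "x \<in> S3" and u: "u \<bullet> x = 0" "u \<bullet> J x = 0" and u': "u' \<bullet> x = 0" "u' \<bullet> J x = 0"
    and eq: "cmul z x + u = cmul z' x + u'"
  shows "z = z'" "u = u'"
proof -
  have "(cmul z x + u) \<bullet> x = Re z" "(cmul z' x + u') \<bullet> x = Re z'"
    "(cmul z x + u) \<bullet> J x = Im z" "(cmul z' x + u') \<bullet> J x = Im z'"
    using unit_J[OF x] u u' by (simp_all add: cmul_def inner_add_left)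
  then show "z = z'" using eq by (simp add: complex_eq_iff)
  then show "u = u'" using eq by simp
qed

lemma cmul_horizontal:
  assumes "u \<bullet> x = 0" "u \<bullet> J x = 0" shows "cmul z u \<bullet> x = 0" "cmul z u \<bullet> J x = 0"
  using assms J_horizontal[OF assms] by (simp_all add: cmul_def inner_add_left)

text \<open>If \<open>k\<close> preserves fibers, splitting \<open>k (rot t x)\<close> =
  \<open>rot s (k x)\<close> along the complex line of x and its complement eliminates the unknown
  angle s and leaves the equation for horizontal parts. Conversely, equivariance keeps the images of
  a fiber in a single fiber, and the vertical part of V only shifts the phase there.\<close>

lemma AutH_iff_equivariant:
  assumes k: "k \<in> Diff" and V: "V \<in> VF" and kV: "\<And>x. x \<in> S3 \<Longrightarrow> k x = hopf_exp (x, V x)"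
  shows "k \<in> AutH \<longleftrightarrow> (\<forall>x\<in>S3. \<forall>t. hfield V (rot t x) = rot t (hfield V x))"
proof
  let ?\<mu> = "\<lambda>x. hopf_factor x (V x)" and ?b = "hfield V"
  have ke: "k x = cmul (?\<mu> x) (x + ?b x)" if "x \<in> S3" for x
    using kV[OF that] by (simp add: hopf_exp_factor hfield_def)
  have bh: "?b x \<bullet> x = 0" "?b x \<bullet> J x = 0" if "x \<in> S3" for x using hfield_horizontal[OF V that] by auto
  {
    assume A: "k \<in> AutH"
    show "\<forall>x\<in>S3. \<forall>t. ?b (rot t x) = rot t (?b x)"
    proof (intro ballI allI)
      fix x t assume x: "x \<in> S3"
      let ?p = "rot t x"
      have p: "?p \<in> S3" by (rule rot_S3[OF x])
      have "?p \<in> circle x" by (auto simp: circle_def)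
      then have "k ?p \<in> circle (k x)" using A x unfolding AutH_def by blast
      then obtain s where s: "k ?p = rot s (k x)" by (auto simp: circle_def)
      have xp: "x = rot (- t) ?p" by (simp add: rot_rot)
      have bp: "?b ?p \<bullet> x = 0" "?b ?p \<bullet> J x = 0"
      proof -
        have "?b ?p \<bullet> rot (- t) ?p = 0" "?b ?p \<bullet> J (rot (- t) ?p) = 0"
          using bh[OF p] by (simp_all add: rot_eq[of "- t" ?p] inner_diff_right J_linear JJ inner_add_right)
        then show "?b ?p \<bullet> x = 0" "?b ?p \<bullet> J x = 0" by (simp_all only: xp[symmetric])
      qed
      \<comment> \<open>The components along the line give \<mu>(p) e^(it) = e^(is) \<mu>(x).
        Substituting this in the other components lets the nonzero scalar \<mu>(p) cancel.\<close>
      have "cmul (?\<mu> ?p * cis t) x + cmul (?\<mu> ?p) (?b ?p) = cmul (cis s * ?\<mu> x) x + cmul (cis s * ?\<mu> x) (?b x)"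
        using s[unfolded ke[OF p] ke[OF x]] by (simp only: rot_def cmul_linear(1) cmul_cmul)
      note un = cmul_decomposition_unique[OF x cmul_horizontal[OF bp] cmul_horizontal[OF bh[OF x]] this]
      have "cmul (?\<mu> ?p) (?b ?p) = cmul (?\<mu> ?p) (cmul (cis t) (?b x))"
        using un by (simp add: cmul_cmul)
      then show "?b ?p = rot t (?b x)" unfolding rot_def by (rule cmul_cancel[OF hopf_factor_nonzero])
    qed
  }
  assume R: "\<forall>x\<in>S3. \<forall>t. ?b (rot t x) = rot t (?b x)"
  have "k ` circle x = circle (k x)" if x: "x \<in> S3" for x
  proof -
    define z where "z = x + ?b x"
    have "z \<bullet> x = 1" using bh[OF x] unit_J[OF x] by (simp add: z_def inner_add_left)
    then have z0: "z \<noteq> 0" by auto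
    define u where "u = z /\<^sub>R norm z"
    have zu: "z = norm z *\<^sub>R u" "norm u = 1" using z0 by (simp_all add: u_def)
    define a where "a t = V (rot t x) \<bullet> J (rot t x)" for t
    \<comment> \<open>The positive factor must be 1 because k maps into the sphere; what remains is
      the argument arctan a(t) of the complex scalar.\<close>
    have kr: "k (rot t x) = rot (t + arctan (a t)) u" for t
    proof -
      have p: "rot t x \<in> S3" by (rule rot_S3[OF x])
      have "Complex 1 (a t) = of_real (sqrt (1 + (a t)\<^sup>2)) * cis (arctan (a t))"
        using one_plus_pos(1)[of "a t"] by (simp add: complex_eq_iff cos_arctan sin_arctan)
      then have \<mu>: "?\<mu> (rot t x) = of_real (hopf_scale (rot t x, V (rot t x)) * sqrt (1 + (a t)\<^sup>2)) * cis (arctan (a t))"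
        unfolding hopf_factor_def a_def[symmetric] by simp
      have "rot t x + ?b (rot t x) = rot t z" using R x by (simp add: z_def rot_linear)
      also have "\<dots> = norm z *\<^sub>R rot t u" by (subst zu(1)) (rule rot_linear(3))
      finally have "k (rot t x) = cmul (?\<mu> (rot t x)) (norm z *\<^sub>R rot t u)"
        unfolding ke[OF p] by (simp only:)
      also have "\<dots> = (hopf_scale (rot t x, V (rot t x)) * sqrt (1 + (a t)\<^sup>2) * norm z) *\<^sub>R rot (arctan (a t)) (rot t u)"
        unfolding \<mu> cmul_linear(5) cmul_linear(3) rot_def[of "arctan (a t)"] by simp
      finally have e: "k (rot t x) = (hopf_scale (rot t x, V (rot t x)) * sqrt (1 + (a t)\<^sup>2) * norm z) *\<^sub>R rot (t + arctan (a t)) u"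
        (is "_ = ?c *\<^sub>R _") by (simp only: rot_rot add.commute)
      have "?c > 0" using hopf_scale_pos z0 one_plus_pos(1)[of "a t"] by simp
      moreover have "norm (k (rot t x)) = 1" using Diff_D(4)[OF k p] by simp
      ultimately have "?c = 1" unfolding e by (simp add: zu(2) abs_of_pos)
      then show ?thesis using e by simp
    qed
    have ca: "continuous_on UNIV a"
      unfolding a_def[abs_def] rot_J[symmetric] by (intro continuous_intros continuous_on_orbit[OF VF_D(1)[OF V] x])
        (auto simp: rot_eq intro!: continuous_intros)
    have "k ` circle x = circle u"
    proof (intro equalityI subsetI)
      show "y \<in> circle u" if "y \<in> k ` circle x" for y using that kr by (auto simp: circle_def)
      fix y assume "y \<in> circle u"
      then obtain \<theta> where y: "y = rot \<theta> u" by (auto simp: circle_def)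
      \<comment> \<open>Since arctan lies strictly between -\<pi>/2 and \<pi>/2, the phase t +
        arctan a(t) is at most \<theta> at the left end and at least \<theta> at the right end.
        Hence the whole fiber is attained.\<close>
      have "\<exists>t\<ge>\<theta> - pi/2. t \<le> \<theta> + pi/2 \<and> t + arctan (a t) = \<theta>"
      proof (rule IVT')
        show "\<theta> - pi/2 + arctan (a (\<theta> - pi/2)) \<le> \<theta>" using arctan_ubound[of "a (\<theta> - pi/2)"] by simp
        show "\<theta> \<le> \<theta> + pi/2 + arctan (a (\<theta> + pi/2))" using arctan_lbound[of "a (\<theta> + pi/2)"] by simp
        show "continuous_on {\<theta> - pi/2..\<theta> + pi/2} (\<lambda>t. t + arctan (a t))"
          by (intro continuous_intros continuous_on_subset[OF ca]) auto
      qed simp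
      then obtain t where "t + arctan (a t) = \<theta>" by blast
      then have "y = k (rot t x)" using kr y by simp
      then show "y \<in> k ` circle x" by (auto simp: circle_def)
    qed
    moreover have "k x \<in> k ` circle x" using circle_self by blast
    ultimately show ?thesis using circle_eq by blast
  qed
  then show "k \<in> AutH" using k by (simp add: AutH_def)
qed

end

text \<open>For a linear inner map the higher chain rule has a single term,
  \<open>D (A x) (map A hs)\<close>.\<close>

lemma frechet_smooth_precompose_linear:
  assumes f: "frechet_smooth E F U f" and A: "continuous_map E' E A" and E': "subspace (topspace E')"
    and lin: "\<And>x y. x \<in> topspace E' \<Longrightarrow> y \<in> topspace E' \<Longrightarrow> A (x + y) = A x + A y"
      "\<And>c x. x \<in> topspace E' \<Longrightarrow> A (c *\<^sub>R x) = c *\<^sub>R A x"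
  shows "frechet_smooth E' F {x \<in> topspace E'. A x \<in> U} (\<lambda>x. f (A x))"
proof -
  from f obtain D where D: "openin E U" "\<forall>x\<in>U. D x [] = f x"
    "\<forall>x\<in>U. \<forall>hs\<in>lists (topspace E). \<forall>h\<in>topspace E.
       limitin F (\<lambda>t. (1 / t) *\<^sub>R (D (x + t *\<^sub>R h) hs - D x hs)) (D x (hs @ [h])) (at (0::real))"
    "\<forall>n. continuous_map (prod_topology (subtopology E U) (product_topology (\<lambda>_. E) {..<n})) F (\<lambda>(x, h). D x (map h [0..<n]))"
    unfolding frechet_smooth_def by (elim conjE exE) (rule that)
  let ?U = "{x \<in> topspace E'. A x \<in> U}"
  have AE: "A x \<in> topspace E" if "x \<in> topspace E'" for x
    using continuous_map_image_subset_topspace[OF A] that by blast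
  have oU: "openin E' ?U" by (rule openin_continuous_map_preimage[OF A D(1)])
  show ?thesis unfolding frechet_smooth_def
  proof (intro conjI oU exI[of _ "\<lambda>x hs. D (A x) (map A hs)"] ballI allI)
    show "D (A x) (map A []) = f (A x)" if "x \<in> ?U" for x using D(2) that by simp
    fix x hs h assume x: "x \<in> ?U" and hs: "hs \<in> lists (topspace E')" and h: "h \<in> topspace E'"
    have "map A hs \<in> lists (topspace E)" using hs AE by auto
    moreover have "A (x + t *\<^sub>R h) = A x + t *\<^sub>R A h" for t
      using x h E' by (simp add: lin subspace_scale)
    ultimately show "limitin F (\<lambda>t. (1 / t) *\<^sub>R (D (A (x + t *\<^sub>R h)) (map A hs) - D (A x) (map A hs)))
       (D (A x) (map A (hs @ [h]))) (at 0)"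
      using D(3) x AE[OF h] by simp
  next
    fix n :: nat
    let ?X = "prod_topology (subtopology E' ?U) (product_topology (\<lambda>_. E') {..<n})"
    let ?Y = "prod_topology (subtopology E U) (product_topology (\<lambda>_. E) {..<n})"
    have "continuous_map ?X ?Y (\<lambda>z. (A (fst z), restrict (\<lambda>i. A (snd z i)) {..<n}))"
    proof (rule continuous_map_pairedI)
      have "continuous_map ?X (subtopology E' ?U) fst" by (rule continuous_map_fst)
      then have "continuous_map ?X E' fst" "fst ` topspace ?X \<subseteq> ?U"
        using continuous_map_image_subset_topspace[of ?X "subtopology E' ?U" fst] by (auto simp: continuous_map_in_subtopology)
      then have c: "continuous_map ?X E (\<lambda>z. A (fst z))" "(\<lambda>z. A (fst z)) ` topspace ?X \<subseteq> U"
        using continuous_map_compose[OF _ A] by (auto simp: o_def)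
      show "continuous_map ?X (subtopology E U) (\<lambda>z. A (fst z))"
        by (rule continuous_map_into_subtopology[OF c(1) image_subset_iff_funcset[THEN iffD1, OF c(2)]])
      have "continuous_map ?X E (\<lambda>z. A (snd z i))" if "i < n" for i
        using continuous_map_compose[OF continuous_map_compose[OF continuous_map_snd continuous_map_product_projection[of i "{..<n}" "\<lambda>_. E'"]] A] that
        by (simp add: o_def)
      then show "continuous_map ?X (product_topology (\<lambda>_. E) {..<n}) (\<lambda>z. restrict (\<lambda>i. A (snd z i)) {..<n})"
        by (simp add: continuous_map_componentwise image_subset_iff)
    qed
    from continuous_map_compose[OF this D(4)[rule_format, of n]]
    have "continuous_map ?X F (\<lambda>z. D (A (fst z)) (map (restrict (\<lambda>i. A (snd z i)) {..<n}) [0..<n]))"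
      by (simp add: o_def)
    moreover have "map (restrict (\<lambda>i. A (h i)) {..<n}) [0..<n] = map A (map h [0..<n])" for h by simp
    ultimately show "continuous_map ?X F (\<lambda>(x, h). D (A x) (map A (map h [0..<n])))"
      by (simp only: case_prod_unfold)
  qed
qed

text \<open>\<open>A\<close> is linear only on the carrier of \<open>F\<close>, so the values of
  \<open>D\<close> must be shown to lie there before \<open>A\<close> can be moved inside a
  difference quotient.\<close>

lemma frechet_smooth_postcompose_linear:
  assumes f: "frechet_smooth VF_topology F U f" and A: "continuous_map F F' A" and F: "subspace (topspace F)"
    and lin: "\<And>x y. x \<in> topspace F \<Longrightarrow> y \<in> topspace F \<Longrightarrow> A (x - y) = A x - A y"
      "\<And>c x. x \<in> topspace F \<Longrightarrow> A (c *\<^sub>R x) = c *\<^sub>R A x"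
  shows "frechet_smooth VF_topology F' U (\<lambda>x. A (f x))"
proof -
  from f obtain D where D: "openin VF_topology U" "\<forall>x\<in>U. D x [] = f x"
    "\<forall>x\<in>U. \<forall>hs\<in>lists (topspace VF_topology). \<forall>h\<in>topspace VF_topology.
       limitin F (\<lambda>t. (1 / t) *\<^sub>R (D (x + t *\<^sub>R h) hs - D x hs)) (D x (hs @ [h])) (at (0::real))"
    "\<forall>n. continuous_map (prod_topology (subtopology VF_topology U) (product_topology (\<lambda>_. VF_topology) {..<n})) F (\<lambda>(x, h). D x (map h [0..<n]))"
    unfolding frechet_smooth_def by (elim conjE exE) (rule that)
  \<comment> \<open>Without directions this follows from continuity for n = 0; otherwise the value
    is a limit in \<open>F\<close>.\<close>
  have DF: "D x hs \<in> topspace F" if x: "x \<in> U" and hs: "hs \<in> lists VF" for x hs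
  proof (cases hs rule: rev_cases)
    case Nil
    have "x \<in> VF" using openin_subset[OF D(1)] x by auto
    then have "(x, \<lambda>_. undefined) \<in> topspace (prod_topology (subtopology VF_topology U) (product_topology (\<lambda>_. VF_topology) {..<0::nat}))"
      using x by simp
    then show ?thesis
      using continuous_map_image_subset_topspace[OF D(4)[rule_format, of 0]] Nil by force
  next
    case (snoc hs' h)
    then have "limitin F (\<lambda>t. (1 / t) *\<^sub>R (D (x + t *\<^sub>R h) hs' - D x hs')) (D x (hs' @ [h])) (at (0::real))"
      using D(3) x hs by simp
    from limitin_topspace[OF this] snoc show ?thesis by simp
  qed
  show ?thesis unfolding frechet_smooth_def
  proof (intro conjI D(1) exI[of _ "\<lambda>x hs. A (D x hs)"] ballI allI)
    show "A (D x []) = A (f x)" if "x \<in> U" for x using D(2) that by simp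
    fix x hs h assume x: "x \<in> U" and hs: "hs \<in> lists (topspace VF_topology)" and h: "h \<in> topspace VF_topology"
    have "limitin F (\<lambda>t. (1 / t) *\<^sub>R (D (x + t *\<^sub>R h) hs - D x hs)) (D x (hs @ [h])) (at (0::real))"
      using D(3) x hs h by blast
    then have l: "limitin F' (A \<circ> (\<lambda>t. (1 / t) *\<^sub>R (D (x + t *\<^sub>R h) hs - D x hs))) (A (D x (hs @ [h]))) (at (0::real))"
      by (rule continuous_map_limit[OF A])
    obtain d where d: "d > 0" "\<And>t::real. \<bar>t\<bar> < d \<Longrightarrow> x + t *\<^sub>R h \<in> U"
      using openin_VF_line[OF D(1) x] h by auto
    have "\<forall>\<^sub>F t in at (0::real). \<bar>t\<bar> < d" using d(1) by (auto simp: eventually_at dist_real_def)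
    then have "\<forall>\<^sub>F t in at (0::real). (A \<circ> (\<lambda>t. (1 / t) *\<^sub>R (D (x + t *\<^sub>R h) hs - D x hs))) t =
       (1 / t) *\<^sub>R (A (D (x + t *\<^sub>R h) hs) - A (D x hs))"
    proof eventually_elim
      case (elim t)
      have "D (x + t *\<^sub>R h) hs \<in> topspace F" "D x hs \<in> topspace F" using DF d(2)[OF elim] x hs by auto
      then show ?case by (simp add: lin subspace_diff[OF F])
    qed
    then show "limitin F' (\<lambda>t. (1 / t) *\<^sub>R (A (D (x + t *\<^sub>R h) hs) - A (D x hs))) (A (D x (hs @ [h]))) (at 0)"
      by (rule limitin_transform_eventually[OF _ l])
  next
    fix n
    show "continuous_map (prod_topology (subtopology VF_topology U) (product_topology (\<lambda>_. VF_topology) {..<n})) F'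
       (\<lambda>(x, h). A (D x (map h [0..<n])))"
      using continuous_map_compose[OF D(4)[rule_format, of n] A] by (simp add: o_def case_prod_unfold)
  qed
qed

section \<open>Splitting the model space\<close>

locale VF_projection =
  fixes Q :: "(real^4 \<Rightarrow> real^4) \<Rightarrow> real^4 \<Rightarrow> real^4"
  assumes Q_continuous: "continuous_map VF_topology VF_topology Q"
    and Q_add: "\<And>V W. V \<in> VF \<Longrightarrow> W \<in> VF \<Longrightarrow> Q (V + W) = Q V + Q W"
    and Q_scaleR: "\<And>c V. V \<in> VF \<Longrightarrow> Q (c *\<^sub>R V) = c *\<^sub>R Q V"
    and Q_idem: "\<And>V. V \<in> VF \<Longrightarrow> Q (Q V) = Q V"
begin

definition ker :: "(real^4 \<Rightarrow> real^4) set" where "ker = {V \<in> VF. Q V = 0}"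
text \<open>The range of \<open>Q\<close>, written as the kernel of the complementary projection, so
  that closedness is the same statement as for \<open>ker\<close>.\<close>

definition rng :: "(real^4 \<Rightarrow> real^4) set" where "rng = {V \<in> VF. V - Q V = 0}"

abbreviation "F \<equiv> subtopology Cinf_topology ker"
abbreviation "G \<equiv> subtopology Cinf_topology rng"
abbreviation "FG \<equiv> prod_topology F G"

definition split :: "(real^4 \<Rightarrow> real^4) \<Rightarrow> (real^4 \<Rightarrow> real^4) \<times> (real^4 \<Rightarrow> real^4)" where
  "split V = (V - Q V, Q V)"

definition join :: "(real^4 \<Rightarrow> real^4) \<times> (real^4 \<Rightarrow> real^4) \<Rightarrow> real^4 \<Rightarrow> real^4" where
  "join p = fst p + snd p"

lemma Q_VF: "V \<in> VF \<Longrightarrow> Q V \<in> VF"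
  using continuous_map_image_subset_topspace[OF Q_continuous] by auto

lemma Q_diff: "V \<in> VF \<Longrightarrow> W \<in> VF \<Longrightarrow> Q (V - W) = Q V - Q W"
  using Q_add[of V "(-1) *\<^sub>R W"] Q_scaleR[of W "-1"] subspace_scale[OF subspace_VF, of W "-1"] by simp

lemma Q_0: "Q 0 = 0"
  using Q_scaleR[of 0 0] subspace_0[OF subspace_VF] by simp

lemma subspace_ker: "subspace ker"
  unfolding subspace_def ker_def
  using subspace_0[OF subspace_VF] subspace_add[OF subspace_VF] subspace_scale[OF subspace_VF] Q_0 Q_add Q_scaleR
  by (simp del: plus_fun_apply)

lemma subspace_rng: "subspace rng"
  unfolding subspace_def rng_def
  using subspace_0[OF subspace_VF] subspace_add[OF subspace_VF] subspace_scale[OF subspace_VF] Q_0 Q_add Q_scaleR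
  by (simp del: plus_fun_apply)

lemma closedin_zero_set:
  assumes T: "continuous_map VF_topology VF_topology T"
  shows "closedin Cinf_topology {V \<in> VF. T V = 0}"
proof -
  have TV: "T V \<in> VF" if "V \<in> VF" for V using continuous_map_image_subset_topspace[OF T] that by auto
  have "T V = 0 \<longleftrightarrow> (\<forall>x\<in>S3. T V x = 0)" if V: "V \<in> VF" for V
  proof
    assume "\<forall>x\<in>S3. T V x = 0"
    then show "T V = 0" using Cinf_zero[OF VF_D(1)[OF TV[OF V]]] by (intro ext) (metis zero_fun_apply)
  qed simp
  then have "{V \<in> VF. T V = 0} = topspace VF_topology \<inter> (\<Inter>x\<in>S3. {V \<in> topspace VF_topology. T V x \<in> {0}})"
    by auto
  moreover have "closedin VF_topology (topspace VF_topology \<inter> (\<Inter>x\<in>S3. {V \<in> topspace VF_topology. T V x \<in> {0}}))"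
  proof (intro closedin_Int closedin_topspace closedin_INT S3_nonempty)
    fix x assume x: "x \<in> S3"
    show "closedin VF_topology {V \<in> topspace VF_topology. T V x \<in> {0}}"
      by (rule closedin_continuous_map_preimage[OF continuous_map_eval[OF continuous_map_VF_imp_Cinf[OF T] x]]) simp
  qed
  ultimately have "closedin VF_topology {V \<in> VF. T V = 0}" by simp
  then show ?thesis using closedin_closed_subtopology[OF closedin_VF] by (simp add: VF_topology_def)
qed

lemma continuous_map_complement: "continuous_map VF_topology VF_topology (\<lambda>V. V - Q V)"
  using continuous_map_VF_combination[OF _ Q_continuous, of "\<lambda>V. V" "\<lambda>_. -1"] by simp

lemma frechet_space_F: "frechet_space F" and frechet_space_G: "frechet_space G"
  unfolding ker_def rng_def
  using frechet_space_closed_subspace_Cinf[OF subspace_ker] frechet_space_closed_subspace_Cinf[OF subspace_rng]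
    closedin_zero_set[OF Q_continuous] closedin_zero_set[OF continuous_map_complement]
  by (simp_all add: ker_def rng_def)

lemma topspace_F: "topspace F = ker" and topspace_G: "topspace G = rng"
  using VF_D(1) by (auto simp: ker_def rng_def)

lemma topspace_FG: "topspace FG = ker \<times> rng"
  by (simp only: topspace_prod_topology topspace_F topspace_G)

lemma subspace_FG: "subspace (topspace FG)"
  unfolding topspace_FG by (rule subspace_Times[OF subspace_ker subspace_rng])

lemma split_in: "V \<in> VF \<Longrightarrow> V - Q V \<in> ker" "V \<in> VF \<Longrightarrow> Q V \<in> rng"
  using Q_diff[of V "Q V"] Q_idem[of V] Q_VF[of V] subspace_diff[OF subspace_VF, of V "Q V"]
  by (simp_all add: ker_def rng_def)

lemma homeomorphic_maps_split: "homeomorphic_maps VF_topology FG split join"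
  unfolding homeomorphic_maps_def topspace_FG topspace_VF_topology
proof (intro conjI ballI)
  have c: "continuous_map VF_topology Cinf_topology (\<lambda>V. V - Q V)" "continuous_map VF_topology Cinf_topology Q"
    using continuous_map_VF_imp_Cinf continuous_map_complement Q_continuous by auto
  show "continuous_map VF_topology FG split"
    unfolding split_def
    by (intro continuous_map_pairedI continuous_map_into_subtopology c) (use split_in in auto)
  have sub: "continuous_map FG F fst" "continuous_map FG G snd"
    by (rule continuous_map_fst, rule continuous_map_snd)
  have "continuous_map FG VF_topology fst" "continuous_map FG VF_topology snd"
    using continuous_map_into_subtopology[of FG Cinf_topology fst VF] continuous_map_into_subtopology[of FG Cinf_topology snd VF]
      sub[THEN continuous_map_into_fulltopology]
    by (simp_all add: VF_topology_def topspace_FG ker_def rng_def Pi_iff)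
  from continuous_map_VF_combination[OF this, of "\<lambda>_. 1"]
  show "continuous_map FG VF_topology join" by (simp add: join_def[abs_def])
  show "join (split V) = V" for V by (simp add: join_def split_def)
  fix p assume p: "p \<in> ker \<times> rng"
  then have "Q (fst p + snd p) = snd p"
    using Q_add[of "fst p" "snd p"] by (auto simp: ker_def rng_def)
  then show "split (join p) = p" by (simp add: split_def join_def prod_eq_iff)
qed

lemma split_image_eq:
  assumes "R \<subseteq> VF" shows "split ` R = {p \<in> topspace FG. join p \<in> R}"
proof (intro equalityI subsetI)
  fix p assume "p \<in> split ` R"
  then show "p \<in> {p \<in> topspace FG. join p \<in> R}"
    using homeomorphic_maps_split continuous_map_image_subset_topspace[of VF_topology FG split] assms
    unfolding homeomorphic_maps_def by auto
next
  fix p assume p: "p \<in> {p \<in> topspace FG. join p \<in> R}"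
  have "\<forall>p\<in>topspace FG. split (join p) = p"
    using homeomorphic_maps_split unfolding homeomorphic_maps_def by blast
  then have "split (join p) = p" using p by blast
  then show "p \<in> split ` R" using p by (metis (no_types, lifting) imageI mem_Collect_eq)
qed

text \<open>\<open>split\<close> and its inverse \<open>join\<close> are continuous and linear, so
  composing with them preserves smoothness of transitions in both directions.\<close>

lemma smooth_chart_split:
  assumes ch: "chart Diff_topology VF_topology U \<phi>"
    and co: "\<And>V \<psi>. (V, \<psi>) \<in> Diff_atlas \<Longrightarrow> charts_compatible VF_topology U \<phi> VF_topology V \<psi>"
  shows "smooth_chart Diff_topology VF_topology Diff_atlas FG U (split \<circ> \<phi>)"
proof -
  have U: "openin Diff_topology U" "openin VF_topology (\<phi> ` U)"
    "homeomorphic_map (subtopology Diff_topology U) (subtopology VF_topology (\<phi> ` U)) \<phi>"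
    using ch by (auto simp: chart_def)
  have UVF: "\<phi> ` U \<subseteq> VF" using openin_subset[OF U(2)] by simp
  have cj: "continuous_map FG VF_topology join" and cs: "continuous_map VF_topology FG split"
    and js: "\<And>V. V \<in> VF \<Longrightarrow> join (split V) = V"
    using homeomorphic_maps_split by (auto simp: homeomorphic_maps_def)
  have tsU: "topspace (subtopology Diff_topology U) = U" using openin_subset[OF U(1)] by (simp add: inf_absorb2)
  have inj: "inj_on \<phi> U" using homeomorphic_imp_injective_map[OF U(3)] unfolding tsU .
  have injs: "inj_on (split \<circ> \<phi>) U"
    using inj UVF js by (auto simp: inj_on_def) (metis image_subset_iff)
  have "openin FG {p \<in> topspace FG. join p \<in> \<phi> ` U}" by (rule openin_continuous_map_preimage[OF cj U(2)])
  then have oim: "openin FG ((split \<circ> \<phi>) ` U)" unfolding image_comp[symmetric] split_image_eq[OF UVF] .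
  have hs: "homeomorphic_map VF_topology FG split" using homeomorphic_maps_split homeomorphic_maps_map by blast
  have "homeomorphic_map (subtopology VF_topology (\<phi> ` U)) (subtopology FG (split ` \<phi> ` U)) split"
  proof (rule homeomorphic_map_subtopologies[OF hs])
    have "split ` \<phi> ` U \<subseteq> topspace FG" using split_image_eq[OF UVF] by auto
    then show "split ` (topspace VF_topology \<inter> \<phi> ` U) = topspace FG \<inter> split ` \<phi> ` U"
      using UVF by (simp add: inf_absorb2)
  qed
  from homeomorphic_map_compose[OF U(3) this]
  have hm: "homeomorphic_map (subtopology Diff_topology U) (subtopology FG ((split \<circ> \<phi>) ` U)) (split \<circ> \<phi>)"
    by (simp only: image_comp)
  have inv: "inv_into U (split \<circ> \<phi>) p = inv_into U \<phi> (join p)" if p: "p \<in> (split \<circ> \<phi>) ` U" for p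
  proof -
    obtain u where u: "u \<in> U" "p = split (\<phi> u)" using p by auto
    then have "join p = \<phi> u" using js UVF by auto
    then show ?thesis using u inv_into_f_f[OF injs u(1)] inv_into_f_f[OF inj u(1)] by simp
  qed
  have "charts_compatible FG U (split \<circ> \<phi>) VF_topology V \<psi>" if V: "(V, \<psi>) \<in> Diff_atlas" for V \<psi>
    unfolding charts_compatible_def
  proof
    have t: "frechet_smooth VF_topology VF_topology (\<phi> ` (U \<inter> V)) (\<lambda>v. \<psi> (inv_into U \<phi> v))"
      "frechet_smooth VF_topology VF_topology (\<psi> ` (U \<inter> V)) (\<lambda>w. \<phi> (inv_into V \<psi> w))"
      using co[OF V] by (auto simp: charts_compatible_def)
    have "frechet_smooth FG VF_topology {p \<in> topspace FG. join p \<in> \<phi> ` (U \<inter> V)} (\<lambda>p. \<psi> (inv_into U \<phi> (join p)))"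
      by (rule frechet_smooth_precompose_linear[OF t(1) cj subspace_FG]) (simp_all add: join_def algebra_simps)
    moreover have "\<phi> ` (U \<inter> V) \<subseteq> VF" using UVF by auto
    ultimately have "frechet_smooth FG VF_topology ((split \<circ> \<phi>) ` (U \<inter> V)) (\<lambda>p. \<psi> (inv_into U \<phi> (join p)))"
      unfolding image_comp[symmetric] by (simp only: split_image_eq)
    then show "frechet_smooth FG VF_topology ((split \<circ> \<phi>) ` (U \<inter> V)) (\<lambda>p. \<psi> (inv_into U (split \<circ> \<phi>) p))"
    proof (rule frechet_smooth_cong)
      fix p assume "p \<in> (split \<circ> \<phi>) ` (U \<inter> V)"
      then have "p \<in> (split \<circ> \<phi>) ` U" by blast
      then show "\<psi> (inv_into U \<phi> (join p)) = \<psi> (inv_into U (split \<circ> \<phi>) p)" by (simp only: inv)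
    qed
    have "frechet_smooth VF_topology FG (\<psi> ` (U \<inter> V)) (\<lambda>w. split (\<phi> (inv_into V \<psi> w)))"
    proof (rule frechet_smooth_postcompose_linear[OF t(2) cs])
      show "split (x - y) = split x - split y" if "x \<in> topspace VF_topology" "y \<in> topspace VF_topology" for x y
        using that Q_diff[of x y] by (simp add: split_def)
      show "split (c *\<^sub>R x) = c *\<^sub>R split x" if "x \<in> topspace VF_topology" for c x
        using that Q_scaleR[of x c] by (simp add: split_def scaleR_diff_right)
    qed (simp add: subspace_VF)
    then show "frechet_smooth VF_topology FG (\<psi> ` (U \<inter> V)) (\<lambda>w. (split \<circ> \<phi>) (inv_into V \<psi> w))" by simp
  qed
  then show ?thesis unfolding smooth_chart_def chart_def using U(1) oim hm by blast
qed

lemma split_in_F_iff: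
  assumes "V \<in> VF" shows "split V \<in> topspace F \<times> {0} \<longleftrightarrow> Q V = 0"
  unfolding topspace_F split_def using split_in[OF assms] by simp

end

section \<open>The submanifold charts\<close>

context hopf begin

sublocale proj: VF_projection nonbasic
  by standard (auto simp only: continuous_map_nonbasic nonbasic_add nonbasic_scaleR nonbasic_idem)

text \<open>\<open>AutH\<close> is a group containing f, so g may be replaced by g composed with the
  inverse of f. The field \<open>hopf.chart_log f g\<close> describes exactly this diffeomorphism
  near the identity.\<close>

lemma AutH_in_chart:
  assumes f: "f \<in> AutH" and g: "g \<in> hopf.chart_dom f"
  shows "g \<in> AutH \<longleftrightarrow> nonbasic (hopf.chart_log f g) = 0"
proof -
  have fD: "f \<in> Diff" using f by (simp add: AutH_def)
  have gD: "g \<in> Diff" using g by (simp add: hopf.chart_dom_def)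
  define k where "k = compose_S3 g (inv_S3 f)"
  have kD: "k \<in> Diff" unfolding k_def by (rule compose_S3_Diff[OF gD inv_S3_Diff[OF fD]])
  have "g = compose_S3 k f" unfolding k_def using compose_S3_inv_cancel(1)[OF fD Diff_D(1)[OF gD]] by simp
  then have "g \<in> AutH \<longleftrightarrow> k \<in> AutH"
    using AutH_compose[OF f, of k] AutH_compose[OF AutH_inverse[OF f], of g] by (auto simp: k_def)
  moreover have V: "hopf.chart_log f g \<in> VF" using hopf.chart_log_in_range(2)[OF fD g] by (simp add: hopf.chart_range_def)
  have "k x = hopf_exp (x, hopf.chart_log f g x)" if x: "x \<in> S3" for x
  proof -
    have i: "inv_S3 f x \<in> S3" "f (inv_S3 f x) = x" using inv_S3[OF fD x] by auto
    have "(f (inv_S3 f x), g (inv_S3 f x)) \<in> hopf_log_dom" using g i(1) unfolding hopf.chart_dom_def by blast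
    then have "(x, g (inv_S3 f x)) \<in> hopf_log_dom" unfolding i(2) .
    from hopf.L[OF x Diff_D(4)[OF gD i(1)] this] show ?thesis using x by (simp add: hopf.chart_log_def k_def compose_S3_def)
  qed
  from AutH_iff_equivariant[OF kD V this] nonbasic_eq_0_iff[OF V]
  have "k \<in> AutH \<longleftrightarrow> nonbasic (hopf.chart_log f g) = 0" by simp
  ultimately show ?thesis by simp
qed

lemma frechet_submanifold_AutH: "frechet_submanifold Diff_topology VF_topology Diff_atlas AutH"
  unfolding frechet_submanifold_def
proof (intro conjI ballI frechet_manifold_Diff closedin_AutH)
  fix f assume f: "f \<in> AutH"
  then have fD: "f \<in> Diff" by (simp add: AutH_def)
  let ?U = "hopf.chart_dom f" and ?\<phi> = "hopf.chart_log f"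
  have co: "charts_compatible VF_topology ?U ?\<phi> VF_topology V \<psi>" if V: "(V, \<psi>) \<in> Diff_atlas" for V \<psi>
  proof -
    obtain h where h: "h \<in> Diff" "V = local_addition.chart_dom log_dom h"
      "\<And>g. g \<in> local_addition.chart_dom log_dom h \<Longrightarrow> \<psi> g = local_addition.chart_log log_map h g"
      using V by (rule Diff_atlasE) (rule that)
    have "two_local_additions hopf_exp hopf_log UNIV hopf_log_dom exp_map log_map exp_dom log_dom"
      by (intro two_local_additions.intro hopf.local_addition_axioms std.local_addition_axioms)
    from charts_compatible_local_additions[OF this fD h(1) refl h(3)]
    show ?thesis using h(2) by simp
  qed
  have sc: "smooth_chart Diff_topology VF_topology Diff_atlas proj.FG ?U (proj.split \<circ> ?\<phi>)"
    by (rule proj.smooth_chart_split[OF hopf.chart_chart_log[OF fD refl] co])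
  have "0 < f x \<bullet> f x" if "x \<in> S3" for x using Diff_D(4)[OF fD that] unfolding S3_inner by simp
  then have fU: "f \<in> ?U" using fD unfolding hopf.chart_dom_def by (simp add: hopf_log_dom_def)
  have iff: "g \<in> AutH \<longleftrightarrow> (proj.split \<circ> ?\<phi>) g \<in> topspace proj.F \<times> {0}" if g: "g \<in> ?U" for g
  proof -
    have "?\<phi> g \<in> VF" using hopf.chart_log_in_range(2)[OF fD g] by (simp add: hopf.chart_range_def)
    then show ?thesis using AutH_in_chart[OF f g] proj.split_in_F_iff by simp
  qed
  show "\<exists>(F :: (real^4 \<Rightarrow> real^4) topology) (G :: (real^4 \<Rightarrow> real^4) topology) U \<phi>. frechet_space F \<and> frechet_space G \<and>
      smooth_chart Diff_topology VF_topology Diff_atlas (prod_topology F G) U \<phi> \<and>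
      f \<in> U \<and> (\<forall>y\<in>U. (y \<in> AutH) = (\<phi> y \<in> topspace F \<times> {0}))"
    by (rule exI[of _ proj.F], rule exI[of _ proj.G], rule exI[of _ ?U], rule exI[of _ "proj.split \<circ> ?\<phi>"])
      (intro conjI ballI proj.frechet_space_F proj.frechet_space_G sc fU iff)
qed

end

theorem theorem2:
  fixes H :: "(real^4) set set"
  assumes "hopf_fibration H"
  shows "frechet_submanifold Diff_topology VF_topology Diff_atlas (Aut H)"
proof -
  obtain J where J: "orthogonal_complex_structure J" "H = {S3 \<inter> L | L. L \<in> complex_lines J}"
    using assms unfolding hopf_fibration_def by blast
  interpret hopf J by standard (rule J(1))
  show ?thesis unfolding J(2) Aut_eq by (rule frechet_submanifold_AutH)
qed

end
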